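(* Let $(X,\rho)$ be a compact metric space carrying an Ahlfors $t$-regular Borel probability measure $\mu$, $0<t<\infty$, let $(r_n)_{n\in\mathbb{N}}$ be a decreasing sequence of positive numbers tending to zero, let $E(\mathbf{x})=\limsup_{n\to\infty}B(x_n,r_n)$ for $\mathbf{x}=(x_n)_{n\in\mathbb{N}}\in\Omega=X^{\mathbb{N}}$, and let $$\alpha=\min\Bigl\{t,\limsup_{n\to\infty}\frac{\log n}{-\log r_n}\Bigr\}.$$ If $F\subset X$ is analytic, then for $\mathbb{P}$-almost every $\mathbf{x}\in\Omega$, $$\max\{0,\alpha+\dim_{\mathrm H}F-t\}\le\dim_{\mathrm H}(E(\mathbf{x})\cap F)\le\max\{0,\alpha+\dim_{\mathrm P}F-t\}.$$
   Context: $\mu$ is Ahlfors $t$-regular if there is a constant $0<C<\infty$ such that $C^{-1}r^t\le\mu(B(x,r))\le Cr^t$ for all $x\in X$ and $0<r<\operatorname{diam}X$, where $B(x,r)$ is the closed ball with centre $x$ and radius $r$. $X$ has more than one point. $(\Omega,\mathcal A,\mathbb{P})$ is the completion of the infinite product probability space of countably many copies of $(X,\mathcal B(X),\mu)$, where $\mathcal B(X)$ is the Borel $\sigma$-algebra; so the coordinates $x_n$ are independent and distributed according to $\mu$. The covering set is $E(\mathbf{x})=\limsup_{n\to\infty}B(x_n,r_n)=\bigcap_{k=1}^\infty\bigcup_{n=k}^\infty B(x_n,r_n)$. $\dim_{\mathrm H}$ and $\dim_{\mathrm P}$ are Hausdorff and packing dimension with respect to $\rho$; the dimension of the empty set is $0$.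 A set is analytic if it is a continuous image of a Borel set. *)

theory Defs
  imports "HOL-Probability.Probability"
begin

text \<open>
  The metric space \<open>X\<close> is the whole of a type of class \<^class>\<open>metric_space\<close>; dimensions take
  values in \<^typ>\<open>ereal\<close>.
\<close>


section \<open>Hausdorff dimension\<close>

text \<open>
  The value \<open>(diam U)\<^sup>s\<close> with the usual conventions that the empty set contributes \<open>0\<close> and that
  \<open>0\<^sup>0 = 1\<close> for nonempty \<open>U\<close>. The latter has to be spelled out since \<open>0 powr 0 = 0\<close>.
\<close>

definition diam_powr :: "real \<Rightarrow> 'a::metric_space set \<Rightarrow> ennreal" where
  "diam_powr s U =
     (if U = {} then 0 else if s = 0 then 1 else ennreal (diameter U powr s))"

text \<open>Boundedness is required because \<^const>\<open>diameter\<close> is unspecified on unbounded sets.\<close>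

definition hausdorff_premeasure :: "real \<Rightarrow> real \<Rightarrow> 'a::metric_space set \<Rightarrow> ennreal" where
  "hausdorff_premeasure s \<delta> A =
     (INF U \<in> {U :: nat \<Rightarrow> 'a set.
                 A \<subseteq> (\<Union>i. U i) \<and> (\<forall>i. bounded (U i) \<and> diameter (U i) \<le> \<delta>)}.
        \<Sum>i. diam_powr s (U i))"

definition hausdorff_measure :: "real \<Rightarrow> 'a::metric_space set \<Rightarrow> ennreal" where
  "hausdorff_measure s A = (SUP \<delta>\<in>{0<..}. hausdorff_premeasure s \<delta> A)"

definition hausdorff_dim :: "'a::metric_space set \<Rightarrow> ereal" where
  "hausdorff_dim A = Inf {ereal s |s. 0 \<le> s \<and> hausdorff_measure s A = 0}"


section \<open>Packing dimension\<close>

text \<open>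
  A \<open>\<delta>\<close>-packing of \<open>A\<close> is a countable family of pairwise disjoint closed balls centred in \<open>A\<close> with
  radii at most \<open>\<delta>\<close>. Balls are recorded as pairs (centre, radius), since in a general metric space
  a ball does not determine its radius.
\<close>

definition packings :: "real \<Rightarrow> 'a::metric_space set \<Rightarrow> ('a \<times> real) set set" where
  "packings \<delta> A =
     {\<C>. countable \<C> \<and> \<C> \<subseteq> A \<times> {0<..\<delta>} \<and>
          pairwise (\<lambda>(x, \<rho>) (y, \<sigma>). cball x \<rho> \<inter> cball y \<sigma> = {}) \<C>}"

definition packing_premeasure :: "real \<Rightarrow> 'a::metric_space set \<Rightarrow> ennreal" where
  "packing_premeasure s A =
     (INF \<delta>\<in>{0<..}. SUP \<C>\<in>packings \<delta> A. \<Sum>\<^sub>\<infinity>(x, \<rho>)\<in>\<C>. ennreal ((2 * \<rho>) powr s))"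

definition packing_measure :: "real \<Rightarrow> 'a::metric_space set \<Rightarrow> ennreal" where
  "packing_measure s A =
     (INF B \<in> {B :: nat \<Rightarrow> 'a set. A \<subseteq> (\<Union>i. B i)}. \<Sum>i. packing_premeasure s (B i))"

definition packing_dim :: "'a::metric_space set \<Rightarrow> ereal" where
  "packing_dim A = Inf {ereal s |s. 0 \<le> s \<and> packing_measure s A = 0}"


section \<open>Ahlfors regular measures, analytic sets and covering sets\<close>

definition ahlfors_regular :: "real \<Rightarrow> 'a::metric_space measure \<Rightarrow> bool" where
  "ahlfors_regular t \<mu> \<longleftrightarrow>
     (\<exists>C::real. 0 < C \<and>
        (\<forall>x r. 0 < r \<and> r < diameter (UNIV :: 'a set) \<longrightarrow>
           ennreal (inverse C * r powr t) \<le> emeasure \<mu> (cball x r) \<and>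
           emeasure \<mu> (cball x r) \<le> ennreal (C * r powr t)))"

text \<open>
  A set is analytic if it is a continuous image of a Borel subset of some Polish space. HOL cannot
  quantify existentially over the Polish space inside a formula, so it appears as a type argument.
  A theorem assuming \<open>analytic_via TYPE('b) F\<close> for a type variable \<open>'b\<close> of class
  \<^class>\<open>polish_space\<close> holds for every such space, hence for every analytic set \<open>F\<close>.
\<close>

definition analytic_via :: "'b::polish_space itself \<Rightarrow> 'a::topological_space set \<Rightarrow> bool" where
  "analytic_via _ A \<longleftrightarrow>
     (\<exists>(B :: 'b set) f. B \<in> sets borel \<and> continuous_on B f \<and> A = f ` B)"

definition covering_set :: "(nat \<Rightarrow> real) \<Rightarrow> (nat \<Rightarrow> 'a::metric_space) \<Rightarrow> 'a set" where
  "covering_set r x = (\<Inter>k\<in>{1..}. \<Union>n\<in>{k..}. cball (x n) (r n))"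

end

theory Submission
  imports Defs
begin

text \<open>
  Upper bound: a set with finite packing premeasure of order \<open>s\<close> has a \<open>\<rho>\<close>-neighbourhood of measure
  at most a constant times \<open>\<rho> powr (t - s)\<close>. So the expected \<open>u\<close>-dimensional cover sum of the balls that
  meet the set is finite for \<open>u\<close> above the asserted bound, and the balls meeting the set form covers
  that show that its intersection with the limsup set is almost surely null.

  Lower bound: by capacitability for a net content and a flow on the tree of cells, the analytic set
  carries a measure \<open>\<nu>\<close> on a compact subset with finite energy of any order below the Hausdorff
  dimension. The sequence of balls is cut into very sparse blocks, and \<open>\<nu>\<close> is multiplied by the
  normalised counting densities of the blocks. By independence the products have almost constant mass
  and bounded \<open>s\<close>-energy. Hence no compact set that supports all of them has a cover of small
  \<open>s\<close>-dimensional sum, and the points covered by every late block form such a set.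
\<close>


section \<open>Hausdorff measure\<close>

text \<open>Both bounds lose \<open>t - \<alpha>\<close> for the same reason. A normalised ball of
  radius r has second moment of order r^(-t). Averaging r^(-b) independent ones leaves r^(b-t), felt
  only at distances up to 2r, so a measure of finite q-energy keeps finite s-energy for s < q - (t -
  b). Conversely, a set covered by about r^(-s) balls at every small scale r is hit by B(x_n, r_n)
  with probability of order r_n^(t-s), and the series of r_n^(t-s+u) converges once t - s + u
  exceeds the limsup. Equal radii at every scale are what packings provide and Hausdorff covers do
  not. The obstacle is the measure on an analytic set. Capacitability needs continuity along
  increasing sequences of arbitrary sets, which nested cells give. But cells need not be open or
  closed: compactness applies only after swelling them, and limits of points of a cell may leave it.
  Each such step costs a factor, the number of neighbouring cells. Hence the very sparse scales and
  the strict inequalities between all exponents; the latter are removed at the end through rational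
  exponents.\<close>

lemma hausdorff_measure_eq_0_iff:
  "hausdorff_measure s A = 0 \<longleftrightarrow>
    (\<forall>\<delta>>0. \<forall>\<epsilon>>0. \<exists>U :: nat \<Rightarrow> 'a::metric_space set. A \<subseteq> (\<Union>i. U i) \<and>
       (\<forall>i. bounded (U i) \<and> diameter (U i) \<le> \<delta>) \<and> (\<Sum>i. diam_powr s (U i)) < \<epsilon>)"
proof -
  have "hausdorff_measure s A = 0 \<longleftrightarrow> (\<forall>\<delta>>0. hausdorff_premeasure s \<delta> A = 0)"
    unfolding hausdorff_measure_def bot_ennreal[symmetric] SUP_bot_conv(1) by auto
  moreover have "hausdorff_premeasure s \<delta> A = 0 \<longleftrightarrow> (\<forall>\<epsilon>>0. \<exists>U :: nat \<Rightarrow> 'a set. A \<subseteq> (\<Union>i. U i) \<and>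
       (\<forall>i. bounded (U i) \<and> diameter (U i) \<le> \<delta>) \<and> (\<Sum>i. diam_powr s (U i)) < \<epsilon>)" for \<delta>
    unfolding hausdorff_premeasure_def bot_ennreal[symmetric] INF_eq_bot_iff
    by (simp add: bex_simps conj_assoc)
  ultimately show ?thesis by simp
qed

lemma hausdorff_measure_0_cover:
  assumes "hausdorff_measure s A = 0" "0 < \<delta>" "0 < \<epsilon>"
  obtains U :: "nat \<Rightarrow> 'a::metric_space set" where "A \<subseteq> (\<Union>i. U i)"
    "\<And>i. bounded (U i)" "\<And>i. diameter (U i) \<le> \<delta>" "(\<Sum>i. diam_powr s (U i)) < \<epsilon>"
  using assms unfolding hausdorff_measure_eq_0_iff by meson

lemma hausdorff_measure_UN_eq_0:
  fixes A :: "nat \<Rightarrow> 'a::metric_space set"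
  assumes "\<And>i. hausdorff_measure s (A i) = 0"
  shows "hausdorff_measure s (\<Union>i. A i) = 0"
  unfolding hausdorff_measure_eq_0_iff
proof (intro allI impI)
  fix \<delta> :: real and \<epsilon> :: ennreal assume \<delta>: "0 < \<delta>" and \<epsilon>: "0 < \<epsilon>"
  obtain e :: real where e: "0 < e" "ennreal e < \<epsilon>"
    using \<epsilon> by (metis dense ennreal_cases ennreal_less_zero_iff less_top_ennreal not_less_zero top.extremum_strict ennreal_0)
  have "\<exists>U :: nat \<Rightarrow> 'a set. A i \<subseteq> (\<Union>j. U j) \<and> (\<forall>j. bounded (U j) \<and> diameter (U j) \<le> \<delta>) \<and>
      (\<Sum>j. diam_powr s (U j)) < ennreal (e * (1/2) ^ Suc i)" for i
    using assms[of i] \<delta> e unfolding hausdorff_measure_eq_0_iff by simp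
  then obtain U :: "nat \<Rightarrow> nat \<Rightarrow> 'a set" where
    U: "\<And>i. A i \<subseteq> (\<Union>j. U i j)" "\<And>i j. bounded (U i j)" "\<And>i j. diameter (U i j) \<le> \<delta>"
       "\<And>i. (\<Sum>j. diam_powr s (U i j)) < ennreal (e * (1/2) ^ Suc i)"
    by metis
  define V where "V = (\<lambda>n. case_prod U (prod_decode n))"
  have "(\<Sum>n. diam_powr s (V n)) = (\<Sum>n. case_prod (\<lambda>i j. diam_powr s (U i j)) (prod_decode n))"
    by (simp add: V_def split_beta)
  also have "\<dots> = (\<Sum>i. \<Sum>j. diam_powr s (U i j))"
    by (subst suminf_ennreal_2dimen[symmetric]) auto
  also have "\<dots> \<le> (\<Sum>i. ennreal (e * (1/2) ^ Suc i))"
    using U(4) by (intro suminf_le) (auto intro: less_imp_le)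
  also have "\<dots> = ennreal e"
  proof (rule suminf_ennreal_eq)
    show "(\<lambda>i. e * (1/2) ^ Suc i) sums e"
      using sums_mult[OF power_half_series, of e] by simp
  qed (use e in auto)
  finally have "(\<Sum>n. diam_powr s (V n)) < \<epsilon>" using e(2) by simp
  moreover have "(\<Union>i. A i) \<subseteq> (\<Union>n. V n)"
  proof safe
    fix x i assume "x \<in> A i"
    then obtain j where "x \<in> U i j" using U(1) by blast
    then show "x \<in> (\<Union>n. V n)" by (auto simp: V_def intro!: exI[of _ "prod_encode (i, j)"])
  qed
  moreover have "\<forall>n. bounded (V n) \<and> diameter (V n) \<le> \<delta>"
    using U(2,3) by (auto simp: V_def split_beta)
  ultimately show "\<exists>U. (\<Union>i. A i) \<subseteq> (\<Union>i. U i) \<and> (\<forall>i. bounded (U i) \<and> diameter (U i) \<le> \<delta>) \<and>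
      (\<Sum>i. diam_powr s (U i)) < \<epsilon>" by blast
qed

lemma diam_powr_mono_exponent:
  assumes "0 \<le> s'" "s' \<le> s" "bounded U" "diameter U \<le> 1"
  shows "diam_powr s U \<le> diam_powr s' U"
proof (cases "U = {}")
  case False
  have d: "0 \<le> diameter U" using assms(3) by (rule diameter_ge_0)
  have "diameter U powr s \<le> diameter U powr s'"
    using d assms by (intro powr_mono') auto
  \<comment> \<open>For \<open>s' = 0\<close> the right-hand side is \<open>1\<close>, while
    \<open>0 powr 0 = 0\<close> for a single point.\<close>
  moreover have "diameter U powr s \<le> 1"
    using d assms by (intro powr_le1) auto
  ultimately show ?thesis using False assms by (auto simp: diam_powr_def intro!: ennreal_leI)
qed (simp add: diam_powr_def)

lemma hausdorff_dim_le:
  "0 \<le> s \<Longrightarrow> hausdorff_measure s A = 0 \<Longrightarrow> hausdorff_dim A \<le> ereal s"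
  unfolding hausdorff_dim_def by (rule Inf_lower) auto

lemma hausdorff_dim_nonneg: "0 \<le> hausdorff_dim A"
  unfolding hausdorff_dim_def by (rule Inf_greatest) auto

lemma hausdorff_measure_mono:
  "A \<subseteq> B \<Longrightarrow> hausdorff_measure s B = 0 \<Longrightarrow> hausdorff_measure s A = 0"
  unfolding hausdorff_measure_eq_0_iff by (meson order_trans)

lemma diameter_le_dist:
  assumes "\<And>x y. x \<in> S \<Longrightarrow> y \<in> S \<Longrightarrow> dist x y \<le> d" "0 \<le> d"
  shows "diameter S \<le> d"
  unfolding diameter_def using assms by (auto intro!: cSUP_least)

lemma diam_powr_le:
  assumes "U \<subseteq> cball x e" "0 < s" "0 < e"
  shows "diam_powr s U \<le> ennreal ((2 * e) powr s)"
proof (cases "U = {}")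
  case False
  have "diameter U \<le> 2 * e"
  proof (rule diameter_le_dist)
    fix y z assume "y \<in> U" "z \<in> U"
    then have "dist x y \<le> e" "dist x z \<le> e" using assms(1) by auto
    then show "dist y z \<le> 2 * e" using dist_triangle3[of y z x] by simp
  qed (use assms(3) in simp)
  moreover have "0 \<le> diameter U"
    using assms(1) by (intro diameter_ge_0) (auto intro: bounded_subset)
  ultimately show ?thesis using False assms
    by (auto simp: diam_powr_def intro!: ennreal_leI powr_mono2)
qed (simp add: diam_powr_def)

text \<open>
  Covers are swollen to open ones so that compactness applies; the size parameters \<open>e i\<close> are kept
  positive, unlike diameters.
\<close>

lemma hausdorff_dim_ge_open_cover:
  fixes A :: "'a::metric_space set"
  assumes "0 < s" "0 < \<epsilon>"
    and no: "\<And>U e. A \<subseteq> (\<Union>i::nat. U i) \<Longrightarrow> (\<And>i. open (U i)) \<Longrightarrow> (\<And>i. 0 < e i) \<Longrightarrow>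
       (\<And>i y z. y \<in> U i \<Longrightarrow> z \<in> U i \<Longrightarrow> dist y z \<le> e i) \<Longrightarrow>
       (\<Sum>i. ennreal (e i powr s)) \<le> ennreal \<epsilon> \<Longrightarrow> False"
  shows "ereal s \<le> hausdorff_dim A"
  unfolding hausdorff_dim_def
proof (rule Inf_greatest, safe)
  fix s' assume s': "0 \<le> s'" "hausdorff_measure s' A = 0"
  show "ereal s \<le> ereal s'"
  proof (rule ccontr)
    assume "\<not> ereal s \<le> ereal s'"
    then have "s' < s" by simp
    obtain U where U: "A \<subseteq> (\<Union>i. U i)" "\<And>i. bounded (U i)" "\<And>i. diameter (U i) \<le> 1"
        "(\<Sum>i. diam_powr s' (U i)) < ennreal (\<epsilon> / 2)"
      using hausdorff_measure_0_cover[OF s'(2), of 1 "ennreal (\<epsilon> / 2)"] assms(2) 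
      by (metis ennreal_less_zero_iff half_gt_zero zero_less_one)
    have ex: "\<exists>e>0. diameter (U i) < e \<and> e powr s \<le> diameter (U i) powr s + \<epsilon> / 2 * (1/2) ^ Suc i" for i
    proof -
      let ?d = "diameter (U i)"
      have d: "0 \<le> ?d" using U(2) by (rule diameter_ge_0)
      \<comment> \<open>\<open>max 0\<close> keeps the base nonnegative around \<open>?d\<close>, as
        continuity of the power needs if \<open>?d = 0\<close>.\<close>
      have "isCont (\<lambda>x. (max 0 x) powr s) ?d" using assms(1)
        by (intro continuous_intros) auto
      then have "\<forall>\<^sub>F x in at ?d. (max 0 x) powr s < ?d powr s + \<epsilon> / 2 * (1/2) ^ Suc i"
        using d assms(2) unfolding isCont_def by (intro order_tendstoD) auto
      then have "\<forall>\<^sub>F x in at_right ?d. (max 0 x) powr s < ?d powr s + \<epsilon> / 2 * (1/2) ^ Suc i"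
        by (rule filter_leD[rotated]) (simp add: at_le)
      then have "\<forall>\<^sub>F x in at_right ?d. x > ?d \<and> (max 0 x) powr s < ?d powr s + \<epsilon> / 2 * (1/2) ^ Suc i"
        by (intro eventually_conj eventually_at_right_less)
      then obtain e where "e > ?d" "(max 0 e) powr s < ?d powr s + \<epsilon> / 2 * (1/2) ^ Suc i"
        using eventually_happens'[OF trivial_limit_at_right_real] by blast
      then show ?thesis using d by (intro exI[of _ e]) auto
    qed
    obtain e where e: "\<And>i. 0 < e i" "\<And>i. diameter (U i) < e i"
        "\<And>i. e i powr s \<le> diameter (U i) powr s + \<epsilon> / 2 * (1/2) ^ Suc i"
      using ex by metis
    \<comment> \<open>Half the gap between the diameter and \<open>e i\<close> on either side keeps
      all distances within \<open>e i\<close>.\<close>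
    define V where "V i = (\<Union>x\<in>U i. ball x ((e i - diameter (U i)) / 2))" for i
    \<comment> \<open>An empty piece contributes \<open>0\<close> but needs a positive size; its
      power is exactly the error allotted to index \<open>i\<close>.\<close>
    define e' where "e' i = (if U i = {} then (\<epsilon> / 2 * (1/2) ^ Suc i) powr (1/s) else e i)" for i
    have le: "ennreal (e' i powr s) \<le> diam_powr s' (U i) + ennreal (\<epsilon> / 2 * (1/2) ^ Suc i)" for i
    proof (cases "U i = {}")
      case True
      then show ?thesis using assms by (simp add: e'_def diam_powr_def powr_powr)
    next
      case False
      have "ennreal (e' i powr s) \<le> ennreal (diameter (U i) powr s + \<epsilon> / 2 * (1/2) ^ Suc i)"
        using e(3)[of i] False unfolding e'_def by (intro ennreal_leI) simp
      also have "\<dots> = diam_powr s (U i) + ennreal (\<epsilon> / 2 * (1/2) ^ Suc i)"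
        using False assms by (subst ennreal_plus) (auto simp: diam_powr_def)
      also have "\<dots> \<le> diam_powr s' (U i) + ennreal (\<epsilon> / 2 * (1/2) ^ Suc i)"
        by (intro add_right_mono diam_powr_mono_exponent) (use s' \<open>s' < s\<close> U in auto)
      finally show ?thesis .
    qed
    show False
    proof (rule no[of V e'])
      show "A \<subseteq> (\<Union>i. V i)"
      proof
        fix x assume "x \<in> A"
        then obtain i where "x \<in> U i" using U(1) by blast
        then have "x \<in> V i" using e(2)[of i] unfolding V_def by force
        then show "x \<in> (\<Union>i. V i)" by blast
      qed
      show "open (V i)" for i unfolding V_def by auto
      show "0 < e' i" for i using e(1) assms(2) by (simp add: e'_def)
      show "dist y z \<le> e' i" if yz: "y \<in> V i" "z \<in> V i" for i y z
      proof -
        obtain y' z' where yz': "y' \<in> U i" "dist y' y < (e i - diameter (U i)) / 2"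
           "z' \<in> U i" "dist z' z < (e i - diameter (U i)) / 2"
          using yz unfolding V_def by auto
        have "dist y' z' \<le> diameter (U i)"
          using yz' U(2) by (intro diameter_bounded_bound)
        moreover have "dist y z \<le> dist y' y + dist y' z' + dist z' z"
          by (smt (verit) dist_commute dist_triangle)
        ultimately show ?thesis using yz' by (auto simp: e'_def)
      qed
      have "(\<Sum>i. ennreal (e' i powr s)) \<le> (\<Sum>i. diam_powr s' (U i) + ennreal (\<epsilon> / 2 * (1/2) ^ Suc i))"
        by (intro suminf_le le) auto
      also have "\<dots> = (\<Sum>i. diam_powr s' (U i)) + (\<Sum>i. ennreal (\<epsilon> / 2 * (1/2) ^ Suc i))"
        by (rule suminf_add[symmetric]) auto
      also have "(\<Sum>i. ennreal (\<epsilon> / 2 * (1/2) ^ Suc i)) = ennreal (\<epsilon> / 2)"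
      proof (rule suminf_ennreal_eq)
        show "(\<lambda>i. \<epsilon> / 2 * (1/2) ^ Suc i) sums (\<epsilon> / 2)"
          using sums_mult[OF power_half_series, of "\<epsilon> / 2"] by simp
      qed (use assms in auto)
      also have "(\<Sum>i. diam_powr s' (U i)) + ennreal (\<epsilon> / 2) \<le> ennreal (\<epsilon> / 2) + ennreal (\<epsilon> / 2)"
        using U(4) by (intro add_right_mono) simp
      also have "\<dots> = ennreal \<epsilon>" using assms by (subst ennreal_plus[symmetric]) auto
      finally show "(\<Sum>i. ennreal (e' i powr s)) \<le> ennreal \<epsilon>" .
    qed
  qed
qed


section \<open>Net contents\<close>

text \<open>
  A list of naturals stands for a cell of the common refinement of the partitions into the level
  sets of \<open>a 0\<close>, \<open>a 1\<close>, \<dots>; the cells containing \<open>x\<close> are the lists \<open>code a x n\<close>, so cells are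
  ordered like a tree.
\<close>

definition code :: "(nat \<Rightarrow> 'a \<Rightarrow> nat) \<Rightarrow> 'a \<Rightarrow> nat \<Rightarrow> nat list" where
  "code a x n = map (\<lambda>i. a i x) [0..<n]"

definition code_covers :: "(nat \<Rightarrow> 'a \<Rightarrow> nat) \<Rightarrow> nat list set \<Rightarrow> 'a set \<Rightarrow> bool" where
  "code_covers a U A \<longleftrightarrow> (\<forall>x\<in>A. \<exists>n. code a x n \<in> U)"

text \<open>This is the sum of \<open>w (length P)\<close> over \<open>P\<close> in
  \<open>U\<close>. As a measure it is additive and continuous from below on arbitrary sets of
  nodes.\<close>

definition weight :: "(nat \<Rightarrow> ennreal) \<Rightarrow> nat list set \<Rightarrow> ennreal" where
  "weight w U = emeasure (density (count_space UNIV) (\<lambda>P. w (length P))) U"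

text \<open>Nodes of all lengths compete, even \<open>[]\<close>, so the content is at most
  \<open>w 0\<close>. For the weights used later this does not affect vanishing of the content,
  because short nodes are heavy.\<close>

definition net_content :: "(nat \<Rightarrow> 'a \<Rightarrow> nat) \<Rightarrow> (nat \<Rightarrow> ennreal) \<Rightarrow> 'a set \<Rightarrow> ennreal" where
  "net_content a w A = (INF U\<in>{U. code_covers a U A}. weight w U)"

definition cyl :: "(nat \<Rightarrow> 'a \<Rightarrow> nat) \<Rightarrow> 'a set \<Rightarrow> nat list \<Rightarrow> 'a set" where
  "cyl a A P = {x\<in>A. code a x (length P) = P}"

lemma length_code [simp]: "length (code a x n) = n"
  by (simp add: code_def)

lemma code_0 [simp]: "code a x 0 = []"
  by (simp add: code_def)

lemma code_Suc: "code a x (Suc n) = code a x n @ [a n x]"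
  by (simp add: code_def)

lemma take_code: "m \<le> n \<Longrightarrow> take m (code a x n) = code a x m"
  by (simp add: code_def take_map)

lemma weight_mono: "U \<subseteq> V \<Longrightarrow> weight w U \<le> weight w V"
  unfolding weight_def by (rule emeasure_mono) auto

lemma weight_Un_le: "weight w (U \<union> V) \<le> weight w U + weight w V"
  unfolding weight_def by (rule emeasure_subadditive) auto

lemma weight_disjoint_Un: "U \<inter> V = {} \<Longrightarrow> weight w (U \<union> V) = weight w U + weight w V"
  unfolding weight_def by (rule plus_emeasure[symmetric]) auto

lemma weight_singleton: "weight w {P} = w (length P)"
  unfolding weight_def by (subst emeasure_density) (auto simp: nn_integral_indicator_singleton)

lemma weight_ge: "P \<in> U \<Longrightarrow> w (length P) \<le> weight w U"
  using weight_mono[of "{P}" U w] by (simp add: weight_singleton)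

lemma net_content_le: "code_covers a U A \<Longrightarrow> net_content a w A \<le> weight w U"
  unfolding net_content_def by (rule INF_lower) auto

lemma net_content_mono: "A \<subseteq> B \<Longrightarrow> net_content a w A \<le> net_content a w B"
  unfolding net_content_def by (rule INF_superset_mono) (auto simp: code_covers_def)

lemma net_content_approx:
  assumes "net_content a w A < \<infinity>" "0 < e"
  obtains U where "code_covers a U A" "weight w U < net_content a w A + ennreal e"
proof -
  have "\<exists>U\<in>{U. code_covers a U A}. weight w U < net_content a w A + ennreal e"
  proof (rule INF_approx_ennreal[OF assms(2)])
    show "net_content a w A \<noteq> \<infinity>" using assms(1) by auto
  qed (rule net_content_def)
  then show thesis using that by blast
qed

lemma net_content_empty [simp]: "net_content a w {} = 0"
  using net_content_le[of a "{}" "{}" w] by (simp add: code_covers_def weight_def)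

lemma net_content_Un_le: "net_content a w (A \<union> B) \<le> net_content a w A + net_content a w B"
proof (rule ennreal_le_epsilon)
  fix e :: real assume fin: "net_content a w A + net_content a w B < top" and e: "0 < e"
  obtain U where U: "code_covers a U A" "weight w U < net_content a w A + ennreal (e/2)"
    using net_content_approx[of a w A "e/2"] fin e by auto
  obtain V where V: "code_covers a V B" "weight w V < net_content a w B + ennreal (e/2)"
    using net_content_approx[of a w B "e/2"] fin e by auto
  have "net_content a w (A \<union> B) \<le> weight w (U \<union> V)"
    using U V by (intro net_content_le) (auto simp: code_covers_def)
  also have "\<dots> \<le> weight w U + weight w V" by (rule weight_Un_le)
  also have "\<dots> \<le> (net_content a w A + ennreal (e/2)) + (net_content a w B + ennreal (e/2))"
    using U V by (intro add_mono) auto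
  also have "\<dots> = net_content a w A + net_content a w B + (ennreal (e/2) + ennreal (e/2))"
    by (simp add: ac_simps)
  also have "ennreal (e/2) + ennreal (e/2) = ennreal e"
    using e by (subst ennreal_plus[symmetric]) auto
  finally show "net_content a w (A \<union> B) \<le> net_content a w A + net_content a w B + ennreal e" .
qed

lemma net_content_UN_le:
  "finite I \<Longrightarrow> net_content a w (\<Union>i\<in>I. A i) \<le> (\<Sum>i\<in>I. net_content a w (A i))"
  by (induction I rule: finite_induct)
     (auto intro: order_trans[OF net_content_Un_le] add_left_mono)

lemma net_content_cyl_le: "net_content a w (cyl a A P) \<le> w (length P)"
  using net_content_le[of a "{P}" "cyl a A P" w] by (auto simp: code_covers_def cyl_def weight_singleton)

lemma net_content_cyl_children:
  assumes "\<And>x. a (length P) x < N"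
  shows "net_content a w (cyl a A P) \<le> (\<Sum>i<N. net_content a w (cyl a A (P @ [i])))"
proof -
  have "cyl a A P \<subseteq> (\<Union>i<N. cyl a A (P @ [i]))"
    using assms by (auto simp: cyl_def code_Suc)
  from net_content_mono[OF this] net_content_UN_le[of "{..<N}"] show ?thesis
    by (rule order_trans) auto
qed

text \<open>Maximality refers to cells, so these are the shortest lists along each branch of the
  tree.\<close>

definition maximal_nodes :: "nat list set \<Rightarrow> nat list set" where
  "maximal_nodes U = {P \<in> U. \<forall>k<length P. take k P \<notin> U}"

lemma maximal_nodes_subset: "maximal_nodes U \<subseteq> U"
  by (auto simp: maximal_nodes_def)

lemma maximal_nodes_below:
  assumes "code a x n \<in> U"
  obtains m where "m \<le> n" "code a x m \<in> maximal_nodes U"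
proof -
  define m where "m = (LEAST m. code a x m \<in> U)"
  have m: "code a x m \<in> U" unfolding m_def using assms by (rule LeastI)
  have mn: "m \<le> n" unfolding m_def using assms by (rule Least_le)
  have "code a x k \<notin> U" if "k < m" for k
    using that unfolding m_def by (rule not_less_Least)
  then have "code a x m \<in> maximal_nodes U"
    using m by (auto simp: maximal_nodes_def take_code)
  with mn show thesis by (rule that)
qed

lemma code_covers_maximal: "code_covers a U A \<Longrightarrow> code_covers a (maximal_nodes U) A"
  unfolding code_covers_def by (metis maximal_nodes_below)

text \<open>
  Strong subadditivity: of two nodes containing the same point one contains the other, so the nodes
  discarded when passing to the maximal nodes of \<open>U \<union> V\<close> still cover.
\<close>

lemma weight_maximal_nodes:
  assumes "code_covers a U A" "code_covers a V A"
  shows "weight w (maximal_nodes (U \<union> V)) + net_content a w A \<le> weight w U + weight w V"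
proof -
  let ?W = "U \<union> V" and ?M = "maximal_nodes (U \<union> V)"
  have "code_covers a ((?W - ?M) \<union> (U \<inter> V)) A"
    unfolding code_covers_def
  proof
    fix x assume "x \<in> A"
    then obtain n m where nm: "code a x n \<in> U" "code a x m \<in> V"
      using assms unfolding code_covers_def by metis
    consider "n = m" | "n < m" | "m < n" by linarith
    then show "\<exists>n. code a x n \<in> (?W - ?M) \<union> (U \<inter> V)"
    proof cases
      case 2
      then have "code a x m \<notin> ?M" using nm by (auto simp: maximal_nodes_def take_code)
      then show ?thesis using nm by blast
    next
      case 3
      then have "code a x n \<notin> ?M" using nm by (auto simp: maximal_nodes_def take_code)
      then show ?thesis using nm by blast
    qed (use nm in auto)
  qed
  then have "net_content a w A \<le> weight w (?W - ?M) + weight w (U \<inter> V)"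
    by (rule order_trans[OF net_content_le weight_Un_le])
  then have "weight w ?M + net_content a w A \<le> weight w ?M + weight w (?W - ?M) + weight w (U \<inter> V)"
    by (simp add: add.assoc add_left_mono)
  also have "weight w ?M + weight w (?W - ?M) = weight w ?W"
    using maximal_nodes_subset[of ?W] by (subst weight_disjoint_Un[symmetric]) (auto intro!: arg_cong[of _ _ "weight w"])
  also have "weight w ?W = weight w U + weight w (V - U)"
    by (subst weight_disjoint_Un[symmetric]) auto
  also have "\<dots> + weight w (U \<inter> V) = weight w U + (weight w (V - U) + weight w (U \<inter> V))"
    by (simp add: add.assoc)
  also have "weight w (V - U) + weight w (U \<inter> V) = weight w V"
    by (subst weight_disjoint_Un[symmetric]) (auto intro!: arg_cong[of _ _ "weight w"])
  finally show ?thesis .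
qed

text \<open>Near-optimal covers are merged one after the other, keeping maximal nodes. Strong
  subadditivity, applied with the content of the smaller set, lets the weight exceed the content of
  \<open>A k\<close> only by a geometric sum of errors. Passing to maximal nodes never lengthens the
  node at a point, so it is eventually constant, and these stable nodes cover the union. The sets
  are arbitrary, as the images in the capacitability argument require.\<close>

lemma net_content_incseq:
  assumes inc: "incseq A"
  shows "net_content a w (\<Union>k. A k) \<le> (SUP k. net_content a w (A k))"
proof (rule ennreal_le_epsilon)
  fix e :: real
  let ?c = "\<lambda>k. net_content a w (A k)"
  let ?S = "SUP k. ?c k"
  assume S: "?S < top" and e: "0 < e"
  have cS: "?c k \<le> ?S" for k by (rule SUP_upper) auto
  then have fin: "?c k < \<infinity>" for k using S by (metis infinity_ennreal_def le_less_trans)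
  have "\<exists>U. code_covers a U (A k) \<and> weight w U < ?c k + ennreal (e * (1/2) ^ Suc k)" for k
    by (rule net_content_approx[OF fin, of "e * (1/2) ^ Suc k" k]) (use e in auto)
  then obtain U where U: "\<And>k. code_covers a (U k) (A k)"
      "\<And>k. weight w (U k) < ?c k + ennreal (e * (1/2) ^ Suc k)" by metis
  define W where "W = rec_nat (U 0) (\<lambda>k V. maximal_nodes (V \<union> U (Suc k)))"
  have W0: "W 0 = U 0" and WS: "W (Suc k) = maximal_nodes (W k \<union> U (Suc k))" for k
    by (auto simp: W_def)
  have cov: "code_covers a (W k) (A k)" for k
  proof (cases k)
    case (Suc n)
    have "code_covers a (W n \<union> U (Suc n)) (A (Suc n))"
      using U(1)[of "Suc n"] by (auto simp: code_covers_def)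
    then show ?thesis unfolding Suc WS by (rule code_covers_maximal)
  qed (simp add: W0 U)
  have bound: "weight w (W k) \<le> ?c k + ennreal (e * (1 - (1/2) ^ Suc k))" for k
  proof (induction k)
    case 0
    show ?case using U(2)[of 0] by (simp add: W0 less_imp_le)
  next
    case (Suc k)
    have "A k \<subseteq> A (Suc k)" using inc by (rule incseq_SucD)
    then have "code_covers a (U (Suc k)) (A k)" using U(1)[of "Suc k"] by (auto simp: code_covers_def)
    from weight_maximal_nodes[OF cov this, of w]
    have "weight w (W (Suc k)) + ?c k \<le> weight w (W k) + weight w (U (Suc k))" by (simp add: WS)
    also have "\<dots> \<le> (?c k + ennreal (e * (1 - (1/2) ^ Suc k))) + (?c (Suc k) + ennreal (e * (1/2) ^ Suc (Suc k)))"
      using U(2)[of "Suc k"] Suc by (intro add_mono) auto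
    also have "\<dots> = (?c (Suc k) + (ennreal (e * (1 - (1/2) ^ Suc k)) + ennreal (e * (1/2) ^ Suc (Suc k)))) + ?c k"
      by (simp add: ac_simps)
    also have "ennreal (e * (1 - (1/2) ^ Suc k)) + ennreal (e * (1/2) ^ Suc (Suc k))
        = ennreal (e * (1 - (1/2) ^ Suc (Suc k)))"
      using e power_le_one[of "1/2::real" "Suc k"] by (subst ennreal_plus[symmetric]) (auto simp: algebra_simps)
    finally show ?case using fin[of k]
      by (auto simp: ennreal_add_left_cancel_le add.commute[of _ "?c k"])
  qed
  have WSle: "weight w (W k) \<le> ?S + ennreal e" for k
  proof -
    have "ennreal (e * (1 - (1/2) ^ Suc k)) \<le> ennreal e"
      using e by (intro ennreal_leI) (auto simp: field_simps)
    with cS[of k] have "?c k + ennreal (e * (1 - (1/2) ^ Suc k)) \<le> ?S + ennreal e" by (intro add_mono)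
    with bound[of k] show ?thesis by (rule order_trans)
  qed
  \<comment> \<open>Nodes present from stage \<open>i\<close> on; the union over \<open>i\<close> is
    the cover sought.\<close>
  define D where "D i = (\<Inter>j\<in>{i..}. W j)" for i
  have "incseq D" by (auto simp: D_def incseq_def)
  have "weight w (\<Union>i. D i) = (SUP i. weight w (D i))"
    unfolding weight_def using \<open>incseq D\<close> by (subst SUP_emeasure_incseq) auto
  also have "\<dots> \<le> ?S + ennreal e"
  proof (rule SUP_least)
    fix i
    have "weight w (D i) \<le> weight w (W i)" by (rule weight_mono) (auto simp: D_def)
    also note WSle
    finally show "weight w (D i) \<le> ?S + ennreal e" .
  qed
  finally have "weight w (\<Union>i. D i) \<le> ?S + ennreal e" .
  moreover have "code_covers a (\<Union>i. D i) (\<Union>k. A k)"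
    unfolding code_covers_def
  proof safe
    fix x k assume x: "x \<in> A k"
    \<comment> \<open>A decreasing sequence of naturals, hence eventually constant.\<close>
    define n where "n j = (LEAST n. code a x n \<in> W j)" for j
    have n: "code a x (n j) \<in> W j" if "j \<ge> k" for j
    proof -
      have "x \<in> A j" using x that inc by (auto simp: incseq_def)
      then have "\<exists>n. code a x n \<in> W j" using cov by (auto simp: code_covers_def)
      then show ?thesis unfolding n_def by (rule LeastI_ex)
    qed
    have dec: "n (Suc j) \<le> n j" if "j \<ge> k" for j
    proof -
      have "code a x (n j) \<in> W j \<union> U (Suc j)" using n[OF that] by simp
      then obtain m where "m \<le> n j" "code a x m \<in> W (Suc j)"
        unfolding WS by (rule maximal_nodes_below)
      moreover from this have "n (Suc j) \<le> m" unfolding n_def by (intro Least_le)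
      ultimately show ?thesis by simp
    qed
    obtain j0 where j0: "j0 \<ge> k" "\<And>j. j \<ge> k \<Longrightarrow> n j0 \<le> n j"
      using ex_has_least_nat[of "\<lambda>j. j \<ge> k" k n] by auto
    have "n j \<le> n j0" if "j \<ge> j0" for j
      using that
    proof (induction j rule: dec_induct)
      case (step i)
      then show ?case using dec[of i] j0(1) by linarith
    qed simp
    then have "n j = n j0" if "j \<ge> j0" for j
      using j0 that by (metis le_antisym le_trans)
    then have "code a x (n j0) \<in> D j0"
      unfolding D_def using n j0(1) by (metis INT_I atLeast_iff order_trans)
    then show "\<exists>n. code a x n \<in> (\<Union>i. D i)" by blast
  qed
  ultimately show "net_content a w (\<Union>k. A k) \<le> ?S + ennreal e"
    by (meson net_content_le order_trans)
qed


section \<open>Analytic sets and capacitability\<close>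

text \<open>
  Baire space appears as \<^typ>\<open>nat \<Rightarrow> nat discrete\<close>, because \<^typ>\<open>nat\<close> itself is no metric space in
  the library.
\<close>

lemma projection_of_closed_UN:
  fixes B :: "nat \<Rightarrow> 'b::topological_space set"
  assumes "\<And>n. \<exists>C :: ('b \<times> (nat \<Rightarrow> nat discrete)) set. closed C \<and> B n = fst ` C"
  shows "\<exists>C :: ('b \<times> (nat \<Rightarrow> nat discrete)) set. closed C \<and> (\<Union>n. B n) = fst ` C"
proof -
  obtain C :: "nat \<Rightarrow> ('b \<times> (nat \<Rightarrow> nat discrete)) set" where C: "\<And>n. closed (C n)" "\<And>n. B n = fst ` C n"
    using assms by metis
  \<comment> \<open>The first entry of the sequence names the index \<open>n\<close>, the rest is a
    witness for \<open>B n\<close>. Written as an intersection of implications, the set is closed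
    because the entries are discrete.\<close>
  define D where "D = (\<Inter>n. (\<lambda>p. snd p 0) -` (- {discrete n}) \<union> (\<lambda>p. (fst p, \<lambda>m. snd p (Suc m))) -` C n)"
  have "continuous_on UNIV (\<lambda>p :: 'b \<times> (nat \<Rightarrow> nat discrete). snd p 0)"
    by (intro continuous_on_product_coordinates[THEN continuous_on_compose2[OF _ continuous_on_snd]])
       (auto intro: continuous_intros)
  moreover have "continuous_on UNIV (\<lambda>p :: 'b \<times> (nat \<Rightarrow> nat discrete). (fst p, \<lambda>m. snd p (Suc m)))"
    by (intro continuous_on_Pair continuous_on_coordinatewise_then_product
        continuous_on_product_coordinates[THEN continuous_on_compose2[OF _ continuous_on_snd]])
       (auto intro: continuous_intros)
  ultimately have "closed D" unfolding D_def
    by (intro closed_INT ballI closed_Un closed_vimage C) (simp_all add: closed_def open_discrete)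
  moreover have "(\<Union>n. B n) = fst ` D"
  proof (intro equalityI subsetI)
    fix x assume "x \<in> (\<Union>n. B n)"
    then obtain n \<sigma> where "(x, \<sigma>) \<in> C n" using C(2) by auto
    then have "(x, case_nat (discrete n) \<sigma>) \<in> D" by (auto simp: D_def discrete_inject)
    then show "x \<in> fst ` D" by force
  next
    fix x assume "x \<in> fst ` D"
    then obtain \<sigma> where \<sigma>: "(x, \<sigma>) \<in> D" by auto
    define n where "n = of_discrete (\<sigma> 0)"
    have "\<sigma> 0 = discrete n" by (simp add: n_def of_discrete_inverse)
    then have "(x, \<lambda>m. \<sigma> (Suc m)) \<in> C n" using \<sigma> by (auto simp: D_def)
    then have "x \<in> B n" unfolding C(2) by force
    then show "x \<in> (\<Union>n. B n)" by blast
  qed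
  ultimately show ?thesis by blast
qed

lemma projection_of_closed_INT:
  fixes B :: "nat \<Rightarrow> 'b::topological_space set"
  assumes "\<And>n. \<exists>C :: ('b \<times> (nat \<Rightarrow> nat discrete)) set. closed C \<and> B n = fst ` C"
  shows "\<exists>C :: ('b \<times> (nat \<Rightarrow> nat discrete)) set. closed C \<and> (\<Inter>n. B n) = fst ` C"
proof -
  obtain C :: "nat \<Rightarrow> ('b \<times> (nat \<Rightarrow> nat discrete)) set" where C: "\<And>n. closed (C n)" "\<And>n. B n = fst ` C n"
    using assms by metis
  \<comment> \<open>Row \<open>n\<close> of the sequence, read through \<open>prod_encode\<close>,
    is the witness for \<open>B n\<close>.\<close>
  define D where "D = (\<Inter>n. (\<lambda>p. (fst p, \<lambda>m. snd p (prod_encode (n, m)))) -` C n)"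
  have "continuous_on UNIV (\<lambda>p :: 'b \<times> (nat \<Rightarrow> nat discrete). (fst p, \<lambda>m. snd p (prod_encode (n, m))))" for n
    by (intro continuous_on_Pair continuous_on_coordinatewise_then_product
        continuous_on_product_coordinates[THEN continuous_on_compose2[OF _ continuous_on_snd]])
       (auto intro: continuous_intros)
  then have "closed D" unfolding D_def
    by (intro closed_INT ballI closed_vimage C)
  moreover have "(\<Inter>n. B n) = fst ` D"
  proof (intro equalityI subsetI)
    fix x assume "x \<in> (\<Inter>n. B n)"
    then have "\<forall>n. \<exists>\<sigma>. (x, \<sigma>) \<in> C n" using C(2) by force
    then obtain \<sigma> where "\<And>n. (x, \<sigma> n) \<in> C n" by metis
    then have "(x, \<lambda>k. case prod_decode k of (n, m) \<Rightarrow> \<sigma> n m) \<in> D" by (auto simp: D_def)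
    then show "x \<in> fst ` D" by force
  qed (auto simp: D_def C(2), force)
  ultimately show ?thesis by blast
qed

lemma projection_of_closed_open:
  fixes S :: "'b::metric_space set"
  assumes "open S"
  shows "\<exists>C :: ('b \<times> (nat \<Rightarrow> nat discrete)) set. closed C \<and> S = fst ` C"
proof -
  define T where "T n = (\<Inter>y\<in>-S. {x. 1 / real (Suc n) \<le> dist x y})" for n :: nat
  have "S = (\<Union>n. T n)"
  proof (intro equalityI subsetI)
    fix x assume "x \<in> S"
    then obtain e where e: "0 < e" "ball x e \<subseteq> S" using assms openE by blast
    obtain n where "1 / real (Suc n) < e" using e(1) nat_approx_posE by blast
    then have "x \<in> T n" using e(2) unfolding T_def by (auto simp: subset_iff) force
    then show "x \<in> (\<Union>n. T n)" by blast
  qed (force simp: T_def)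
  moreover have "closed (T n)" for n
    unfolding T_def by (intro closed_INT ballI closed_Collect_le continuous_intros)
  then have "\<exists>C :: ('b \<times> (nat \<Rightarrow> nat discrete)) set. closed C \<and> T n = fst ` C" for n
    by (intro exI[of _ "T n \<times> UNIV"]) (auto intro: closed_Times)
  ultimately show ?thesis using projection_of_closed_UN[of T] by simp
qed

text \<open>Projections of closed sets are not stable under complements, so the induction over the
  sigma-algebra carries a set and its complement at the same time.\<close>

lemma borel_projection_of_closed:
  fixes B :: "'b::metric_space set"
  assumes "B \<in> sets borel"
  shows "\<exists>C :: ('b \<times> (nat \<Rightarrow> nat discrete)) set. closed C \<and> B = fst ` C"
proof -
  let ?P = "\<lambda>B. \<exists>C :: ('b \<times> (nat \<Rightarrow> nat discrete)) set. closed C \<and> B = fst ` C"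
  have "B \<in> sigma_sets UNIV {S. open S}" using assms by (simp add: borel_def)
  then have "?P B \<and> ?P (- B)"
  proof (induction rule: sigma_sets.induct)
    case (Basic S)
    then have "?P S" using projection_of_closed_open by auto
    moreover have "?P (- S)" using Basic
      by (intro exI[of _ "(- S) \<times> UNIV"]) (auto intro: closed_Times)
    ultimately show ?case by blast
  next
    case Empty
    have "?P {}" by (intro exI[of _ "{}"]) auto
    moreover have "?P (- {})" by (intro exI[of _ UNIV]) auto
    ultimately show ?case by blast
  next
    case (Compl S)
    then show ?case by (simp add: Compl_eq_Diff_UNIV[symmetric])
  next
    case (Union S)
    then show ?case using projection_of_closed_UN[of S] projection_of_closed_INT[of "\<lambda>n. - S n"]
      by (simp add: Compl_UN)
  qed
  then show ?thesis by blast
qed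

text \<open>
  Choquet's argument: \<open>C\<close> is shrunk successively to finite unions of balls of radius \<open>1 / (k + 1)\<close>
  while the capacity of the image stays above \<open>e\<close>. What is left is compact, and every neighbourhood
  of its image already contains the image of some stage.
\<close>

lemma capacitability:
  fixes g :: "'c::{complete_space, second_countable_topology} \<Rightarrow> 'a::metric_space" and cap :: "'a set \<Rightarrow> ennreal"
  assumes C: "closed C" and g: "continuous_on C g"
    and mono: "\<And>A B. A \<subseteq> B \<Longrightarrow> cap A \<le> cap B"
    and inc: "\<And>A :: nat \<Rightarrow> 'a set. incseq A \<Longrightarrow> cap (\<Union>k. A k) \<le> (SUP k. cap (A k))"
    and e: "e < cap (g ` C)"
  obtains K where "compact K" "K \<subseteq> g ` C" "\<And>G. open G \<Longrightarrow> K \<subseteq> G \<Longrightarrow> e < cap G"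
proof -
  obtain D :: "'c set" where D: "countable D" "\<And>X. open X \<Longrightarrow> X \<noteq> {} \<Longrightarrow> \<exists>d\<in>D. d \<in> X"
    using countable_dense_setE by blast
  define d where "d = from_nat_into D"
  have "D \<noteq> {}" using D(2)[of UNIV] by auto
  have dense: "\<exists>i. dist (d i) x < \<epsilon>" if "0 < \<epsilon>" for x and \<epsilon> :: real
  proof -
    obtain y where "y \<in> D" "y \<in> ball x \<epsilon>" using D(2)[of "ball x \<epsilon>"] \<open>0 < \<epsilon>\<close> by auto
    moreover obtain i where "d i = y" unfolding d_def
      using from_nat_into_surj[OF D(1) \<open>y \<in> D\<close>] by blast
    ultimately show ?thesis by (auto simp: dist_commute)
  qed
  define T where "T k N = (\<Union>i\<in>{..N}. cball (d i) (1 / real (Suc k)))" for k N :: nat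
  have closedT: "closed (T k N)" for k N unfolding T_def by (intro closed_UN) auto
  have "\<exists>S. \<forall>k. (e < cap (g ` S k) \<and> closed (S k) \<and> S k \<subseteq> C) \<and> (\<exists>N. S (Suc k) = S k \<inter> T k N)"
  proof (rule dependent_nat_choice)
    show "\<exists>x. e < cap (g ` x) \<and> closed x \<and> x \<subseteq> C" using C e by blast
  next
    fix S k assume S: "e < cap (g ` S) \<and> closed S \<and> S \<subseteq> C"
    have "incseq (\<lambda>N. g ` (S \<inter> T k N))"
    proof (rule incseq_SucI, rule image_mono)
      fix N
      have "T k N \<subseteq> T k (Suc N)" unfolding T_def by (rule UN_mono) auto
      then show "S \<inter> T k N \<subseteq> S \<inter> T k (Suc N)" by blast
    qed
    from inc[OF this] have "cap (g ` S) \<le> (SUP N. cap (g ` (S \<inter> T k N)))"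
    proof (rule order_trans[rotated])
      have "\<exists>N. x \<in> T k N" for x
      proof -
        obtain i where "dist (d i) x < 1 / real (Suc k)" using dense[of "1 / real (Suc k)" x] by auto
        then have "x \<in> T k i" unfolding T_def by (intro UN_I[of i]) auto
        then show ?thesis by blast
      qed
      then show "cap (g ` S) \<le> cap (\<Union>N. g ` (S \<inter> T k N))" by (intro mono) blast
    qed
    with S have "e < (SUP N. cap (g ` (S \<inter> T k N)))" by (meson less_le_trans)
    then obtain N where "e < cap (g ` (S \<inter> T k N))" by (auto simp: less_SUP_iff)
    then show "\<exists>y. (e < cap (g ` y) \<and> closed y \<and> y \<subseteq> C) \<and> (\<exists>N. y = S \<inter> T k N)"
      using S closedT by (intro exI[of _ "S \<inter> T k N"]) auto
  qed
  then obtain S N where S: "\<And>k. e < cap (g ` S k)" "\<And>k. closed (S k)" "\<And>k. S k \<subseteq> C"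
      "\<And>k. S (Suc k) = S k \<inter> T k (N k)" by metis
  have dec: "decseq S" by (rule decseq_SucI) (auto simp: S(4))
  \<comment> \<open>The sets \<open>S k\<close> need not be compact, but all terms of
    \<open>b\<close> after the \<open>k\<close>-th lie in finitely many balls of radius
    \<open>1 / (k + 1)\<close>, so the range of \<open>b\<close> is totally bounded.\<close>
  have sub: "\<exists>l\<in>(\<Inter>k. S k). \<exists>r :: nat \<Rightarrow> nat. strict_mono r \<and> (b \<circ> r) \<longlonglongrightarrow> l" if b: "\<And>k. b k \<in> S k" for b
  proof -
    have "compact (closure (range b))"
    proof (rule compact_eq_totally_bounded[THEN iffD2],
        intro conjI allI impI complete_eq_closed[THEN iffD2] closed_closure)
      fix \<epsilon> :: real assume "0 < \<epsilon>"
      then obtain k where k: "1 / real (Suc k) < \<epsilon>" using nat_approx_posE by blast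
      have "b j \<in> b ` {..k} \<union> T k (N k)" for j
      proof (cases "j \<le> k")
        case False
        then have "S j \<subseteq> S (Suc k)" using dec by (auto simp: decseq_def)
        then show ?thesis using b[of j] by (auto simp: S(4))
      qed auto
      then have "closure (range b) \<subseteq> b ` {..k} \<union> T k (N k)"
        using closedT by (intro closure_minimal closed_Un) (auto intro: finite_imp_closed)
      also have "\<dots> \<subseteq> (\<Union>x\<in>b ` {..k} \<union> d ` {..N k}. ball x \<epsilon>)"
        using k \<open>0 < \<epsilon>\<close> by (force simp: T_def)
      finally show "\<exists>F. finite F \<and> closure (range b) \<subseteq> (\<Union>x\<in>F. ball x \<epsilon>)"
        by (intro exI[of _ "b ` {..k} \<union> d ` {..N k}"]) auto
    qed
    moreover have "\<forall>n. b n \<in> closure (range b)"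
      by (meson closure_subset rangeI subsetD)
    ultimately obtain l r where lr: "strict_mono (r :: nat \<Rightarrow> nat)" "(b \<circ> r) \<longlonglongrightarrow> l"
      unfolding compact_def by metis
    have "l \<in> S k" for k
    proof (rule closed_sequentially[OF S(2)])
      show "(\<lambda>n. (b \<circ> r) (n + k)) \<longlonglongrightarrow> l" using lr(2) by (rule LIMSEQ_ignore_initial_segment)
      fix n
      have "k \<le> r (n + k)" using seq_suble[OF lr(1), of "n + k"] by simp
      then show "(b \<circ> r) (n + k) \<in> S k" using b[of "r (n + k)"] dec by (auto simp: decseq_def)
    qed
    with lr show ?thesis by blast
  qed
  let ?K = "\<Inter>k. S k"
  have "compact ?K"
    unfolding compact_def using sub by (metis INT_iff UNIV_I)
  moreover have KC: "?K \<subseteq> C" using S(3) by auto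
  ultimately have "compact (g ` ?K)"
    using g by (meson compact_continuous_image continuous_on_subset)
  moreover have "e < cap G" if G: "open G" "g ` ?K \<subseteq> G" for G
  proof -
    have "\<exists>k. g ` S k \<subseteq> G"
    proof (rule ccontr)
      assume "\<not> ?thesis"
      then have "\<forall>k. \<exists>y\<in>S k. g y \<notin> G" by blast
      then obtain b where b: "\<And>k. b k \<in> S k" "\<And>k. g (b k) \<notin> G" by metis
      obtain l r where l: "l \<in> ?K" "(b \<circ> r) \<longlonglongrightarrow> l" using sub[of b, OF b(1)] by blast
      have "(\<lambda>n. g ((b \<circ> r) n)) \<longlonglongrightarrow> g l"
        by (rule continuous_on_tendsto_compose[OF g l(2)])
           (use KC l(1) subsetD[OF S(3) b(1)] in \<open>auto intro!: always_eventually\<close>)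
      then have "\<forall>\<^sub>F n in sequentially. g ((b \<circ> r) n) \<in> G"
        using topological_tendstoD G l(1) by blast
      then show False using b(2) by simp
    qed
    then obtain k where "g ` S k \<subseteq> G" ..
    with S(1)[of k] mono show ?thesis by (meson less_le_trans)
  qed
  ultimately show thesis using KC by (intro that[of "g ` ?K"]) auto
qed


section \<open>Ahlfors regular spaces\<close>

text \<open>A set of largest cardinality cannot be enlarged. This produces the separated nets and,
  later, maximal packings.\<close>

lemma finite_maximal_set:
  assumes "Q {}" and "\<And>S. finite S \<Longrightarrow> Q S \<Longrightarrow> card S \<le> N"
  obtains S :: "'a set" where "finite S" "Q S" "\<And>x. x \<notin> S \<Longrightarrow> \<not> Q (insert x S)"
proof -
  let ?R = "\<lambda>n. \<exists>S. finite S \<and> Q S \<and> card S = n"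
  have "?R 0" using assms(1) by (intro exI[of _ "{}"]) auto
  moreover have "\<forall>n. ?R n \<longrightarrow> n \<le> N" using assms(2) by auto
  ultimately obtain n where n: "?R n" "\<forall>m. ?R m \<longrightarrow> m \<le> n"
    using GreatestI_nat[of ?R 0 N] Greatest_le_nat[of ?R _ N] by blast
  then obtain S where S: "finite S" "Q S" "card S = n" by blast
  have "\<not> Q (insert x S)" if "x \<notin> S" for x
  proof
    assume "Q (insert x S)"
    then have "?R (Suc n)" using S that by (intro exI[of _ "insert x S"]) auto
    then show False using n(2) by auto
  qed
  with S show thesis by (intro that)
qed

text \<open>The lower bound concerns radii below the diameter, the upper bound all radii; a constant
  that also serves the large radii is found in \<open>ahlfors_spaceI\<close>.\<close>

locale ahlfors_space = prob_space \<mu> for \<mu> :: "'a::metric_space measure" +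
  fixes t C :: real
  assumes compact_space: "compact (UNIV :: 'a set)"
    and sets_eq: "sets \<mu> = sets borel"
    and t_pos: "0 < t"
    and C_pos: "0 < C"
    and diam_pos: "0 < diameter (UNIV :: 'a set)"
    and ball_lower: "0 < r \<Longrightarrow> r < diameter (UNIV :: 'a set) \<Longrightarrow> r powr t / C \<le> measure \<mu> (cball x r)"
    and ball_upper: "0 < r \<Longrightarrow> measure \<mu> (cball x r) \<le> C * r powr t"
begin

lemma space_eq [simp]: "space \<mu> = UNIV"
  using sets_eq_imp_space_eq[OF sets_eq] by simp

lemma closed_sets [measurable, simp]: "closed A \<Longrightarrow> A \<in> sets \<mu>"
  by (simp add: sets_eq)

lemma card_disjoint_balls:
  assumes S: "finite S" "pairwise (\<lambda>x y. cball x r \<inter> cball y r = {}) S"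
    and r: "0 < r" "r < diameter (UNIV :: 'a set)"
    and A: "A \<in> sets \<mu>" "\<And>x. x \<in> S \<Longrightarrow> cball x r \<subseteq> A"
  shows "real (card S) * (r powr t / C) \<le> measure \<mu> A"
proof -
  have "real (card S) * (r powr t / C) = (\<Sum>x\<in>S. r powr t / C)" by simp
  also have "\<dots> \<le> (\<Sum>x\<in>S. measure \<mu> (cball x r))"
    using r by (intro sum_mono ball_lower)
  also have "\<dots> = measure \<mu> (\<Union>x\<in>S. cball x r)"
    using S by (intro finite_measure_finite_Union[symmetric])
       (auto simp: disjoint_family_on_def pairwise_def)
  also have "\<dots> \<le> measure \<mu> A"
    using A by (intro finite_measure_mono) auto
  finally show ?thesis .
qed

text \<open>The net is a maximal \<open>\<delta> / 2\<close>-separated set. Balls of radius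
  \<open>\<delta> / 5\<close> around its points are disjoint, and those around net points within
  \<open>5 / 2 * \<delta>\<close> of \<open>x\<close> fit into
  \<open>cball x (3 * \<delta>)\<close>; comparing masses gives \<open>15 = 3 / (1 / 5)\<close>. The
  distance \<open>5 / 2 * \<delta>\<close> allows for a point within \<open>2 * \<delta>\<close> of
  \<open>x\<close> and a further \<open>\<delta> / 2\<close> to its net point.\<close>

lemma separated_net:
  assumes \<delta>: "0 < \<delta>" "3 * \<delta> < diameter (UNIV :: 'a set)"
  obtains S :: "'a set" where "finite S" "\<And>x. \<exists>s\<in>S. dist x s \<le> \<delta> / 2"
    "\<And>x. real (card {s\<in>S. dist x s \<le> 5 / 2 * \<delta>}) \<le> C\<^sup>2 * 15 powr t"
proof -
  have disj: "pairwise (\<lambda>x y. cball x (\<delta>/5) \<inter> cball y (\<delta>/5) = {}) S"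
    if "pairwise (\<lambda>x y. \<delta> / 2 < dist x y) S" for S :: "'a set"
    using that unfolding pairwise_def
  proof safe
    fix x y z assume "\<forall>x\<in>S. \<forall>y\<in>S. x \<noteq> y \<longrightarrow> \<delta> / 2 < dist x y" "x \<in> S" "y \<in> S" "x \<noteq> y"
      "z \<in> cball x (\<delta>/5)" "z \<in> cball y (\<delta>/5)"
    then have "\<delta> / 2 < dist x y" "dist x z \<le> \<delta> / 5" "dist y z \<le> \<delta> / 5" by auto
    then show "z \<in> {}" using dist_triangle2[of x y z] \<delta> by auto
  qed
  let ?N = "nat \<lceil>C / (\<delta>/5) powr t\<rceil>"
  obtain S :: "'a set" where S: "finite S" "pairwise (\<lambda>x y. \<delta> / 2 < dist x y) S"
    "\<And>x. x \<notin> S \<Longrightarrow> \<not> pairwise (\<lambda>x y. \<delta> / 2 < dist x y) (insert x S)"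
  proof (rule finite_maximal_set[of "pairwise (\<lambda>x y. \<delta> / 2 < dist x y)" ?N])
    fix S :: "'a set" assume "finite S" "pairwise (\<lambda>x y. \<delta> / 2 < dist x y) S"
    from card_disjoint_balls[OF this(1) disj[OF this(2)], of UNIV]
    have "real (card S) * ((\<delta>/5) powr t / C) \<le> 1"
      using \<delta> prob_space by (auto simp: sets_eq)
    then have "real (card S) \<le> C / (\<delta>/5) powr t"
      using C_pos \<delta> by (simp add: field_simps)
    then show "card S \<le> ?N" by linarith
  qed auto
  have "\<exists>s\<in>S. dist x s \<le> \<delta> / 2" for x
  proof (cases "x \<in> S")
    case False
    then have "\<exists>s\<in>S. \<not> \<delta> / 2 < dist x s \<or> \<not> \<delta> / 2 < dist s x"
      using S(2) S(3)[OF False] unfolding pairwise_insert by blast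
    then show ?thesis by (metis dist_commute not_less)
  next
    case True
    then show ?thesis using \<delta>(1) by (intro bexI[of _ x]) auto
  qed
  moreover have "real (card {s\<in>S. dist x s \<le> 5 / 2 * \<delta>}) \<le> C\<^sup>2 * 15 powr t" for x
  proof -
    let ?S = "{s\<in>S. dist x s \<le> 5 / 2 * \<delta>}"
    have "pairwise (\<lambda>x y. \<delta> / 2 < dist x y) ?S"
      using S(2) by (rule pairwise_subset) auto
    then have "real (card ?S) * ((\<delta>/5) powr t / C) \<le> measure \<mu> (cball x (3 * \<delta>))"
    proof (intro card_disjoint_balls disj)
      fix s assume "s \<in> ?S"
      then have s: "dist x s \<le> 5 / 2 * \<delta>" by simp
      show "cball s (\<delta> / 5) \<subseteq> cball x (3 * \<delta>)"
      proof
        fix z assume "z \<in> cball s (\<delta> / 5)"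
        then show "z \<in> cball x (3 * \<delta>)" using s dist_triangle[of x z s] \<delta>(1) by simp
      qed
    qed (use S(1) \<delta> in \<open>auto simp: sets_eq\<close>)
    also have "\<dots> \<le> C * (3 * \<delta>) powr t" using \<delta> by (intro ball_upper) auto
    also have "(3 * \<delta>) powr t = 15 powr t * (\<delta>/5) powr t"
      using \<delta> by (subst powr_mult[symmetric]) auto
    finally have "real (card ?S) * ((\<delta>/5) powr t / C) * (C / (\<delta>/5) powr t)
        \<le> C * (15 powr t * (\<delta>/5) powr t) * (C / (\<delta>/5) powr t)"
      using C_pos by (intro mult_right_mono) auto
    moreover have "(\<delta>/5) powr t \<noteq> 0" using \<delta>(1) by simp
    ultimately show ?thesis using C_pos by (simp add: power2_eq_square mult_ac)
  qed
  ultimately show thesis using S(1) by (intro that)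
qed

text \<open>Points are sorted by a chosen nearby net point. The multiplicity \<open>M\<close> must
  not depend on \<open>\<delta>\<close>, since it is used at all scales at once.\<close>

lemma doubling_partition:
  obtains M :: nat where "\<And>\<delta>. 0 < \<delta> \<Longrightarrow> \<exists>a :: 'a \<Rightarrow> nat. (\<exists>N. \<forall>x. a x < N) \<and>
     (\<forall>x y. a x = a y \<longrightarrow> dist x y \<le> \<delta>) \<and> (\<forall>x. card (a ` cball x (2 * \<delta>)) \<le> M)"
proof -
  let ?D = "diameter (UNIV :: 'a set)"
  let ?M = "nat \<lceil>C\<^sup>2 * 15 powr t\<rceil>"
  have small: "\<exists>a :: 'a \<Rightarrow> nat. (\<exists>N. \<forall>x. a x < N) \<and>
     (\<forall>x y. a x = a y \<longrightarrow> dist x y \<le> \<delta>) \<and> (\<forall>x. card (a ` cball x (2 * \<delta>)) \<le> ?M)"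
    if \<delta>: "0 < \<delta>" "3 * \<delta> < ?D" for \<delta>
  proof -
    obtain S :: "'a set" where S: "finite S" "\<And>x. \<exists>s\<in>S. dist x s \<le> \<delta> / 2"
      "\<And>x. real (card {s\<in>S. dist x s \<le> 5 / 2 * \<delta>}) \<le> C\<^sup>2 * 15 powr t"
      by (rule separated_net[OF \<delta>]) blast
    obtain c where c: "\<And>x. c x \<in> S" "\<And>x. dist x (c x) \<le> \<delta> / 2" using S(2) by metis
    obtain g :: "'a \<Rightarrow> nat" where g: "bij_betw g S {0..<card S}"
      using ex_bij_betw_finite_nat[OF S(1)] by blast
    define a where "a x = g (c x)" for x
    have "a x < card S" for x using g c(1) by (auto simp: a_def bij_betw_def)
    moreover have "dist x y \<le> \<delta>" if "a x = a y" for x y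
    proof -
      have "c x = c y" using that g c(1) by (auto simp: a_def bij_betw_def inj_on_def)
      then show ?thesis using c(2)[of x] c(2)[of y] dist_triangle2[of x y "c x"] by simp
    qed
    moreover have "card (a ` cball x (2 * \<delta>)) \<le> ?M" for x
    proof -
      have "c y \<in> {s\<in>S. dist x s \<le> 5 / 2 * \<delta>}" if "y \<in> cball x (2 * \<delta>)" for y
        using c[of y] that dist_triangle[of x "c y" y] by auto
      then have "a ` cball x (2 * \<delta>) \<subseteq> g ` {s\<in>S. dist x s \<le> 5 / 2 * \<delta>}"
        unfolding a_def by blast
      then have "card (a ` cball x (2 * \<delta>)) \<le> card {s\<in>S. dist x s \<le> 5 / 2 * \<delta>}"
        using S(1) by (intro surj_card_le) auto
      then show ?thesis using S(3)[of x] by linarith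
    qed
    ultimately show ?thesis by blast
  qed
  \<comment> \<open>For \<open>\<delta>\<close> at least a third of the diameter one fixed partition
    of mesh \<open>?D / 4\<close> serves, and its number of cells bounds the multiplicity.\<close>
  obtain a0 :: "'a \<Rightarrow> nat" and N0 where a0: "\<And>x. a0 x < N0" "\<And>x y. a0 x = a0 y \<Longrightarrow> dist x y \<le> ?D / 4"
    using small[of "?D / 4"] diam_pos by auto
  show thesis
  proof (rule that[of "max ?M N0"])
    fix \<delta> :: real assume "0 < \<delta>"
    show "\<exists>a :: 'a \<Rightarrow> nat. (\<exists>N. \<forall>x. a x < N) \<and>
     (\<forall>x y. a x = a y \<longrightarrow> dist x y \<le> \<delta>) \<and> (\<forall>x. card (a ` cball x (2 * \<delta>)) \<le> max ?M N0)"
    proof (cases "3 * \<delta> < ?D")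
      case True
      then show ?thesis using small[OF \<open>0 < \<delta>\<close>] by (meson max.coboundedI1)
    next
      case False
      have "card (a0 ` A) \<le> N0" for A
        using card_mono[of "{..<N0}" "a0 ` A"] a0(1) by auto
      moreover have "dist x y \<le> \<delta>" if "a0 x = a0 y" for x y
        using a0(2)[OF that] False diam_pos by linarith
      ultimately show ?thesis using a0(1) by (intro exI[of _ a0]) (auto intro: max.coboundedI2)
    qed
  qed
qed

end


section \<open>Compact sets of positive content\<close>

lemma weight_empty [simp]: "weight w {} = 0"
  by (simp add: weight_def)

text \<open>The test \<open>to_nat (from_nat i) = i\<close> selects one index for each list, so that
  covers by nodes turn into covers indexed by naturals.\<close>

lemma weight_eq_suminf:
  "weight w U = (\<Sum>i. if from_nat i \<in> U \<and> to_nat (from_nat i :: nat list) = i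
     then w (length (from_nat i :: nat list)) else 0)"
proof -
  let ?W = "\<lambda>i. if from_nat i \<in> U \<and> to_nat (from_nat i :: nat list) = i then {from_nat i :: nat list} else {}"
  have "U = (\<Union>i. ?W i)"
  proof (intro equalityI subsetI)
    fix P assume "P \<in> U"
    then show "P \<in> (\<Union>i. ?W i)" by (intro UN_I[of "to_nat P"]) auto
  qed (auto split: if_splits)
  then have "weight w U = weight w (\<Union>i. ?W i)" by (rule arg_cong)
  also have "\<dots> = (\<Sum>i. weight w (?W i))"
    unfolding weight_def
  proof (rule suminf_emeasure[symmetric])
    show "disjoint_family ?W" unfolding disjoint_family_on_def
    proof (intro ballI impI)
      fix i j :: nat assume ij: "i \<noteq> j"
      show "?W i \<inter> ?W j = {}"
      proof (rule ccontr)
        assume "?W i \<inter> ?W j \<noteq> {}"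
        then obtain P where P: "P \<in> ?W i \<inter> ?W j" by (meson ex_in_conv)
        have "to_nat P = i" using IntD1[OF P] by (simp split: if_splits)
        moreover have "to_nat P = j" using IntD2[OF P] by (simp split: if_splits)
        ultimately show False using ij by simp
      qed
    qed
  qed simp
  also have "\<dots> = (\<Sum>i. if from_nat i \<in> U \<and> to_nat (from_nat i :: nat list) = i
     then w (length (from_nat i :: nat list)) else 0)"
    by (intro suminf_cong) (simp add: weight_singleton)
  finally show ?thesis .
qed

lemma weight_UN_le: "weight w (\<Union>i::nat. V i) \<le> (\<Sum>i. weight w (V i))"
  unfolding weight_def by (rule emeasure_subadditive_countably) auto

lemma weight_finite: "finite U \<Longrightarrow> weight w U = (\<Sum>P\<in>U. w (length P))"
  by (induction U rule: finite_induct)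
     (auto simp: weight_singleton weight_disjoint_Un[of "{_}", simplified])

text \<open>Completing the square. Against exponents quadratic in \<open>n\<close> this absorbs all
  factors with exponents linear in \<open>n\<close>, such as \<open>M ^ n\<close> and the ratio of
  consecutive scales.\<close>

lemma quadratic_le:
  fixes d A x :: real
  assumes "0 < d"
  shows "A * x - d * x\<^sup>2 \<le> A\<^sup>2 / (4 * d)"
proof -
  have "A\<^sup>2 / (4 * d) - (A * x - d * x\<^sup>2) = d * (x - A / (2 * d))\<^sup>2"
    using assms by (simp add: power2_eq_square field_simps)
  also have "\<dots> \<ge> 0" using assms by simp
  finally show ?thesis by simp
qed

text \<open>
  The scales decrease so fast that the multiplicity \<open>M ^ n\<close> of the common refinement of \<open>n\<close>
  partitions is negligible compared to every power of the \<open>n\<close>-th scale, and at the same time so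
  slowly that consecutive scales have comparable logarithms.
\<close>

definition scale :: "nat \<Rightarrow> real" where
  "scale n = (1/2) ^ n\<^sup>2"

lemma scale_pos [simp]: "0 < scale n"
  by (simp add: scale_def)

lemma scale_neq_0 [simp]: "scale n \<noteq> 0"
  by (simp add: scale_def)

lemma scale_0 [simp]: "scale 0 = 1"
  by (simp add: scale_def)

lemma scale_antimono: "m \<le> n \<Longrightarrow> scale n \<le> scale m"
  unfolding scale_def by (rule power_decreasing) (auto simp: power_mono)

lemma scale_le_half_power: "scale n \<le> (1/2) ^ n"
  unfolding scale_def by (rule power_decreasing) (auto simp: power2_eq_square)

lemma scale_powr: "scale n powr v = 2 powr (- (v * (real n)\<^sup>2))"
proof -
  have "scale n = 1 / 2 ^ n\<^sup>2" by (simp add: scale_def power_one_over)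
  also have "(2::real) ^ n\<^sup>2 = 2 powr real (n\<^sup>2)" by (rule powr_realpow[symmetric]) simp
  also have "1 / \<dots> = 2 powr (- real (n\<^sup>2))" by (simp only: powr_minus_divide)
  finally show ?thesis by (simp add: powr_powr mult.commute)
qed

lemma power_le_2_powr: "real M ^ n \<le> 2 powr (real M * real n)"
proof -
  have "real M \<le> 2 powr real M"
    using of_nat_less_two_power[of M, where 'a=real] by (simp add: powr_realpow)
  then have "real M ^ n \<le> (2 powr real M) ^ n" by (intro power_mono) auto
  also have "\<dots> = 2 powr (real M * real n)"
    by (simp add: powr_power mult.commute)
  finally show ?thesis .
qed

lemma scale_tendsto_0: "scale \<longlonglongrightarrow> 0"
proof (rule tendsto_sandwich[of "\<lambda>_. 0" _ _ "\<lambda>n. (1/2) ^ n"])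
  show "(\<lambda>n. (1/2::real) ^ n) \<longlonglongrightarrow> 0" by (rule LIMSEQ_realpow_zero) auto
qed (auto intro!: always_eventually scale_le_half_power less_imp_le)

text \<open>\<open>Suc i\<close> makes a cell of length \<open>n > 0\<close> have diameter at most
  \<open>scale n\<close>. The cell of \<open>[]\<close> is the whole space, whose diameter is not
  controlled; hence the separate treatment of length \<open>0\<close> below.\<close>

locale net_partition =
  fixes a :: "nat \<Rightarrow> 'a::metric_space \<Rightarrow> nat" and N :: "nat \<Rightarrow> nat" and M :: nat
  assumes a_less: "a i x < N i"
    and a_dist: "a i x = a i y \<Longrightarrow> dist x y \<le> scale (Suc i)"
    and a_card: "card (a i ` cball x (2 * scale (Suc i))) \<le> M"
begin

abbreviation content :: "real \<Rightarrow> 'a set \<Rightarrow> ennreal" where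
  "content u \<equiv> net_content a (\<lambda>n. ennreal (scale n powr u))"

lemma code_dist: "0 < n \<Longrightarrow> code a x n = code a y n \<Longrightarrow> dist x y \<le> scale n"
  by (cases n) (auto simp: code_Suc intro: a_dist)

lemma finite_codes: "finite ((\<lambda>y. code a y n) ` B)"
proof (induction n)
  case (Suc n)
  have "(\<lambda>y. code a y (Suc n)) ` B \<subseteq> (\<lambda>(l, k). l @ [k]) ` ((\<lambda>y. code a y n) ` B \<times> {..<N n})"
    using a_less by (auto simp: code_Suc)
  with Suc show ?case by (meson finite_SigmaI finite_imageI finite_lessThan finite_subset)
qed (auto simp: image_constant_conv)

text \<open>A ball of scale \<open>n\<close> lies in a ball of the same kind at every coarser scale,
  where the partition has at most \<open>M\<close> cells. In the common refinement these factors
  multiply.\<close>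

lemma card_codes:
  assumes "B \<subseteq> cball x (2 * scale n)"
  shows "card ((\<lambda>y. code a y n) ` B) \<le> M ^ n"
proof -
  have "card ((\<lambda>y. code a y m) ` B) \<le> M ^ m" if "m \<le> n" for m
    using that
  proof (induction m)
    case 0
    show ?case by (cases "B = {}") (auto simp: image_constant_conv)
  next
    case (Suc m)
    have fin: "finite (a m ` B)" by (rule finite_subset[of _ "{..<N m}"]) (auto simp: a_less)
    have fin': "finite (a m ` cball x (2 * scale (Suc m)))"
      by (rule finite_subset[of _ "{..<N m}"]) (auto simp: a_less)
    have "(\<lambda>y. code a y (Suc m)) ` B \<subseteq> (\<lambda>(l, k). l @ [k]) ` ((\<lambda>y. code a y m) ` B \<times> a m ` B)"
      by (auto simp: code_Suc)
    then have "card ((\<lambda>y. code a y (Suc m)) ` B) \<le> card ((\<lambda>y. code a y m) ` B \<times> a m ` B)"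
      by (rule surj_card_le[rotated]) (auto intro: finite_codes fin)
    also have "\<dots> = card ((\<lambda>y. code a y m) ` B) * card (a m ` B)"
      by (rule card_cartesian_product)
    also have "card (a m ` B) \<le> card (a m ` cball x (2 * scale (Suc m)))"
    proof (intro card_mono fin' image_mono order_trans[OF assms])
      show "cball x (2 * scale n) \<subseteq> cball x (2 * scale (Suc m))"
        using scale_antimono[OF Suc.prems] by (intro subset_cball) auto
    qed
    also have "\<dots> \<le> M" by (rule a_card)
    also have "card ((\<lambda>y. code a y m) ` B) \<le> M ^ m" using Suc by auto
    finally show ?case by (auto simp: mult.commute)
  qed
  then show ?thesis by auto
qed

text \<open>Contents restrict no diameters, but a cover of weight below
  \<open>scale m powr u\<close> contains only nodes longer than \<open>m\<close>, whose cells are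
  small.\<close>

lemma hausdorff_measure_0_of_content:
  assumes "0 < u" and 0: "content u F = 0"
  shows "hausdorff_measure u F = 0"
  unfolding hausdorff_measure_eq_0_iff
proof (intro allI impI)
  fix \<delta> :: real and \<epsilon> :: ennreal assume "0 < \<delta>" "0 < \<epsilon>"
  obtain m where m: "scale m < \<delta>"
    using order_tendstoD(2)[OF scale_tendsto_0 \<open>0 < \<delta>\<close>] by (auto simp: eventually_sequentially)
  have "content u F < min \<epsilon> (ennreal (scale m powr u))"
    using \<open>0 < \<epsilon>\<close> by (simp add: 0)
  then obtain U where U: "code_covers a U F" "weight (\<lambda>n. ennreal (scale n powr u)) U < min \<epsilon> (ennreal (scale m powr u))"
    unfolding net_content_def INF_less_iff by blast
  have long: "m < length P" if "P \<in> U" for P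
  proof (rule ccontr)
    assume "\<not> m < length P"
    then have "scale m powr u \<le> scale (length P) powr u"
      using assms(1) by (intro powr_mono2) (auto intro: scale_antimono less_imp_le)
    moreover have "ennreal (scale (length P) powr u) < ennreal (scale m powr u)"
      using weight_ge[OF that, of "\<lambda>n. ennreal (scale n powr u)"] U(2) by (auto intro: le_less_trans)
    ultimately show False by (simp add: ennreal_less_iff)
  qed
  define V where "V i = (if from_nat i \<in> U \<and> to_nat (from_nat i :: nat list) = i
     then cyl a UNIV (from_nat i) else {})" for i
  have diam: "bounded (cyl a UNIV P) \<and> diameter (cyl a UNIV P) \<le> scale (length P)" if "0 < length P" for P
  proof
    have d: "dist x y \<le> scale (length P)" if "x \<in> cyl a UNIV P" "y \<in> cyl a UNIV P" for x y
      using that \<open>0 < length P\<close> by (intro code_dist) (auto simp: cyl_def)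
    then show "bounded (cyl a UNIV P)" unfolding bounded_def by blast
    show "diameter (cyl a UNIV P) \<le> scale (length P)"
      using d less_imp_le[OF scale_pos[of "length P"]] by (rule diameter_le_dist)
  qed
  have "F \<subseteq> (\<Union>i. V i)"
  proof
    fix x assume "x \<in> F"
    then obtain n where "code a x n \<in> U" using U(1) by (auto simp: code_covers_def)
    then have "x \<in> V (to_nat (code a x n))" by (auto simp: V_def cyl_def)
    then show "x \<in> (\<Union>i. V i)" by blast
  qed
  moreover have "bounded (V i) \<and> diameter (V i) \<le> \<delta>" for i
  proof (cases "from_nat i \<in> U \<and> to_nat (from_nat i :: nat list) = i")
    case True
    then have "m < length (from_nat i :: nat list)" using long by blast
    then have "scale (length (from_nat i :: nat list)) \<le> \<delta>"
      using m scale_antimono[of m "length (from_nat i :: nat list)"] by simp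
    moreover have "0 < length (from_nat i :: nat list)" using \<open>m < _\<close> by linarith
    ultimately show ?thesis using True diam[of "from_nat i"] by (simp add: V_def)
  qed (use \<open>0 < \<delta>\<close> in \<open>auto simp: V_def diameter_def\<close>)
  moreover have "(\<Sum>i. diam_powr u (V i)) \<le> weight (\<lambda>n. ennreal (scale n powr u)) U"
    unfolding weight_eq_suminf
  proof (intro suminf_le)
    fix i
    show "diam_powr u (V i) \<le> (if from_nat i \<in> U \<and> to_nat (from_nat i :: nat list) = i
       then ennreal (scale (length (from_nat i :: nat list)) powr u) else 0)"
    proof (cases "from_nat i \<in> U \<and> to_nat (from_nat i :: nat list) = i")
      case True
      then have "m < length (from_nat i :: nat list)" using long by blast
      then have "0 < length (from_nat i :: nat list)" by linarith
      then have d: "bounded (V i)" "diameter (V i) \<le> scale (length (from_nat i :: nat list))"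
        using True diam[of "from_nat i"] by (simp_all add: V_def)
      then have "diameter (V i) powr u \<le> scale (length (from_nat i :: nat list)) powr u"
        using assms(1) by (intro powr_mono2 diameter_ge_0) auto
      then show ?thesis using True assms(1) by (auto simp: diam_powr_def intro: ennreal_leI)
    qed (auto simp: V_def diam_powr_def)
  qed auto
  ultimately show "\<exists>U. F \<subseteq> (\<Union>i. U i) \<and> (\<forall>i. bounded (U i) \<and> diameter (U i) \<le> \<delta>) \<and>
      (\<Sum>i. diam_powr u (U i)) < \<epsilon>"
    using U(2) by (intro exI[of _ V]) (auto intro: le_less_trans)
qed

lemma card_mult_scale_le:
  assumes "v < u"
  obtains B where "0 < B" "\<And>n. real M ^ n * scale n powr u \<le> B * scale n powr v"
proof
  let ?B = "2 powr ((real M)\<^sup>2 / (4 * (u - v))) :: real"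
  show "0 < ?B" by simp
  fix n
  have "real M ^ n * scale n powr u \<le> 2 powr (real M * real n) * scale n powr u"
    by (intro mult_right_mono power_le_2_powr) auto
  also have "\<dots> = 2 powr (real M * real n - (u - v) * (real n)\<^sup>2) * scale n powr v"
    by (simp add: scale_powr powr_add[symmetric] algebra_simps)
  also have "\<dots> \<le> ?B * scale n powr v"
    using quadratic_le[of "u - v" "real M" "real n"] assms by (intro mult_right_mono) auto
  finally show "real M ^ n * scale n powr u \<le> ?B * scale n powr v" .
qed

text \<open>Capacitability bounds the content of open sets around \<open>K\<close>, not of
  \<open>K\<close> itself, and cells need not be open. So a cover of \<open>K\<close> is swollen to
  an open set. A swollen cell of length \<open>n\<close> meets at most \<open>M ^ n\<close> cells of
  that length, and lowering the exponent to \<open>v\<close> pays for them.\<close>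

lemma compact_positive_content:
  fixes g :: "'c::{complete_space, second_countable_topology} \<Rightarrow> 'a"
  assumes C: "closed C" "continuous_on C g" and v: "v < u" and pos: "0 < content u (g ` C)"
  obtains K where "compact K" "K \<subseteq> g ` C" "0 < content v K"
proof -
  obtain e where e: "0 < e" "e < content u (g ` C)" using dense[OF pos] by (elim exE conjE)
  obtain K where K: "compact K" "K \<subseteq> g ` C" "\<And>G. open G \<Longrightarrow> K \<subseteq> G \<Longrightarrow> e < content u G"
  proof (rule capacitability[OF C, of "content u" e])
    show "content u A \<le> content u B" if "A \<subseteq> B" for A B
      using that by (rule net_content_mono)
    show "content u (\<Union>k. A k) \<le> (SUP k. content u (A k))" if "incseq A" for A :: "nat \<Rightarrow> 'a set"
      using that by (rule net_content_incseq)
  qed (use e that in blast)+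
  obtain B where B: "0 < B" "\<And>n. real M ^ n * scale n powr u \<le> B * scale n powr v"
    using card_mult_scale_le[OF v] by blast
  have "content v K \<noteq> 0"
  proof
    assume "content v K = 0"
    \<comment> \<open>Below this threshold the swollen cover has weight at most \<open>e\<close> in
      the order \<open>u\<close>, contrary to the choice of \<open>K\<close>.\<close>
    moreover have "0 < e / ennreal B" using e(1) B(1) by (simp add: ennreal_zero_less_divide)
    ultimately obtain U where U: "code_covers a U K" "weight (\<lambda>n. ennreal (scale n powr v)) U < e / ennreal B"
      unfolding net_content_def by (metis (mono_tags, lifting) INF_less_iff mem_Collect_eq)
    define G where "G P = (\<Union>x\<in>cyl a UNIV P. ball x (scale (length P)))" for P
    define W where "W i = (if from_nat i \<in> U \<and> to_nat (from_nat i :: nat list) = i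
       then (\<lambda>y. code a y (length (from_nat i :: nat list))) ` G (from_nat i) else {})" for i
    have 1: "e < content u (\<Union>P\<in>U. G P)"
    proof (rule K(3))
      show "open (\<Union>P\<in>U. G P)" unfolding G_def by auto
      show "K \<subseteq> (\<Union>P\<in>U. G P)"
      proof
        fix x assume "x \<in> K"
        then obtain n where n: "code a x n \<in> U" using U(1) by (auto simp: code_covers_def)
        have "x \<in> G (code a x n)" unfolding G_def
          by (rule UN_I[of x]) (auto simp: cyl_def)
        with n show "x \<in> (\<Union>P\<in>U. G P)" by blast
      qed
    qed
    have "code_covers a (\<Union>i. W i) (\<Union>P\<in>U. G P)"
      unfolding code_covers_def
    proof
      fix x assume "x \<in> (\<Union>P\<in>U. G P)"
      then obtain P where "P \<in> U" "x \<in> G P" by blast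
      then have "code a x (length P) \<in> W (to_nat P)" by (auto simp: W_def)
      then show "\<exists>n. code a x n \<in> (\<Union>i. W i)" by blast
    qed
    then have "content u (\<Union>P\<in>U. G P) \<le> weight (\<lambda>n. ennreal (scale n powr u)) (\<Union>i. W i)"
      by (rule net_content_le)
    also have "\<dots> \<le> (\<Sum>i. weight (\<lambda>n. ennreal (scale n powr u)) (W i))" by (rule weight_UN_le)
    also have "\<dots> \<le> (\<Sum>i. ennreal B * (if from_nat i \<in> U \<and> to_nat (from_nat i :: nat list) = i
       then ennreal (scale (length (from_nat i :: nat list)) powr v) else 0))"
    proof (intro suminf_le)
      fix i
      show "weight (\<lambda>n. ennreal (scale n powr u)) (W i) \<le> ennreal B * (if from_nat i \<in> U \<and> to_nat (from_nat i :: nat list) = i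
       then ennreal (scale (length (from_nat i :: nat list)) powr v) else 0)"
      proof (cases "from_nat i \<in> U \<and> to_nat (from_nat i :: nat list) = i")
        case True
        let ?P = "from_nat i :: nat list"
        have Wi: "W i = (\<lambda>y. code a y (length ?P)) ` G ?P" using True by (simp add: W_def)
        have "card (W i) \<le> M ^ length ?P"
        proof (cases "length ?P = 0 \<or> cyl a UNIV ?P = {}")
          case True
          then show ?thesis
          proof
            assume "length ?P = 0"
            then have "W i \<subseteq> {[]}" unfolding Wi by auto
            then have "card (W i) \<le> 1" using card_mono[of "{[]::nat list}" "W i"] by simp
            then show ?thesis using \<open>length ?P = 0\<close> by simp
          qed (simp add: Wi G_def)
        next
          case False
          then obtain x where x: "x \<in> cyl a UNIV ?P" by blast
          have "G ?P \<subseteq> cball x (2 * scale (length ?P))"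
          proof
            fix z assume "z \<in> G ?P"
            then obtain y where y: "y \<in> cyl a UNIV ?P" "dist y z < scale (length ?P)"
              by (auto simp: G_def)
            have "dist x y \<le> scale (length ?P)"
              using x y False by (intro code_dist) (auto simp: cyl_def)
            with y(2) show "z \<in> cball x (2 * scale (length ?P))"
              using dist_triangle[of x z y] by simp
          qed
          then show ?thesis unfolding Wi by (rule card_codes)
        qed
        moreover have "weight (\<lambda>n. ennreal (scale n powr u)) (W i)
            = (\<Sum>P\<in>W i. ennreal (scale (length P) powr u))"
          by (rule weight_finite) (simp add: Wi finite_codes)
        moreover have "\<dots> = (\<Sum>P\<in>W i. ennreal (scale (length ?P) powr u))"
          by (intro sum.cong) (auto simp: Wi)
        moreover have "\<dots> = ennreal (real (card (W i)) * scale (length ?P) powr u)"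
          by (simp add: ennreal_mult ennreal_of_nat_eq_real_of_nat)
        moreover have "real (card (W i)) * scale (length ?P) powr u \<le> real M ^ length ?P * scale (length ?P) powr u"
          using \<open>card (W i) \<le> _\<close> by (intro mult_right_mono) (auto simp flip: of_nat_power)
        ultimately have "weight (\<lambda>n. ennreal (scale n powr u)) (W i)
            = ennreal (real (card (W i)) * scale (length ?P) powr u)"
          and "real (card (W i)) * scale (length ?P) powr u \<le> B * scale (length ?P) powr v"
          using B(2)[of "length ?P"] by (simp_all only: order_trans)
        then have "weight (\<lambda>n. ennreal (scale n powr u)) (W i) \<le> ennreal (B * scale (length ?P) powr v)"
          by (simp only: ennreal_leI)
        then show ?thesis using True B(1) by (simp add: ennreal_mult)
      qed (auto simp: W_def)
    qed auto
    also have "\<dots> = ennreal B * weight (\<lambda>n. ennreal (scale n powr v)) U"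
      by (simp add: weight_eq_suminf)
    also have "\<dots> \<le> ennreal B * (e / ennreal B)"
      using U(2) by (intro mult_left_mono) auto
    also have "\<dots> = e"
      using B(1) by (simp add: ennreal_times_divide mult.commute[of "ennreal B"] ennreal_mult_divide_eq)
    finally show False using 1 by simp
  qed
  then show thesis using K by (intro that) (auto simp: zero_less_iff_neq_zero)
qed

end


section \<open>Frostman's lemma\<close>

text \<open>
  The mass of a flow on the tree is realised by Lebesgue measure: the node \<open>P\<close> gets the interval of
  length \<open>\<theta> P\<close> whose left end point is the total mass to the left of the path to \<open>P\<close>.
\<close>

lemma tree_flow_measure:
  fixes \<theta> :: "nat list \<Rightarrow> real" and N :: "nat \<Rightarrow> nat"
  assumes nonneg: "\<And>P. 0 \<le> \<theta> P" and split: "\<And>P. \<theta> P = (\<Sum>i<N (length P). \<theta> (P @ [i]))"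
  shows "\<exists>node :: nat \<Rightarrow> real \<Rightarrow> nat list.
    (\<forall>n \<omega>. length (node n \<omega>) = n) \<and>
    (\<forall>m n \<omega>. m \<le> n \<longrightarrow> take m (node n \<omega>) = node m \<omega>) \<and>
    (\<forall>n. node n \<in> measurable borel (count_space UNIV)) \<and>
    (\<forall>n P. emeasure lborel {\<omega>\<in>{0..<\<theta> []}. node n \<omega> = P} \<le> ennreal (\<theta> P)) \<and>
    (\<forall>n \<omega>. \<omega> \<in> {0..<\<theta> []} \<longrightarrow> 0 < \<theta> (node n \<omega>))"
proof -
  define l where "l P = (\<Sum>j<length P. \<Sum>k<P ! j. \<theta> (take j P @ [k]))" for P
  have l_snoc: "l (P @ [i]) = l P + (\<Sum>k<i. \<theta> (P @ [k]))" for P i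
    unfolding l_def by (simp add: nth_append)
  \<comment> \<open>The child whose interval contains \<open>\<omega>\<close>; for
    \<open>\<omega>\<close> outside \<open>{0..<\<theta> []}\<close> the value is irrelevant but
    still measurable.\<close>
  define step where "step P \<omega> = (LEAST i. \<omega> < l P + (\<Sum>k\<le>i. \<theta> (P @ [k])))" for P \<omega>
  define node where "node = rec_nat (\<lambda>\<omega>. []) (\<lambda>n f \<omega>. f \<omega> @ [step (f \<omega>) \<omega>])"
  have node0: "node 0 \<omega> = []" and nodeS: "node (Suc n) \<omega> = node n \<omega> @ [step (node n \<omega>) \<omega>]" for n \<omega>
    by (auto simp: node_def)
  have len: "length (node n \<omega>) = n" for n \<omega>
    by (induction n) (auto simp: node0 nodeS)
  \<comment> \<open>The strict inequality on the right makes \<open>\<theta>\<close> positive along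
    the path.\<close>
  have inv: "l (node n \<omega>) \<le> \<omega> \<and> \<omega> < l (node n \<omega>) + \<theta> (node n \<omega>)" if "\<omega> \<in> {0..<\<theta> []}" for n \<omega>
  proof (induction n)
    case 0
    show ?case using that by (simp add: node0 l_def)
  next
    case (Suc n)
    let ?P = "node n \<omega>"
    let ?Q = "\<lambda>i. \<omega> < l ?P + (\<Sum>k\<le>i. \<theta> (?P @ [k]))"
    have "\<omega> < l ?P + (\<Sum>k<N n. \<theta> (?P @ [k]))" using Suc split[of ?P] by (simp add: len)
    moreover have "N n \<noteq> 0"
    proof
      assume "N n = 0"
      then have "\<theta> ?P = 0" using split[of ?P] by (simp add: len)
      then show False using Suc by linarith
    qed
    ultimately have "?Q (N n - 1)" by (cases "N n") (auto simp: lessThan_Suc_atMost)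
    then have 1: "?Q (step ?P \<omega>)" unfolding step_def by (rule LeastI)
    have 2: "l ?P + (\<Sum>k<step ?P \<omega>. \<theta> (?P @ [k])) \<le> \<omega>"
    proof (cases "step ?P \<omega>")
      case (Suc i)
      then have "\<not> ?Q i" using not_less_Least[of i ?Q] by (simp add: step_def)
      then show ?thesis by (simp add: Suc lessThan_Suc_atMost)
    qed (use Suc in auto)
    show ?case using 1 2 by (simp add: nodeS l_snoc lessThan_Suc_atMost[symmetric])
  qed
  show ?thesis
  proof (intro exI[of _ node] conjI allI impI)
    show "length (node n \<omega>) = n" for n \<omega> by (rule len)
    show "take m (node n \<omega>) = node m \<omega>" if "m \<le> n" for m n \<omega>
      using that by (induction n rule: dec_induct) (auto simp: nodeS len)
    show "node n \<in> measurable borel (count_space UNIV)" for n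
    proof (induction n)
      case 0
      have "node 0 = (\<lambda>_. [])" by (auto simp: node0)
      then show ?case by simp
    next
      case (Suc n)
      have "(\<lambda>\<omega>. (\<lambda>P \<omega>. P @ [step P \<omega>]) (node n \<omega>) \<omega>) \<in> measurable borel (count_space UNIV)"
      proof (rule measurable_compose_countable[OF _ Suc])
        fix P
        have "step P \<in> measurable borel (count_space UNIV)"
          unfolding step_def by (rule measurable_Least) measurable
        then show "(\<lambda>\<omega>. P @ [step P \<omega>]) \<in> measurable borel (count_space UNIV)"
          by (rule measurable_compose) simp
      qed
      moreover have "node (Suc n) = (\<lambda>\<omega>. (\<lambda>P \<omega>. P @ [step P \<omega>]) (node n \<omega>) \<omega>)"
        by (auto simp: nodeS)
      ultimately show ?case by simp
    qed
    show "emeasure lborel {\<omega>\<in>{0..<\<theta> []}. node n \<omega> = P} \<le> ennreal (\<theta> P)" for n P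
    proof -
      have "emeasure lborel {\<omega>\<in>{0..<\<theta> []}. node n \<omega> = P} \<le> emeasure lborel {l P..<l P + \<theta> P}"
        using inv by (intro emeasure_mono) auto
      also have "\<dots> = ennreal (\<theta> P)" using nonneg by simp
      finally show ?thesis .
    qed
    show "0 < \<theta> (node n \<omega>)" if "\<omega> \<in> {0..<\<theta> []}" for n \<omega>
      using inv[OF that, of n] by linarith
  qed
qed

lemma le_suminf_ennreal: "f n \<le> suminf f" for f :: "nat \<Rightarrow> ennreal"
  using sum_le_suminf[of f "{n}"] by simp

context net_partition
begin

text \<open>
  Mass is passed from each node to its children in proportion to their contents. Since the content is
  subadditive, the mass of a node never exceeds its content.
\<close>

lemma content_flow:
  "\<exists>\<theta> :: nat list \<Rightarrow> real. (\<forall>P. 0 \<le> \<theta> P) \<and> (\<forall>P. \<theta> P = (\<Sum>i<N (length P). \<theta> (P @ [i]))) \<and>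
    (\<forall>P. ennreal (\<theta> P) \<le> content u (cyl a K P)) \<and> ennreal (\<theta> []) = content u K"
proof -
  define c where "c P = enn2real (content u (cyl a K P))" for P
  have ce: "ennreal (c P) = content u (cyl a K P)" for P
    unfolding c_def using net_content_cyl_le[of a "\<lambda>n. ennreal (scale n powr u)" K P]
    by (intro ennreal_enn2real) (auto intro: le_less_trans)
  have c0: "0 \<le> c P" for P by (simp add: c_def)
  define S where "S P = (\<Sum>i<N (length P). c (P @ [i]))" for P
  have S0: "0 \<le> S P" for P unfolding S_def by (intro sum_nonneg c0)
  have cS: "c P \<le> S P" for P
  proof -
    have "ennreal (c P) \<le> (\<Sum>i<N (length P). content u (cyl a K (P @ [i])))"
      unfolding ce by (rule net_content_cyl_children) (rule a_less)
    also have "\<dots> = ennreal (S P)"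
      unfolding S_def by (simp add: ce[symmetric] c0)
    finally show ?thesis by (simp add: S0 c0)
  qed
  \<comment> \<open>If \<open>S P = 0\<close>, the division yields \<open>0\<close>, which conserves
    mass because then \<open>\<theta> P \<le> c P \<le> S P\<close> vanishes too.\<close>
  define \<theta> where "\<theta> P = c [] * (\<Prod>j<length P. c (take (Suc j) P) / S (take j P))" for P
  have \<theta>_snoc: "\<theta> (P @ [i]) = \<theta> P * (c (P @ [i]) / S P)" for P i
    unfolding \<theta>_def by (simp add: mult.assoc)
  have nonneg: "0 \<le> \<theta> P" for P
    unfolding \<theta>_def by (intro mult_nonneg_nonneg prod_nonneg divide_nonneg_nonneg c0 S0 ballI)
  have le: "\<theta> P \<le> c P" for P
  proof (induction P rule: rev_induct)
    case Nil
    show ?case by (simp add: \<theta>_def)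
  next
    case (snoc i P)
    have "\<theta> P * (c (P @ [i]) / S P) \<le> S P * (c (P @ [i]) / S P)"
      using snoc cS[of P] c0 S0 by (intro mult_right_mono divide_nonneg_nonneg) auto
    also have "\<dots> \<le> c (P @ [i])" using c0 by simp
    finally show ?case by (simp add: \<theta>_snoc)
  qed
  show ?thesis
  proof (intro exI[of _ \<theta>] conjI allI)
    show "0 \<le> \<theta> P" for P by (rule nonneg)
    show "\<theta> P = (\<Sum>i<N (length P). \<theta> (P @ [i]))" for P
    proof (cases "S P = 0")
      case True
      then have "\<theta> P = 0" using le[of P] cS[of P] nonneg[of P] by linarith
      then show ?thesis by (simp add: \<theta>_snoc)
    next
      case False
      have "(\<Sum>i<N (length P). \<theta> (P @ [i])) = \<theta> P * (S P / S P)"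
        by (simp only: \<theta>_snoc S_def sum_distrib_left sum_divide_distrib)
      then show ?thesis using False by simp
    qed
    show "ennreal (\<theta> P) \<le> content u (cyl a K P)" for P
      unfolding ce[symmetric] by (rule ennreal_leI[OF le])
    have "cyl a K [] = K" by (auto simp: cyl_def)
    then show "ennreal (\<theta> []) = content u K" using ce[of "[]"] by (simp add: \<theta>_def)
  qed
qed

text \<open>Each \<open>\<omega>\<close> follows a path of nodes of positive mass, whose cells meet
  \<open>K\<close>. Points chosen there converge to a point \<open>T \<omega>\<close> of
  \<open>K\<close>, and \<open>\<nu>\<close> is the image of Lebesgue measure under
  \<open>T\<close>. The limit may leave the cells but stays within \<open>scale n\<close> of the
  \<open>n\<close>-th point, so a ball of radius \<open>scale n\<close> receives mass only from
  cells that meet the ball of twice the radius.\<close>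

lemma content_measure:
  assumes K: "compact K" and pos: "0 < content u K" and u: "0 \<le> u"
  obtains \<nu> :: "'a measure" where "sets \<nu> = sets borel" "emeasure \<nu> (- K) = 0"
    "emeasure \<nu> UNIV \<noteq> 0" "emeasure \<nu> UNIV \<noteq> \<infinity>"
    "\<And>n y. emeasure \<nu> (cball y (scale n)) \<le> ennreal (real M ^ n * scale n powr u)"
proof -
  obtain \<theta> where \<theta>: "\<And>P. 0 \<le> \<theta> P" "\<And>P. \<theta> P = (\<Sum>i<N (length P). \<theta> (P @ [i]))"
    "\<And>P. ennreal (\<theta> P) \<le> content u (cyl a K P)" "ennreal (\<theta> []) = content u K"
    using content_flow[of u K] by (elim exE conjE) blast
  obtain node :: "nat \<Rightarrow> real \<Rightarrow> nat list" where
    node: "\<And>n \<omega>. length (node n \<omega>) = n"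
    "\<And>m n \<omega>. m \<le> n \<Longrightarrow> take m (node n \<omega>) = node m \<omega>"
    "\<And>n. node n \<in> measurable borel (count_space UNIV)"
    "\<And>n P. emeasure lborel {\<omega>\<in>{0..<\<theta> []}. node n \<omega> = P} \<le> ennreal (\<theta> P)"
    "\<And>n \<omega>. \<omega> \<in> {0..<\<theta> []} \<Longrightarrow> 0 < \<theta> (node n \<omega>)"
    using tree_flow_measure[of \<theta> N, OF \<theta>(1,2)] by (elim exE conjE) blast
  have \<theta>_le: "\<theta> P \<le> scale (length P) powr u" for P
    using order_trans[OF \<theta>(3) net_content_cyl_le] by (simp add: ennreal_le_iff)
  define \<Omega> where "\<Omega> = restrict_space lborel {0..<\<theta> []}"
  have space\<Omega>: "space \<Omega> = {0..<\<theta> []}" by (simp add: \<Omega>_def space_restrict_space)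
  have em\<Omega>: "emeasure \<Omega> A = emeasure lborel A" if "A \<subseteq> {0..<\<theta> []}" for A
    unfolding \<Omega>_def using that by (intro emeasure_restrict_space) auto
  define pt where "pt P = (SOME x. x \<in> cyl a K P)" for P
  define f where "f n \<omega> = pt (node n \<omega>)" for n \<omega>
  \<comment> \<open>Positive mass means positive content, and the empty set has content
    \<open>0\<close>.\<close>
  have f_cyl: "f n \<omega> \<in> cyl a K (node n \<omega>)" if "\<omega> \<in> {0..<\<theta> []}" for n \<omega>
  proof -
    have "0 < ennreal (\<theta> (node n \<omega>))" using node(5)[OF that] by simp
    also note \<theta>(3)
    finally have "cyl a K (node n \<omega>) \<noteq> {}" by auto
    then show ?thesis unfolding f_def pt_def by (simp add: some_in_eq)
  qed
  have code_f: "code a (f m \<omega>) n = node n \<omega>" if "\<omega> \<in> {0..<\<theta> []}" "n \<le> m" for m n \<omega>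
    using f_cyl[OF that(1), of m] node(2)[OF that(2), of \<omega>]
    by (auto simp: cyl_def node(1) take_code[OF that(2), symmetric])
  have f_dist: "dist (f m \<omega>) (f k \<omega>) \<le> scale n" if "\<omega> \<in> {0..<\<theta> []}" "0 < n" "n \<le> m" "n \<le> k" for m k n \<omega>
    using that by (intro code_dist) (auto simp: code_f)
  have "\<exists>l\<in>K. (\<lambda>n. f n \<omega>) \<longlonglongrightarrow> l" if \<omega>: "\<omega> \<in> {0..<\<theta> []}" for \<omega>
  proof -
    have "Cauchy (\<lambda>n. f n \<omega>)"
    proof (rule metric_CauchyI)
      fix e :: real assume "0 < e"
      then obtain n where n: "scale n < e" 
        using order_tendstoD(2)[OF scale_tendsto_0 \<open>0 < e\<close>] by (auto simp: eventually_sequentially)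
      have "dist (f m \<omega>) (f k \<omega>) < e" if "m \<ge> Suc n" "k \<ge> Suc n" for m k
        using f_dist[OF \<omega>, of "Suc n" m k] that n scale_antimono[of n "Suc n"] by simp
      then show "\<exists>M. \<forall>m\<ge>M. \<forall>n\<ge>M. dist (f m \<omega>) (f n \<omega>) < e" by blast
    qed
    moreover have "\<forall>n. f n \<omega> \<in> K" using f_cyl[OF \<omega>] by (auto simp: cyl_def)
    ultimately show ?thesis using compact_imp_complete[OF K] by (metis completeE)
  qed
  then obtain T where T: "\<And>\<omega>. \<omega> \<in> {0..<\<theta> []} \<Longrightarrow> T \<omega> \<in> K"
      "\<And>\<omega>. \<omega> \<in> {0..<\<theta> []} \<Longrightarrow> (\<lambda>n. f n \<omega>) \<longlonglongrightarrow> T \<omega>" by metis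
  have T_dist: "dist (f n \<omega>) (T \<omega>) \<le> scale n" if \<omega>: "\<omega> \<in> {0..<\<theta> []}" and "0 < n" for \<omega> n
  proof (rule LIMSEQ_le_const2)
    show "(\<lambda>m. dist (f n \<omega>) (f m \<omega>)) \<longlonglongrightarrow> dist (f n \<omega>) (T \<omega>)"
      by (intro tendsto_intros T(2)[OF \<omega>])
    show "\<exists>N. \<forall>m\<ge>N. dist (f n \<omega>) (f m \<omega>) \<le> scale n"
      using f_dist[OF \<omega>, of n n] that(2) by (intro exI[of _ n]) auto
  qed
  have node_sets: "{\<omega>\<in>{0..<\<theta> []}. node n \<omega> = P} \<in> sets lborel" for n P
  proof -
    have "{\<omega>\<in>{0..<\<theta> []}. node n \<omega> = P} = (node n -` {P} \<inter> space borel) \<inter> {0..<\<theta> []}" by auto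
    also have "\<dots> \<in> sets borel" by (intro sets.Int measurable_sets[OF node(3)]) auto
    finally show ?thesis by simp
  qed
  have T_meas: "T \<in> borel_measurable \<Omega>"
  proof (rule borel_measurable_LIMSEQ_metric)
    fix n
    have "f n \<in> borel_measurable lborel"
      unfolding f_def using node(3)[of n] by (intro measurable_compose[of "node n" _ "count_space UNIV" pt]) auto
    then show "f n \<in> borel_measurable \<Omega>" unfolding \<Omega>_def by (rule measurable_restrict_space1)
  qed (use T(2) in \<open>simp add: space\<Omega>\<close>)
  define \<nu> where "\<nu> = distr \<Omega> borel T"
  have em: "emeasure \<nu> A = emeasure lborel {\<omega>\<in>{0..<\<theta> []}. T \<omega> \<in> A}" if "A \<in> sets borel" for A
  proof -
    have "emeasure \<nu> A = emeasure \<Omega> (T -` A \<inter> space \<Omega>)"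
      unfolding \<nu>_def using T_meas that by (rule emeasure_distr)
    also have "T -` A \<inter> space \<Omega> = {\<omega>\<in>{0..<\<theta> []}. T \<omega> \<in> A}" by (auto simp: space\<Omega>)
    also have "emeasure \<Omega> {\<omega>\<in>{0..<\<theta> []}. T \<omega> \<in> A} = emeasure lborel {\<omega>\<in>{0..<\<theta> []}. T \<omega> \<in> A}"
      by (rule em\<Omega>) auto
    finally show ?thesis .
  qed
  have total: "emeasure \<nu> UNIV = ennreal (\<theta> [])"
  proof -
    have "{\<omega>\<in>{0..<\<theta> []}. T \<omega> \<in> UNIV} = {0..<\<theta> []}" by auto
    then show ?thesis using em[of UNIV] \<theta>(1)[of "[]"] by simp
  qed
  show thesis
  proof
    show "sets \<nu> = sets borel" by (simp add: \<nu>_def)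
    have "emeasure \<nu> (- K) = emeasure lborel {\<omega>\<in>{0..<\<theta> []}. T \<omega> \<in> - K}"
      using K by (intro em) (simp add: compact_imp_closed borel_comp)
    also have "{\<omega>\<in>{0..<\<theta> []}. T \<omega> \<in> - K} = {}" using T(1) by blast
    finally show "emeasure \<nu> (- K) = 0" by simp
    show "emeasure \<nu> UNIV \<noteq> 0" unfolding total using pos \<theta>(4) by auto
    show "emeasure \<nu> UNIV \<noteq> \<infinity>" unfolding total by simp
    show "emeasure \<nu> (cball y (scale n)) \<le> ennreal (real M ^ n * scale n powr u)" for n y
    proof (cases "n = 0")
      case True
      have "emeasure \<nu> (cball y (scale n)) \<le> emeasure \<nu> UNIV"
        by (rule emeasure_mono) (auto simp: \<nu>_def)
      \<comment> \<open>The flow starts with at most the weight of \<open>[]\<close>, which is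
        \<open>scale 0 powr u = 1\<close>.\<close>
      also have "\<dots> \<le> ennreal 1" unfolding total using \<theta>_le[of "[]"] by (intro ennreal_leI) simp
      finally show ?thesis using True by simp
    next
      case False
      let ?C = "(\<lambda>z. code a z n) ` cball y (2 * scale n)"
      have "emeasure \<nu> (cball y (scale n)) = emeasure lborel {\<omega>\<in>{0..<\<theta> []}. T \<omega> \<in> cball y (scale n)}"
        by (rule em) simp
      also have "\<dots> \<le> emeasure lborel (\<Union>P\<in>?C. {\<omega>\<in>{0..<\<theta> []}. node n \<omega> = P})"
      proof (rule emeasure_mono)
        show "{\<omega>\<in>{0..<\<theta> []}. T \<omega> \<in> cball y (scale n)} \<subseteq> (\<Union>P\<in>?C. {\<omega>\<in>{0..<\<theta> []}. node n \<omega> = P})"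
        proof
          fix \<omega> assume "\<omega> \<in> {\<omega>\<in>{0..<\<theta> []}. T \<omega> \<in> cball y (scale n)}"
          then have \<omega>: "\<omega> \<in> {0..<\<theta> []}" "dist y (T \<omega>) \<le> scale n" by auto
          then have "dist y (f n \<omega>) \<le> 2 * scale n"
            using T_dist[OF \<omega>(1), of n] False dist_triangle2[of y "f n \<omega>" "T \<omega>"] by simp
          then have "node n \<omega> \<in> ?C" using code_f[OF \<omega>(1), of n n] by (metis image_eqI le_refl mem_cball)
          then show "\<omega> \<in> (\<Union>P\<in>?C. {\<omega>\<in>{0..<\<theta> []}. node n \<omega> = P})" using \<omega>(1) by auto
        qed
        show "(\<Union>P\<in>?C. {\<omega>\<in>{0..<\<theta> []}. node n \<omega> = P}) \<in> sets lborel"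
          using finite_codes node_sets by (intro sets.finite_UN) auto
      qed
      also have "\<dots> \<le> (\<Sum>P\<in>?C. emeasure lborel {\<omega>\<in>{0..<\<theta> []}. node n \<omega> = P})"
        using finite_codes node_sets by (intro emeasure_subadditive_finite) auto
      also have "\<dots> \<le> (\<Sum>P\<in>?C. ennreal (scale n powr u))"
      proof (rule sum_mono)
        fix P assume "P \<in> ?C"
        then have "length P = n" by auto
        then show "emeasure lborel {\<omega>\<in>{0..<\<theta> []}. node n \<omega> = P} \<le> ennreal (scale n powr u)"
          using node(4)[of n P] ennreal_leI[OF \<theta>_le[of P]] by (auto intro: order_trans)
      qed
      also have "\<dots> = ennreal (real (card ?C) * scale n powr u)"
        by (simp add: ennreal_mult ennreal_of_nat_eq_real_of_nat)
      also have "\<dots> \<le> ennreal (real M ^ n * scale n powr u)"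
        using card_codes[of "cball y (2 * scale n)" y n]
        by (intro ennreal_leI mult_right_mono) (auto simp flip: of_nat_power)
      finally show ?thesis .
    qed
  qed
qed

text \<open>The kernel is dominated by a sum over scales: a point at distance between
  \<open>scale (Suc n)\<close> and \<open>scale n\<close> pays the kernel at the smaller scale.
  Integrated, the \<open>n\<close>-th term is a power of \<open>2\<close> whose exponent is a linear
  function of \<open>n\<close> minus \<open>(u - q) * n^2\<close>, because the squares of
  \<open>n\<close> and \<open>n + 1\<close> differ only linearly.\<close>

lemma energy_bound:
  fixes \<nu> :: "'a measure"
  assumes sets: "sets \<nu> = sets borel" and fin: "emeasure \<nu> UNIV \<noteq> \<infinity>"
    and ball: "\<And>n y. emeasure \<nu> (cball y (scale n)) \<le> ennreal (real M ^ n * scale n powr u)"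
    and q: "0 \<le> q" "q < u"
  shows "\<exists>B. \<forall>y. (\<integral>\<^sup>+z. inverse (ennreal (dist y z powr q)) \<partial>\<nu>) \<le> ennreal B"
proof -
  define D where "D = u - q"
  \<comment> \<open>\<open>2 * q\<close> comes from expanding \<open>(n + 1)^2\<close>,
    \<open>real M\<close> from the multiplicity, and \<open>1\<close> is kept for the factor
    \<open>(1/2) ^ n\<close>.\<close>
  define A where "A = 2 * q + real M + 1"
  define B where "B = (2 :: real) powr (A\<^sup>2 / (4 * D) + q)"
  have D: "0 < D" using q by (simp add: D_def)
  have [measurable]: "cball y r \<in> sets \<nu>" for y r by (simp add: sets)
  have scale_term: "scale (Suc n) powr - q * (real M ^ n * scale n powr u) \<le> B * (1/2) ^ n" for n
  proof -
    have "scale (Suc n) powr - q * (real M ^ n * scale n powr u)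
        \<le> scale (Suc n) powr - q * (2 powr (real M * real n) * scale n powr u)"
      by (intro mult_left_mono mult_right_mono power_le_2_powr) auto
    also have "\<dots> = 2 powr (q * (real (Suc n))\<^sup>2 + real M * real n - u * (real n)\<^sup>2)"
      by (simp add: scale_powr powr_add[symmetric] add_diff_eq del: of_nat_Suc)
    also have "q * (real (Suc n))\<^sup>2 + real M * real n - u * (real n)\<^sup>2 = (A * real n - D * (real n)\<^sup>2) + q - real n"
      by (simp add: A_def D_def power2_eq_square algebra_simps)
    also have "2 powr ((A * real n - D * (real n)\<^sup>2) + q - real n) \<le> 2 powr ((A\<^sup>2 / (4 * D)) + q - real n)"
      using quadratic_le[OF D, of A "real n"] by simp
    also have "\<dots> = B * (1/2) ^ n"
      by (simp add: B_def powr_diff powr_realpow power_one_over)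
    finally show ?thesis .
  qed
  have kernel: "inverse (ennreal (dist y z powr q)) \<le>
      1 + (\<Sum>n. ennreal (scale (Suc n) powr - q) * indicator (cball y (scale n)) z)" for y z
  proof -
    let ?f = "\<lambda>n. ennreal (scale (Suc n) powr - q) * indicator (cball y (scale n)) z"
    consider "dist y z = 0" | "0 < dist y z" "dist y z \<le> 1" | "1 < dist y z"
      using zero_le_dist[of y z] by linarith
    then show ?thesis
    proof cases
      case 1
      \<comment> \<open>At distance \<open>0\<close> the kernel is infinite, so the sum has to
        diverge.\<close>
      have "1 \<le> ?f n" for n
      proof -
        have "scale (Suc n) \<le> 1" using scale_antimono[of 0 "Suc n"] by simp
        then have "scale (Suc n) powr q \<le> 1" using q(1) by (intro powr_le1) (auto simp: abs_of_pos)
        then have "1 \<le> scale (Suc n) powr - q" by (simp add: powr_minus one_le_inverse)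
        then have "ennreal 1 \<le> ennreal (scale (Suc n) powr - q)" by (rule ennreal_leI)
        then show ?thesis using 1 by (simp add: less_imp_le)
      qed
      then have "(\<Sum>i<n. 1) \<le> (\<Sum>i<n. ?f i)" for n by (intro sum_mono)
      also have "(\<Sum>i<n. ?f i) \<le> (\<Sum>i. ?f i)" for n by (rule sum_le_suminf) auto
      finally have "of_nat n \<le> (\<Sum>i. ?f i)" for n by simp
      then have "(SUP n. of_nat n :: ennreal) \<le> (\<Sum>i. ?f i)" by (intro SUP_least)
      then have "(\<Sum>i. ?f i) = \<top>" by (simp add: ennreal_SUP_of_nat_eq_top top_unique)
      then show ?thesis by simp
    next
      case 2
      have ex: "\<exists>m. scale m < dist y z"
        using order_tendstoD(2)[OF scale_tendsto_0 2(1)] by (auto simp: eventually_sequentially)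
      define m where "m = (LEAST m. scale m < dist y z)"
      have m: "scale m < dist y z" unfolding m_def using ex by (rule LeastI_ex)
      with 2 have "m \<noteq> 0" by (auto intro!: Nat.gr0I)
      then obtain n where n: "m = Suc n" by (cases m) auto
      have "\<not> scale n < dist y z" using not_less_Least[of n "\<lambda>m. scale m < dist y z"] n by (simp add: m_def)
      then have f: "?f n = ennreal (scale (Suc n) powr - q)" by simp
      have "scale (Suc n) powr q \<le> dist y z powr q"
        using m q(1) n by (intro powr_mono2) (auto simp: less_imp_le)
      then have "inverse (dist y z powr q) \<le> inverse (scale (Suc n) powr q)"
        by (intro le_imp_inverse_le) auto
      then have "inverse (ennreal (dist y z powr q)) \<le> ennreal (scale (Suc n) powr - q)"
        using 2 by (simp add: inverse_ennreal powr_minus ennreal_leI)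
      also have "\<dots> = ?f n" by (rule f[symmetric])
      also have "?f n \<le> (\<Sum>i. ?f i)"
        by (rule le_suminf_ennreal)
      also have "\<dots> \<le> 1 + (\<Sum>i. ?f i)" by simp
      finally show ?thesis .
    next
      case 3
      have "1 \<le> dist y z powr q" using 3 q(1) by (intro ge_one_powr_ge_zero) auto
      then have "ennreal (inverse (dist y z powr q)) \<le> ennreal 1"
        by (intro ennreal_leI) (simp add: inverse_le_1_iff)
      then have "inverse (ennreal (dist y z powr q)) \<le> 1"
        using 3 by (subst inverse_ennreal) auto
      then show ?thesis by (rule order_trans) simp
    qed
  qed
  have "(\<integral>\<^sup>+z. inverse (ennreal (dist y z powr q)) \<partial>\<nu>) \<le> ennreal (measure \<nu> UNIV + 2 * B)" for y
  proof -
    have "(\<integral>\<^sup>+z. inverse (ennreal (dist y z powr q)) \<partial>\<nu>)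
      \<le> (\<integral>\<^sup>+z. 1 + (\<Sum>n. ennreal (scale (Suc n) powr - q) * indicator (cball y (scale n)) z) \<partial>\<nu>)"
      by (intro nn_integral_mono kernel)
    also have "\<dots> = emeasure \<nu> (space \<nu>) + (\<Sum>n. ennreal (scale (Suc n) powr - q) * emeasure \<nu> (cball y (scale n)))"
      by (subst nn_integral_add) (auto simp: nn_integral_suminf nn_integral_cmult_indicator)
    also have "\<dots> \<le> emeasure \<nu> (space \<nu>) + (\<Sum>n. ennreal (B * (1/2) ^ n))"
    proof (intro add_left_mono suminf_le)
      fix n
      have "ennreal (scale (Suc n) powr - q) * emeasure \<nu> (cball y (scale n))
          \<le> ennreal (scale (Suc n) powr - q) * ennreal (real M ^ n * scale n powr u)"
        by (intro mult_left_mono ball) auto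
      also have "\<dots> = ennreal (scale (Suc n) powr - q * (real M ^ n * scale n powr u))"
        by (simp add: ennreal_mult)
      also have "\<dots> \<le> ennreal (B * (1/2) ^ n)" by (rule ennreal_leI[OF scale_term])
      finally show "ennreal (scale (Suc n) powr - q) * emeasure \<nu> (cball y (scale n)) \<le> ennreal (B * (1/2) ^ n)" .
    qed auto
    also have "(\<Sum>n. ennreal (B * (1/2) ^ n)) = ennreal (2 * B)"
    proof (rule suminf_ennreal_eq)
      show "(\<lambda>n. B * (1/2) ^ n) sums (2 * B)"
        using sums_mult[OF geometric_sums[of "1/2::real"], of B] by (simp add: mult.commute)
    qed (auto simp: B_def)
    also have "emeasure \<nu> (space \<nu>) = ennreal (measure \<nu> UNIV)"
      using fin sets_eq_imp_space_eq[OF sets] by (simp add: emeasure_eq_ennreal_measure)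
    also have "ennreal (measure \<nu> UNIV) + ennreal (2 * B) = ennreal (measure \<nu> UNIV + 2 * B)"
      by (rule ennreal_plus[symmetric]) (auto simp: B_def)
    finally show ?thesis .
  qed
  then show ?thesis by blast
qed

end

text \<open>Of the exponents \<open>q < v < u\<close>, the step from \<open>u\<close> to
  \<open>v\<close> pays for compactness and the step from \<open>v\<close> to \<open>q\<close> for
  the energy integral.\<close>

lemma (in ahlfors_space) frostman:
  fixes g :: "'c::{complete_space, second_countable_topology} \<Rightarrow> 'a"
  assumes C: "closed S" "continuous_on S g" and q: "0 \<le> q" "ereal q < hausdorff_dim (g ` S)"
  shows "\<exists>K (\<nu> :: 'a measure) B. compact K \<and> K \<subseteq> g ` S \<and> sets \<nu> = sets borel \<and> emeasure \<nu> (- K) = 0 \<and>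
    emeasure \<nu> UNIV \<noteq> 0 \<and> emeasure \<nu> UNIV \<noteq> \<infinity> \<and>
    (\<forall>y. (\<integral>\<^sup>+z. inverse (ennreal (dist y z powr q)) \<partial>\<nu>) \<le> ennreal B)"
proof -
  obtain u where u: "q < u" "ereal u < hausdorff_dim (g ` S)"
    using ereal_dense2[OF q(2)] by auto
  obtain v where v: "q < v" "v < u" using dense[OF u(1)] by blast
  obtain M where M: "\<And>\<delta>. 0 < \<delta> \<Longrightarrow> \<exists>a :: 'a \<Rightarrow> nat. (\<exists>N. \<forall>x. a x < N) \<and>
     (\<forall>x y. a x = a y \<longrightarrow> dist x y \<le> \<delta>) \<and> (\<forall>x. card (a ` cball x (2 * \<delta>)) \<le> M)"
    using doubling_partition by blast
  have "\<forall>i. \<exists>(a :: 'a \<Rightarrow> nat) N. (\<forall>x. a x < N) \<and> (\<forall>x y. a x = a y \<longrightarrow> dist x y \<le> scale (Suc i)) \<and>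
      (\<forall>x. card (a ` cball x (2 * scale (Suc i))) \<le> M)"
    using M[OF scale_pos] by blast
  from choice[OF this] obtain a :: "nat \<Rightarrow> 'a \<Rightarrow> nat" where
    "\<forall>i. \<exists>N. (\<forall>x. a i x < N) \<and> (\<forall>x y. a i x = a i y \<longrightarrow> dist x y \<le> scale (Suc i)) \<and>
      (\<forall>x. card (a i ` cball x (2 * scale (Suc i))) \<le> M)" by blast
  from choice[OF this] obtain N where
    aN: "\<And>i x. a i x < N i" "\<And>i x y. a i x = a i y \<Longrightarrow> dist x y \<le> scale (Suc i)"
      "\<And>i x. card (a i ` cball x (2 * scale (Suc i))) \<le> M" by blast
  interpret net_partition a N M by standard (rule aN, erule aN, rule aN)
  have "content u (g ` S) \<noteq> 0"
    using hausdorff_measure_0_of_content[of u "g ` S"] hausdorff_dim_le[of u "g ` S"] u q by auto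
  then obtain K where K: "compact K" "K \<subseteq> g ` S" "0 < content v K"
    using compact_positive_content[OF C v(2)] by (metis zero_less_iff_neq_zero)
  obtain \<nu> :: "'a measure" where \<nu>: "sets \<nu> = sets borel" "emeasure \<nu> (- K) = 0"
    "emeasure \<nu> UNIV \<noteq> 0" "emeasure \<nu> UNIV \<noteq> \<infinity>"
    "\<And>n y. emeasure \<nu> (cball y (scale n)) \<le> ennreal (real M ^ n * scale n powr v)"
    using content_measure[OF K(1,3)] v q by (metis less_imp_le order_trans)
  from energy_bound[OF \<nu>(1,4,5) q(1) v(1)] K \<nu> show ?thesis by blast
qed


section \<open>Random densities\<close>

text \<open>Compactness supplies a countable dense set of centres. The set is then a countable union
  of products of two balls with a common centre and radii \<open>q\<close> and \<open>r - q\<close>,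
  where \<open>q\<close> is rational.\<close>

lemma sets_dist_less:
  assumes "compact (UNIV :: 'a::metric_space set)"
  shows "{p :: 'a \<times> 'a. dist (fst p) (snd p) < r} \<in> sets (borel \<Otimes>\<^sub>M borel)"
proof -
  have "\<forall>n. \<exists>k. finite k \<and> (UNIV :: 'a set) \<subseteq> (\<Union>x\<in>k. ball x (1 / real (Suc n)))"
    using assms unfolding compact_eq_totally_bounded by (metis of_nat_0_less_iff zero_less_Suc zero_less_divide_1_iff)
  from choice[OF this] obtain k where k: "\<And>n. finite (k n)"
      "\<And>n. (UNIV :: 'a set) \<subseteq> (\<Union>x\<in>k n. ball x (1 / real (Suc n)))" by blast
  let ?D = "\<Union>n. k n"
  have "countable ?D" using k(1) by (auto intro: countable_finite)
  have "{p :: 'a \<times> 'a. dist (fst p) (snd p) < r} = (\<Union>d\<in>?D. \<Union>q\<in>\<rat>. ball d q \<times> ball d (r - q))"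
  proof (intro equalityI subsetI)
    fix p :: "'a \<times> 'a" assume "p \<in> {p. dist (fst p) (snd p) < r}"
    then have e: "0 < (r - dist (fst p) (snd p)) / 3" (is "0 < ?e") by simp
    obtain n where n: "1 / real (Suc n) < ?e" using nat_approx_posE[OF e] by blast
    have "fst p \<in> (\<Union>x\<in>k n. ball x (1 / real (Suc n)))" using k(2)[of n] by blast
    then obtain d where d: "d \<in> k n" "dist d (fst p) < 1 / real (Suc n)" by auto
    obtain q where q: "q \<in> \<rat>" "?e < q" "q < 2 * ?e" using Rats_dense_in_real[of ?e "2 * ?e"] e by auto
    have "dist d (snd p) \<le> dist d (fst p) + dist (fst p) (snd p)" by (rule dist_triangle)
    also have "\<dots> < r - q" using d(2) n q(3) by simp
    finally have "p \<in> ball d q \<times> ball d (r - q)" using d(2) n q(2) by (cases p) auto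
    then show "p \<in> (\<Union>d\<in>?D. \<Union>q\<in>\<rat>. ball d q \<times> ball d (r - q))" using d(1) q(1) by blast
  next
    fix p :: "'a \<times> 'a" assume "p \<in> (\<Union>d\<in>?D. \<Union>q\<in>\<rat>. ball d q \<times> ball d (r - q))"
    then obtain d q where "dist d (fst p) < q" "dist d (snd p) < r - q" by auto
    then show "p \<in> {p. dist (fst p) (snd p) < r}" using dist_triangle3[of "fst p" "snd p" d] by simp
  qed
  also have "\<dots> \<in> sets (borel \<Otimes>\<^sub>M borel)"
    using \<open>countable ?D\<close> countable_rat by (intro sets.countable_UN'' pair_measureI) auto
  finally show ?thesis .
qed

lemma prod_mono_ennreal:
  fixes f g :: "'i \<Rightarrow> ennreal"
  shows "(\<And>i. i \<in> I \<Longrightarrow> f i \<le> g i) \<Longrightarrow> prod f I \<le> prod g I"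
  by (induction I rule: infinite_finite_induct) (auto intro: mult_mono)

context ahlfors_space
begin

lemma measurable_eq_borel [measurable_cong]: "sets \<mu> = sets borel"
  by (rule sets_eq)

lemma borel_measurable_dist_compact [measurable]:
  fixes f g :: "'b \<Rightarrow> 'a"
  assumes [measurable]: "f \<in> borel_measurable N" "g \<in> borel_measurable N"
  shows "(\<lambda>x. dist (f x) (g x)) \<in> borel_measurable N"
proof -
  have "(\<lambda>p :: 'a \<times> 'a. dist (fst p) (snd p)) \<in> borel_measurable (borel \<Otimes>\<^sub>M borel)"
  proof (rule borel_measurableI_less)
    fix r
    show "{p \<in> space (borel \<Otimes>\<^sub>M borel). dist (fst p) (snd p :: 'a) < r} \<in> sets (borel \<Otimes>\<^sub>M borel)"
      using sets_dist_less[OF compact_space, of r] by (simp add: space_pair_measure)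
  qed
  from measurable_compose[OF _ this, of "\<lambda>x. (f x, g x)" N] show ?thesis by simp
qed

text \<open>The random centre is \<open>x\<close>. The normalisation uses the ball around the point
  \<open>y\<close> instead, so that the mean over \<open>x\<close> is exactly \<open>1\<close> for
  every \<open>y\<close>.\<close>

definition ball_density :: "real \<Rightarrow> 'a \<Rightarrow> 'a \<Rightarrow> ennreal" where
  "ball_density \<rho> x y = inverse (emeasure \<mu> (cball y \<rho>)) * indicator {x. dist x y \<le> \<rho>} x"

definition block_density :: "nat set \<Rightarrow> real \<Rightarrow> (nat \<Rightarrow> 'a) \<Rightarrow> 'a \<Rightarrow> ennreal" where
  "block_density J \<rho> x y = inverse (of_nat (card J)) * (\<Sum>i\<in>J. ball_density \<rho> (x i) y)"

lemma emeasure_cball_measurable: "(\<lambda>y. emeasure \<mu> (cball y \<rho>)) \<in> borel_measurable borel"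
proof -
  have "(\<lambda>y. \<integral>\<^sup>+x. indicator {..\<rho>} (dist x y) \<partial>\<mu>) \<in> borel_measurable borel"
    by measurable
  moreover have "(\<integral>\<^sup>+x. indicator {..\<rho>} (dist x y) \<partial>\<mu>) = emeasure \<mu> (cball y \<rho>)" for y
  proof -
    have "(\<integral>\<^sup>+x. indicator {..\<rho>} (dist x y) \<partial>\<mu>) = (\<integral>\<^sup>+x. indicator (cball y \<rho>) x \<partial>\<mu>)"
      by (intro nn_integral_cong) (auto simp: indicator_def dist_commute)
    then show ?thesis by simp
  qed
  ultimately show ?thesis by simp
qed

lemma ball_density_measurable [measurable (raw)]:
  assumes [measurable]: "f \<in> borel_measurable N" "g \<in> borel_measurable N"
  shows "(\<lambda>w. ball_density \<rho> (f w) (g w)) \<in> borel_measurable N"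
proof -
  have [measurable]: "(\<lambda>w. emeasure \<mu> (cball (g w) \<rho>)) \<in> borel_measurable N"
    by (rule measurable_compose[OF _ emeasure_cball_measurable]) measurable
  have "(\<lambda>w. inverse (emeasure \<mu> (cball (g w) \<rho>)) * indicator {..\<rho>} (dist (f w) (g w))) \<in> borel_measurable N"
    by measurable
  then show ?thesis unfolding ball_density_def by (simp add: indicator_def)
qed

lemma emeasure_cball_bounds:
  assumes "0 < \<rho>" "\<rho> < diameter (UNIV :: 'a set)"
  shows "emeasure \<mu> (cball y \<rho>) \<noteq> 0" "emeasure \<mu> (cball y \<rho>) \<noteq> \<top>"
    "inverse (emeasure \<mu> (cball y \<rho>)) \<le> ennreal (C / \<rho> powr t)"
proof -
  have pos: "0 < \<rho> powr t / C" using assms C_pos by simp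
  have le: "\<rho> powr t / C \<le> measure \<mu> (cball y \<rho>)" using assms by (rule ball_lower)
  have em: "emeasure \<mu> (cball y \<rho>) = ennreal (measure \<mu> (cball y \<rho>))" by (rule emeasure_eq_measure)
  show "emeasure \<mu> (cball y \<rho>) \<noteq> 0" using pos le unfolding em by simp
  show "emeasure \<mu> (cball y \<rho>) \<noteq> \<top>" by simp
  have "inverse (measure \<mu> (cball y \<rho>)) \<le> inverse (\<rho> powr t / C)"
    using le pos by (rule le_imp_inverse_le)
  then show "inverse (emeasure \<mu> (cball y \<rho>)) \<le> ennreal (C / \<rho> powr t)"
    unfolding em using pos le by (subst inverse_ennreal) (auto intro!: ennreal_leI)
qed

lemma ball_density_mean:
  assumes "0 < \<rho>" "\<rho> < diameter (UNIV :: 'a set)"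
  shows "(\<integral>\<^sup>+x. ball_density \<rho> x y \<partial>\<mu>) = 1"
proof -
  have eq: "{x. dist x y \<le> \<rho>} = cball y \<rho>" by (auto simp: dist_commute)
  have "(\<integral>\<^sup>+x. ball_density \<rho> x y \<partial>\<mu>) = inverse (emeasure \<mu> (cball y \<rho>)) * emeasure \<mu> (cball y \<rho>)"
    unfolding ball_density_def eq by (subst nn_integral_cmult_indicator) auto
  also have "\<dots> = 1"
    using emeasure_cball_bounds[OF assms, of y] 
    by (metis ennreal_inverse_mult mult.commute ennreal_divide_self divide_ennreal_def less_top)
  finally show ?thesis .
qed

text \<open>Both factors are nonzero only if one centre is within \<open>\<rho>\<close> of
  \<open>y\<close> and of \<open>z\<close>. One factor is bounded by
  \<open>C / \<rho> powr t\<close>, the other has mean \<open>1\<close>.\<close>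

lemma ball_density_second_moment:
  assumes "0 < \<rho>" "\<rho> < diameter (UNIV :: 'a set)"
  shows "(\<integral>\<^sup>+x. ball_density \<rho> x y * ball_density \<rho> x z \<partial>\<mu>)
    \<le> ennreal (C / \<rho> powr t) * indicator {..2 * \<rho>} (dist y z)"
proof (cases "dist y z \<le> 2 * \<rho>")
  case True
  have "(\<integral>\<^sup>+x. ball_density \<rho> x y * ball_density \<rho> x z \<partial>\<mu>)
      \<le> (\<integral>\<^sup>+x. ennreal (C / \<rho> powr t) * ball_density \<rho> x z \<partial>\<mu>)"
  proof (intro nn_integral_mono mult_right_mono)
    fix x
    show "ball_density \<rho> x y \<le> ennreal (C / \<rho> powr t)"
      using emeasure_cball_bounds(3)[OF assms, of y] by (auto simp: ball_density_def indicator_def)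
  qed auto
  also have "\<dots> = ennreal (C / \<rho> powr t) * 1"
    by (subst nn_integral_cmult) (auto simp: ball_density_mean[OF assms])
  finally show ?thesis using True by simp
next
  case False
  have "ball_density \<rho> x y * ball_density \<rho> x z = 0" for x
    using False dist_triangle3[of y z x] by (auto simp: ball_density_def indicator_def)
  then have "(\<integral>\<^sup>+x. ball_density \<rho> x y * ball_density \<rho> x z \<partial>\<mu>) = (\<integral>\<^sup>+x. 0 \<partial>\<mu>)"
    by (intro nn_integral_cong)
  then show ?thesis by simp
qed

abbreviation \<Omega> :: "(nat \<Rightarrow> 'a) measure" where
  "\<Omega> \<equiv> \<Pi>\<^sub>M n\<in>(UNIV :: nat set). \<mu>"

lemma prob_space_\<Omega>: "prob_space \<Omega>"
  by (intro prob_space_PiM) (rule prob_space_axioms)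

lemma component_measurable [measurable]: "(\<lambda>x. x i) \<in> borel_measurable \<Omega>"
proof -
  have "(\<lambda>x. x i) \<in> measurable \<Omega> \<mu>" by (rule measurable_component_singleton) simp
  then show ?thesis by (simp cong: measurable_cong_sets add: measurable_cong_sets[OF refl sets_eq])
qed

lemma nn_integral_component:
  assumes "f \<in> borel_measurable borel"
  shows "(\<integral>\<^sup>+x. f (x i) \<partial>\<Omega>) = (\<integral>\<^sup>+x. f x \<partial>\<mu>)"
proof -
  have f: "f \<in> borel_measurable \<mu>"
    using assms by (simp add: measurable_cong_sets[OF sets_eq refl])
  have "(\<integral>\<^sup>+x. f x \<partial>\<mu>) = (\<integral>\<^sup>+x. f x \<partial>distr \<Omega> \<mu> (\<lambda>\<omega>. \<omega> i))"
    by (subst distr_PiM_component) (auto intro: prob_space_axioms)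
  also have "\<dots> = (\<integral>\<^sup>+x. f (x i) \<partial>\<Omega>)"
    using f by (subst nn_integral_distr) auto
  finally show ?thesis by simp
qed

lemma indep_components: "prob_space.indep_vars \<Omega> (\<lambda>_. \<mu>) (\<lambda>i x. x i) UNIV"
proof -
  interpret P: prob_space \<Omega> by (rule prob_space_\<Omega>)
  have "distr \<Omega> \<Omega> (\<lambda>x. \<lambda>i\<in>UNIV. x i) = distr \<Omega> \<Omega> (\<lambda>x. x)"
    by (intro distr_cong) auto
  also have "\<dots> = \<Omega>" by (rule distr_id2) simp
  also have "\<dots> = (\<Pi>\<^sub>M i\<in>UNIV. distr \<Omega> \<mu> (\<lambda>x. x i))"
    by (intro PiM_cong refl distr_PiM_component[symmetric]) (auto intro: prob_space_axioms)
  finally show ?thesis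
    by (subst P.indep_vars_iff_distr_eq_PiM') auto
qed

lemma nn_integral_two_components:
  assumes "f \<in> borel_measurable borel" "g \<in> borel_measurable borel" "i \<noteq> j"
  shows "(\<integral>\<^sup>+x. f (x i) * g (x j) \<partial>\<Omega>) = (\<integral>\<^sup>+x. f x \<partial>\<mu>) * (\<integral>\<^sup>+x. g x \<partial>\<mu>)"
proof -
  interpret P: prob_space \<Omega> by (rule prob_space_\<Omega>)
  have "P.indep_vars (\<lambda>_. \<mu>) (\<lambda>i x. x i) {i, j}"
    by (rule P.indep_vars_subset[OF indep_components]) simp
  then have "P.indep_vars (\<lambda>_. borel) (\<lambda>k x. (if k = i then f else g) (x k)) {i, j}"
    by (rule P.indep_vars_compose2) (use assms in \<open>auto simp: measurable_cong_sets[OF sets_eq refl]\<close>)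
  from P.indep_vars_nn_integral[OF _ this]
  show ?thesis using assms by (simp add: nn_integral_component)
qed

lemma block_density_measurable:
  assumes "\<And>i. i \<in> J \<Longrightarrow> (\<lambda>w. f w i) \<in> borel_measurable N" "g \<in> borel_measurable N"
  shows "(\<lambda>w. block_density J \<rho> (f w) (g w)) \<in> borel_measurable N"
  unfolding block_density_def
  by (intro borel_measurable_times_ennreal borel_measurable_sum borel_measurable_const
      ball_density_measurable assms)

lemma inverse_card_mult:
  "finite J \<Longrightarrow> J \<noteq> {} \<Longrightarrow> inverse (of_nat (card J)) * (of_nat (card J) :: ennreal) = 1"
  by (subst mult.commute, subst divide_ennreal_def[symmetric], rule ennreal_divide_self)
     (auto simp: less_top[symmetric])

lemma block_density_mean:
  assumes J: "finite J" "J \<noteq> {}" and \<rho>: "0 < \<rho>" "\<rho> < diameter (UNIV :: 'a set)"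
  shows "(\<integral>\<^sup>+x. block_density J \<rho> x y \<partial>\<Omega>) = 1"
proof -
  have "(\<integral>\<^sup>+x. ball_density \<rho> (x i) y \<partial>\<Omega>) = 1" for i
    by (subst nn_integral_component[of "\<lambda>x. ball_density \<rho> x y"]) (auto simp: ball_density_mean[OF \<rho>])
  then have "(\<integral>\<^sup>+x. (\<Sum>i\<in>J. ball_density \<rho> (x i) y) \<partial>\<Omega>) = of_nat (card J)"
    by (subst nn_integral_sum) auto
  then show ?thesis unfolding block_density_def
    by (subst nn_integral_cmult) (auto simp: inverse_card_mult[OF J])
qed

text \<open>Pairs of different indices are independent and contribute \<open>1\<close> each. Only
  the diagonal feels the correlation, and it makes up \<open>card J\<close> of the squared number of
  pairs.\<close>

lemma block_density_second_moment:
  assumes J: "finite J" "J \<noteq> {}" and \<rho>: "0 < \<rho>" "\<rho> < diameter (UNIV :: 'a set)"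
  shows "(\<integral>\<^sup>+x. block_density J \<rho> x y * block_density J \<rho> x z \<partial>\<Omega>)
    \<le> 1 + inverse (of_nat (card J)) * (ennreal (C / \<rho> powr t) * indicator {..2 * \<rho>} (dist y z))"
    (is "_ \<le> 1 + ?i * ?c")
proof -
  let ?n = "of_nat (card J) :: ennreal"
  let ?g = "ball_density \<rho>"
  have in1: "?i * ?n = 1" by (rule inverse_card_mult[OF J])
  have "(\<integral>\<^sup>+x. block_density J \<rho> x y * block_density J \<rho> x z \<partial>\<Omega>)
      = (\<integral>\<^sup>+x. (?i * ?i) * (\<Sum>i\<in>J. \<Sum>j\<in>J. ?g (x i) y * ?g (x j) z) \<partial>\<Omega>)"
    by (intro nn_integral_cong) (simp add: block_density_def sum_product[symmetric] ac_simps)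
  also have "\<dots> = (?i * ?i) * (\<Sum>i\<in>J. \<Sum>j\<in>J. \<integral>\<^sup>+x. ?g (x i) y * ?g (x j) z \<partial>\<Omega>)"
    by (simp add: nn_integral_cmult nn_integral_sum)
  also have "\<dots> \<le> (?i * ?i) * (\<Sum>i\<in>J. \<Sum>j\<in>J. 1 + (if j = i then ?c else 0))"
  proof (intro mult_left_mono sum_mono)
    fix i j
    show "(\<integral>\<^sup>+x. ?g (x i) y * ?g (x j) z \<partial>\<Omega>) \<le> 1 + (if j = i then ?c else 0)"
    proof (cases "j = i")
      case True
      have "(\<integral>\<^sup>+x. ?g (x i) y * ?g (x i) z \<partial>\<Omega>) = (\<integral>\<^sup>+x. ?g x y * ?g x z \<partial>\<mu>)"
        by (rule nn_integral_component[of "\<lambda>x. ?g x y * ?g x z"]) measurable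
      also have "\<dots> \<le> ?c" by (rule ball_density_second_moment[OF \<rho>])
      finally show ?thesis using True by (auto intro: order_trans)
    next
      case False
      have "(\<integral>\<^sup>+x. ?g (x i) y * ?g (x j) z \<partial>\<Omega>) = 1"
        using False
        by (subst nn_integral_two_components[of "\<lambda>x. ?g x y" "\<lambda>x. ?g x z"])
           (auto simp: ball_density_mean[OF \<rho>])
      then show ?thesis using False by simp
    qed
  qed auto
  also have "(\<Sum>i\<in>J. \<Sum>j\<in>J. 1 + (if j = i then ?c else 0)) = ?n * ?n + ?n * ?c"
    using J by (simp add: sum.distrib distrib_left)
  also have "(?i * ?i) * (?n * ?n + ?n * ?c) = (?i * ?n) * (?i * ?n) + (?i * ?n) * (?i * ?c)"
    by (simp add: distrib_left ac_simps)
  also have "\<dots> = 1 + ?i * ?c" by (simp add: in1)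
  finally show ?thesis .
qed

end

text \<open>
  The centres are split into independent blocks \<open>J j\<close>, and every ball of a block is shrunk to the
  common radius \<open>\<rho> j\<close>. The product of the block densities vanishes off the points covered in every
  block, and its mean is \<open>1\<close> everywhere.
\<close>

locale covering_blocks = ahlfors_space \<mu> t C for \<mu> :: "'a::metric_space measure" and t C +
  fixes J :: "nat \<Rightarrow> nat set" and \<rho> :: "nat \<Rightarrow> real"
  assumes J: "finite (J j)" "J j \<noteq> {}" and J_disjoint: "disjoint_family J"
    and \<rho>: "0 < \<rho> j" "\<rho> j < diameter (UNIV :: 'a set)"
begin

definition prod_density :: "nat \<Rightarrow> nat \<Rightarrow> (nat \<Rightarrow> 'a) \<Rightarrow> 'a \<Rightarrow> ennreal" where
  "prod_density L k x y = (\<Prod>j\<in>{L..<k}. block_density (J j) (\<rho> j) x y)"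

text \<open>\<open>restr\<close> expresses that \<open>f j\<close> depends only on the coordinates
  in \<open>J j\<close>, and disjoint blocks of coordinates are independent.\<close>

lemma nn_integral_prod_blocks:
  assumes f: "\<And>j. f j \<in> borel_measurable (Pi\<^sub>M (J j) (\<lambda>_. \<mu>))"
    and restr: "\<And>j x. f j (restrict x (J j)) = f j x" and I: "finite I"
  shows "(\<integral>\<^sup>+x. (\<Prod>j\<in>I. f j x) \<partial>\<Omega>) = (\<Prod>j\<in>I. \<integral>\<^sup>+x. f j x \<partial>\<Omega>)"
proof -
  interpret P: prob_space \<Omega> by (rule prob_space_\<Omega>)
  have "P.indep_vars (\<lambda>j. Pi\<^sub>M (J j) (\<lambda>_. \<mu>)) (\<lambda>j x. restrict (\<lambda>i. x i) (J j)) I"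
    by (rule P.indep_vars_restrict[OF indep_components])
       (use J_disjoint in \<open>auto simp: disjoint_family_on_def\<close>)
  then have "P.indep_vars (\<lambda>_. borel) (\<lambda>j x. f j (restrict (\<lambda>i. x i) (J j))) I"
    by (rule P.indep_vars_compose2) (rule f)
  then have "P.indep_vars (\<lambda>_. borel) f I" by (simp add: restr)
  from P.indep_vars_nn_integral[OF I this] show ?thesis by simp
qed

lemma block_density_restrict [simp]:
  "block_density K r (restrict x K) y = block_density K r x y"
  unfolding block_density_def by (intro arg_cong2[where f="(*)"] sum.cong) auto

lemma block_measurable_PiM: "(\<lambda>x. block_density K r x y) \<in> borel_measurable (Pi\<^sub>M K (\<lambda>_. \<mu>))"
proof (rule block_density_measurable)
  fix i assume "i \<in> K"
  then have "(\<lambda>x. x i) \<in> measurable (Pi\<^sub>M K (\<lambda>_. \<mu>)) \<mu>" by (rule measurable_component_singleton)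
  then show "(\<lambda>x. x i) \<in> borel_measurable (Pi\<^sub>M K (\<lambda>_. \<mu>))"
    by (simp add: measurable_cong_sets[OF refl sets_eq])
qed simp

lemma prod_density_mean: "(\<integral>\<^sup>+x. prod_density L k x y \<partial>\<Omega>) = 1"
  unfolding prod_density_def
  by (subst nn_integral_prod_blocks) (auto simp: block_density_mean[OF J \<rho>] block_measurable_PiM)

lemma prod_density_second_moment:
  "(\<integral>\<^sup>+x. prod_density L k x y * prod_density L k x z \<partial>\<Omega>) \<le> (\<Prod>j\<in>{L..<k}.
     1 + inverse (of_nat (card (J j))) * (ennreal (C / \<rho> j powr t) * indicator {..2 * \<rho> j} (dist y z)))"
proof -
  have "(\<integral>\<^sup>+x. prod_density L k x y * prod_density L k x z \<partial>\<Omega>)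
      = (\<integral>\<^sup>+x. (\<Prod>j\<in>{L..<k}. block_density (J j) (\<rho> j) x y * block_density (J j) (\<rho> j) x z) \<partial>\<Omega>)"
    by (simp add: prod_density_def prod.distrib)
  also have "\<dots> = (\<Prod>j\<in>{L..<k}. \<integral>\<^sup>+x. block_density (J j) (\<rho> j) x y * block_density (J j) (\<rho> j) x z \<partial>\<Omega>)"
    by (rule nn_integral_prod_blocks) (auto intro!: borel_measurable_times_ennreal block_measurable_PiM)
  also have "\<dots> \<le> (\<Prod>j\<in>{L..<k}.
     1 + inverse (of_nat (card (J j))) * (ennreal (C / \<rho> j powr t) * indicator {..2 * \<rho> j} (dist y z)))"
    by (intro prod_mono_ennreal block_density_second_moment J \<rho>)
  finally show ?thesis .
qed

end


section \<open>Second moments and energies\<close>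

text \<open>The value at \<open>d = 0\<close> is \<open>\<infinity>\<close>, since \<open>0 powr q = 0\<close>.\<close>

abbreviation riesz_kernel :: "real \<Rightarrow> real \<Rightarrow> ennreal" where
  "riesz_kernel q d \<equiv> inverse (ennreal (d powr q))"

lemma riesz_kernel_eq: "0 < d \<Longrightarrow> riesz_kernel q d = ennreal (d powr - q)"
  by (simp add: inverse_ennreal powr_minus)

lemma riesz_kernel_mult:
  "0 \<le> d \<Longrightarrow> riesz_kernel s d * riesz_kernel e d = riesz_kernel (s + e) d"
  by (cases "d = 0") (auto simp: riesz_kernel_eq ennreal_mult[symmetric] powr_add[symmetric])

lemma riesz_kernel_le:
  assumes "0 \<le> d" "0 \<le> s" "s \<le> q"
  shows "riesz_kernel s d \<le> 1 + riesz_kernel q d"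
proof -
  consider "d = 0" | "0 < d" "d < 1" | "1 \<le> d" using assms(1) by linarith
  then show ?thesis
  proof cases
    case 2
    then have "ennreal (d powr - s) \<le> ennreal (d powr - q)"
      using assms by (intro ennreal_leI powr_mono') auto
    then show ?thesis using 2 by (simp add: riesz_kernel_eq add_increasing)
  next
    case 3
    then have "d powr - s \<le> 1 powr - s" using assms by (intro powr_mono2') auto
    then have "ennreal (d powr - s) \<le> ennreal 1" by (intro ennreal_leI) simp
    then show ?thesis using 3 by (simp add: riesz_kernel_eq add_increasing2)
  qed simp
qed

text \<open>Locality is traded for a small factor: raising the order of the kernel by
  \<open>s\<close> gains \<open>\<delta> powr s\<close>. This makes the variance of the random
  masses small for late blocks. At \<open>d = 0\<close> both sides are infinite.\<close>

lemma riesz_kernel_local: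
  assumes "0 \<le> d" "0 < s" "0 < \<delta>"
  shows "indicator {..\<delta>} d * riesz_kernel e d \<le> ennreal (\<delta> powr s) * riesz_kernel (s + e) d"
proof -
  consider "d = 0" | "0 < d" "d \<le> \<delta>" | "\<delta> < d" using assms(1) by linarith
  then show ?thesis
  proof cases
    case 1
    then show ?thesis using assms by (simp add: ennreal_mult_eq_top_iff)
  next
    case 2
    have "d powr - e = d powr s * d powr - (s + e)" using 2 by (simp add: powr_add[symmetric])
    also have "\<dots> \<le> \<delta> powr s * d powr - (s + e)"
      using 2 assms by (intro mult_right_mono powr_mono2) auto
    finally have "ennreal (d powr - e) \<le> ennreal (\<delta> powr s * d powr - (s + e))" by (rule ennreal_leI)
    then show ?thesis using 2 by (simp add: riesz_kernel_eq ennreal_mult)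
  qed simp
qed

text \<open>Chebyshev's inequality without subtraction, from \<open>(v - z)\<^sup>2 \<ge> v\<^sup>2 / 4\<close> for \<open>z < v / 2\<close>.\<close>

lemma chebyshev_pointwise:
  assumes "0 < v"
  shows "ennreal (v\<^sup>2 / 4) * (if Z < ennreal (v / 2) then 1 else 0) + ennreal (2 * v) * Z \<le> Z * Z + ennreal (v\<^sup>2)"
proof (cases Z)
  case (real z)
  have "v\<^sup>2 / 4 * (if z < v / 2 then 1 else 0) + 2 * v * z \<le> z * z + v\<^sup>2"
  proof (cases "z < v / 2")
    case True
    then have "(v / 2)\<^sup>2 \<le> (v - z)\<^sup>2" using real assms by (intro power_mono) auto
    then show ?thesis using True by (simp add: power2_eq_square algebra_simps)
  next
    case False
    have "0 \<le> (v - z)\<^sup>2" by simp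
    then show ?thesis using False by (simp add: power2_eq_square algebra_simps)
  qed
  then have "ennreal (v\<^sup>2 / 4 * (if z < v / 2 then 1 else 0) + 2 * v * z) \<le> ennreal (z * z + v\<^sup>2)"
    by (rule ennreal_leI)
  then show ?thesis using real assms
    by (auto simp: ennreal_mult ennreal_plus ennreal_less_iff split: if_splits)
qed simp

lemma riesz_kernel_measurable [measurable]: "riesz_kernel q \<in> borel_measurable borel"
proof -
  have "(\<lambda>d. d powr q) \<in> borel_measurable borel"
    by (rule powr_real_measurable) auto
  then show ?thesis by measurable
qed

context covering_blocks
begin

lemma prod_density_measurable [measurable (raw)]:
  assumes [measurable]: "f \<in> measurable N \<Omega>" "g \<in> borel_measurable N"
  shows "(\<lambda>w. prod_density L k (f w) (g w)) \<in> borel_measurable N"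
  unfolding prod_density_def
  by (intro borel_measurable_prod_ennreal block_density_measurable assms(2)
      measurable_compose[OF assms(1) component_measurable])

end

text \<open>Of the energy order \<open>s + e\<close>, the part \<open>e\<close> is spent on the
  correlations of the blocks and \<open>s\<close> survives. \<open>L\<close> is the first block
  used; starting late confines the correlations to distances up to
  \<open>2 * \<rho> L\<close>.\<close>

locale random_energy = covering_blocks \<mu> t C J \<rho>
  for \<mu> :: "'a::metric_space measure" and t C J \<rho> +
  fixes \<nu> :: "'a measure" and v B s e :: real
  assumes sets_\<nu>: "sets \<nu> = sets borel" and mass: "emeasure \<nu> UNIV = ennreal v" and v_pos: "0 < v"
    and energy: "(\<integral>\<^sup>+z. riesz_kernel (s + e) (dist y z) \<partial>\<nu>) \<le> ennreal B" and B_nonneg: "0 \<le> B"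
    and s_pos: "0 < s" and e_nonneg: "0 \<le> e"
    and correlation: "0 \<le> d \<Longrightarrow> (\<Prod>j\<in>{L..<k}. 1 + inverse (of_nat (card (J j))) *
        (ennreal (C / \<rho> j powr t) * indicator {..2 * \<rho> j} d))
      \<le> 1 + indicator {..2 * \<rho> L} d * riesz_kernel e d"
    and \<rho>_tendsto: "\<rho> \<longlonglongrightarrow> 0"
begin

lemma measurable_\<nu> [measurable_cong]: "sets \<nu> = sets borel"
  by (rule sets_\<nu>)

lemma space_\<nu> [simp]: "space \<nu> = UNIV"
  using sets_eq_imp_space_eq[OF sets_\<nu>] by simp

lemma finite_measure_\<nu>: "finite_measure \<nu>"
  by (rule finite_measureI) (simp add: mass)

definition mass_at :: "nat \<Rightarrow> nat \<Rightarrow> (nat \<Rightarrow> 'a) \<Rightarrow> ennreal" where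
  "mass_at L k x = (\<integral>\<^sup>+y. prod_density L k x y \<partial>\<nu>)"

definition energy_at :: "nat \<Rightarrow> nat \<Rightarrow> (nat \<Rightarrow> 'a) \<Rightarrow> ennreal" where
  "energy_at L k x = (\<integral>\<^sup>+y. \<integral>\<^sup>+z. riesz_kernel s (dist y z) *
     (prod_density L k x y * prod_density L k x z) \<partial>\<nu> \<partial>\<nu>)"

lemma mass_at_measurable [measurable]: "mass_at L k \<in> borel_measurable \<Omega>"
proof -
  interpret N: finite_measure \<nu> by (rule finite_measure_\<nu>)
  show ?thesis unfolding mass_at_def by measurable
qed

lemma energy_at_measurable [measurable]: "energy_at L k \<in> borel_measurable \<Omega>"
proof -
  interpret N: finite_measure \<nu> by (rule finite_measure_\<nu>)
  show ?thesis unfolding energy_at_def by measurable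
qed

lemma mass_at_mean: "(\<integral>\<^sup>+x. mass_at L k x \<partial>\<Omega>) = ennreal v"
proof -
  interpret N: finite_measure \<nu> by (rule finite_measure_\<nu>)
  interpret P: prob_space \<Omega> by (rule prob_space_\<Omega>)
  interpret pair_sigma_finite \<nu> \<Omega> ..
  have "(\<integral>\<^sup>+x. mass_at L k x \<partial>\<Omega>) = (\<integral>\<^sup>+y. \<integral>\<^sup>+x. prod_density L k x y \<partial>\<Omega> \<partial>\<nu>)"
    unfolding mass_at_def by (rule Fubini') measurable
  also have "\<dots> = ennreal v" by (simp add: prod_density_mean mass)
  finally show ?thesis .
qed

text \<open>Applied with a constant kernel for the square of the mass and with the Riesz kernel for
  the energy.\<close>

lemma weighted_second_moment:
  assumes [measurable]: "\<kappa> \<in> borel_measurable borel"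
  shows "(\<integral>\<^sup>+x. \<integral>\<^sup>+y. \<integral>\<^sup>+z. \<kappa> (dist y z) * (prod_density L k x y * prod_density L k x z) \<partial>\<nu> \<partial>\<nu> \<partial>\<Omega>)
    \<le> (\<integral>\<^sup>+y. \<integral>\<^sup>+z. \<kappa> (dist y z) * (1 + indicator {..2 * \<rho> L} (dist y z) * riesz_kernel e (dist y z)) \<partial>\<nu> \<partial>\<nu>)"
proof -
  interpret N: finite_measure \<nu> by (rule finite_measure_\<nu>)
  interpret P: prob_space \<Omega> by (rule prob_space_\<Omega>)
  interpret pair_sigma_finite \<nu> \<Omega> ..
  let ?M = "\<lambda>x y z. prod_density L k x y * prod_density L k x z"
  have "(\<integral>\<^sup>+x. \<integral>\<^sup>+y. \<integral>\<^sup>+z. \<kappa> (dist y z) * ?M x y z \<partial>\<nu> \<partial>\<nu> \<partial>\<Omega>)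
      = (\<integral>\<^sup>+y. \<integral>\<^sup>+x. \<integral>\<^sup>+z. \<kappa> (dist y z) * ?M x y z \<partial>\<nu> \<partial>\<Omega> \<partial>\<nu>)"
    by (rule Fubini') measurable
  also have "\<dots> = (\<integral>\<^sup>+y. \<integral>\<^sup>+z. \<integral>\<^sup>+x. \<kappa> (dist y z) * ?M x y z \<partial>\<Omega> \<partial>\<nu> \<partial>\<nu>)"
    by (intro nn_integral_cong Fubini') measurable
  also have "\<dots> = (\<integral>\<^sup>+y. \<integral>\<^sup>+z. \<kappa> (dist y z) * (\<integral>\<^sup>+x. ?M x y z \<partial>\<Omega>) \<partial>\<nu> \<partial>\<nu>)"
    by (intro nn_integral_cong nn_integral_cmult) measurable
  also have "\<dots> \<le> (\<integral>\<^sup>+y. \<integral>\<^sup>+z. \<kappa> (dist y z) * (1 + indicator {..2 * \<rho> L} (dist y z) * riesz_kernel e (dist y z)) \<partial>\<nu> \<partial>\<nu>)"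
    by (intro nn_integral_mono mult_left_mono order_trans[OF prod_density_second_moment correlation]) auto
  finally show ?thesis .
qed

lemma double_energy: "(\<integral>\<^sup>+y. \<integral>\<^sup>+z. riesz_kernel (s + e) (dist y z) \<partial>\<nu> \<partial>\<nu>) \<le> ennreal (B * v)"
proof -
  have "(\<integral>\<^sup>+y. \<integral>\<^sup>+z. riesz_kernel (s + e) (dist y z) \<partial>\<nu> \<partial>\<nu>) \<le> (\<integral>\<^sup>+y. ennreal B \<partial>\<nu>)"
    by (intro nn_integral_mono energy)
  also have "\<dots> = ennreal (B * v)" using B_nonneg v_pos by (simp add: mass ennreal_mult)
  finally show ?thesis .
qed

lemma double_integral_affine:
  "(\<integral>\<^sup>+y. \<integral>\<^sup>+z. 1 + c * riesz_kernel q (dist y z) \<partial>\<nu> \<partial>\<nu>) =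
    ennreal v * ennreal v + c * (\<integral>\<^sup>+y. \<integral>\<^sup>+z. riesz_kernel q (dist y z) \<partial>\<nu> \<partial>\<nu>)"
proof -
  interpret N: finite_measure \<nu> by (rule finite_measure_\<nu>)
  have kernel: "(\<lambda>z. riesz_kernel q (dist y z)) \<in> borel_measurable \<nu>" for y
    by (intro measurable_compose[OF _ riesz_kernel_measurable] borel_measurable_dist_compact
        measurable_const measurable_ident_sets[OF sets_\<nu>]) simp
  have potential: "(\<lambda>y. \<integral>\<^sup>+z. riesz_kernel q (dist y z) \<partial>\<nu>) \<in> borel_measurable \<nu>"
  proof (rule N.borel_measurable_nn_integral)
    have "(\<lambda>p. riesz_kernel q (dist (fst p) (snd p))) \<in> borel_measurable (\<nu> \<Otimes>\<^sub>M \<nu>)"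
      by (rule measurable_compose[OF _ riesz_kernel_measurable]) measurable
    then show "(\<lambda>(y, z). riesz_kernel q (dist y z)) \<in> borel_measurable (\<nu> \<Otimes>\<^sub>M \<nu>)"
      by (simp add: case_prod_beta')
  qed
  have "(\<integral>\<^sup>+z. 1 + c * riesz_kernel q (dist y z) \<partial>\<nu>) = ennreal v + c * (\<integral>\<^sup>+z. riesz_kernel q (dist y z) \<partial>\<nu>)" for y
  proof -
    have "(\<integral>\<^sup>+z. 1 + c * riesz_kernel q (dist y z) \<partial>\<nu>)
        = (\<integral>\<^sup>+z. 1 \<partial>\<nu>) + (\<integral>\<^sup>+z. c * riesz_kernel q (dist y z) \<partial>\<nu>)"
      using kernel by (intro nn_integral_add) auto
    also have "(\<integral>\<^sup>+z. c * riesz_kernel q (dist y z) \<partial>\<nu>) = c * (\<integral>\<^sup>+z. riesz_kernel q (dist y z) \<partial>\<nu>)"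
      using kernel by (rule nn_integral_cmult)
    finally show ?thesis by (simp add: mass)
  qed
  then have "(\<integral>\<^sup>+y. \<integral>\<^sup>+z. 1 + c * riesz_kernel q (dist y z) \<partial>\<nu> \<partial>\<nu>)
      = (\<integral>\<^sup>+y. ennreal v + c * (\<integral>\<^sup>+z. riesz_kernel q (dist y z) \<partial>\<nu>) \<partial>\<nu>)" by simp
  also have "\<dots> = (\<integral>\<^sup>+y. ennreal v \<partial>\<nu>) + (\<integral>\<^sup>+y. c * (\<integral>\<^sup>+z. riesz_kernel q (dist y z) \<partial>\<nu>) \<partial>\<nu>)"
    using potential by (intro nn_integral_add) auto
  also have "(\<integral>\<^sup>+y. c * (\<integral>\<^sup>+z. riesz_kernel q (dist y z) \<partial>\<nu>) \<partial>\<nu>)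
      = c * (\<integral>\<^sup>+y. \<integral>\<^sup>+z. riesz_kernel q (dist y z) \<partial>\<nu> \<partial>\<nu>)"
    using potential by (rule nn_integral_cmult)
  finally show ?thesis by (simp add: mass)
qed

text \<open>The second term bounds the variance uniformly in \<open>k\<close>, and it tends to
  \<open>0\<close> as the first block \<open>L\<close> moves out.\<close>

lemma mass_at_second_moment:
  "(\<integral>\<^sup>+x. mass_at L k x * mass_at L k x \<partial>\<Omega>) \<le> ennreal (v\<^sup>2) + ennreal ((2 * \<rho> L) powr s * (B * v))"
proof -
  interpret N: finite_measure \<nu> by (rule finite_measure_\<nu>)
  have "mass_at L k x * mass_at L k x = (\<integral>\<^sup>+y. \<integral>\<^sup>+z. 1 * (prod_density L k x y * prod_density L k x z) \<partial>\<nu> \<partial>\<nu>)"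
    if "x \<in> space \<Omega>" for x
  proof -
    have [measurable]: "prod_density L k x \<in> borel_measurable \<nu>"
      using that measurable_ident_sets[OF sets_\<nu>]
      by (intro prod_density_measurable[of "\<lambda>_. x" \<nu> "\<lambda>y. y" L k]) (auto simp: id_def)
    show ?thesis by (simp add: mass_at_def nn_integral_cmult nn_integral_multc)
  qed
  then have "(\<integral>\<^sup>+x. mass_at L k x * mass_at L k x \<partial>\<Omega>)
      = (\<integral>\<^sup>+x. \<integral>\<^sup>+y. \<integral>\<^sup>+z. (\<lambda>_. 1) (dist y z) * (prod_density L k x y * prod_density L k x z) \<partial>\<nu> \<partial>\<nu> \<partial>\<Omega>)"
    by (intro nn_integral_cong) simp
  also have "\<dots> \<le> (\<integral>\<^sup>+y. \<integral>\<^sup>+z. (\<lambda>_. 1) (dist y z) * (1 + indicator {..2 * \<rho> L} (dist y z) * riesz_kernel e (dist y z)) \<partial>\<nu> \<partial>\<nu>)"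
    by (rule weighted_second_moment) simp
  also have "\<dots> \<le> (\<integral>\<^sup>+y. \<integral>\<^sup>+z. 1 + ennreal ((2 * \<rho> L) powr s) * riesz_kernel (s + e) (dist y z) \<partial>\<nu> \<partial>\<nu>)"
    using s_pos \<rho>(1)[of L] by (intro nn_integral_mono) (simp add: riesz_kernel_local)
  also have "\<dots> = ennreal v * ennreal v + ennreal ((2 * \<rho> L) powr s) * (\<integral>\<^sup>+y. \<integral>\<^sup>+z. riesz_kernel (s + e) (dist y z) \<partial>\<nu> \<partial>\<nu>)"
    by (rule double_integral_affine)
  also have "\<dots> \<le> ennreal v * ennreal v + ennreal ((2 * \<rho> L) powr s) * ennreal (B * v)"
    by (intro add_left_mono mult_left_mono double_energy) auto
  also have "\<dots> = ennreal (v\<^sup>2) + ennreal ((2 * \<rho> L) powr s * (B * v))"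
    using v_pos B_nonneg by (simp add: ennreal_mult power2_eq_square)
  finally show ?thesis .
qed

lemma energy_at_mean: "(\<integral>\<^sup>+x. energy_at L k x \<partial>\<Omega>) \<le> ennreal (v\<^sup>2 + 2 * (B * v))"
proof -
  interpret N: finite_measure \<nu> by (rule finite_measure_\<nu>)
  have "(\<integral>\<^sup>+x. energy_at L k x \<partial>\<Omega>)
      \<le> (\<integral>\<^sup>+y. \<integral>\<^sup>+z. riesz_kernel s (dist y z) * (1 + indicator {..2 * \<rho> L} (dist y z) * riesz_kernel e (dist y z)) \<partial>\<nu> \<partial>\<nu>)"
    unfolding energy_at_def by (rule weighted_second_moment) measurable
  also have "\<dots> \<le> (\<integral>\<^sup>+y. \<integral>\<^sup>+z. 1 + 2 * riesz_kernel (s + e) (dist y z) \<partial>\<nu> \<partial>\<nu>)"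
  proof (intro nn_integral_mono)
    fix y z :: 'a
    \<comment> \<open>The localisation is given up here; for the energy a bounded mean is
      enough.\<close>
    have "riesz_kernel s (dist y z) * (1 + indicator {..2 * \<rho> L} (dist y z) * riesz_kernel e (dist y z))
        \<le> riesz_kernel s (dist y z) * (1 + riesz_kernel e (dist y z))"
      by (intro mult_left_mono add_left_mono) (auto simp: indicator_def)
    also have "\<dots> = riesz_kernel s (dist y z) + riesz_kernel (s + e) (dist y z)"
      by (simp add: distrib_left riesz_kernel_mult)
    also have "\<dots> \<le> (1 + riesz_kernel (s + e) (dist y z)) + riesz_kernel (s + e) (dist y z)"
      using s_pos e_nonneg by (intro add_right_mono riesz_kernel_le) auto
    also have "\<dots> = 1 + 2 * riesz_kernel (s + e) (dist y z)" by (simp add: mult_2 add.assoc)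
    finally show "riesz_kernel s (dist y z) * (1 + indicator {..2 * \<rho> L} (dist y z) * riesz_kernel e (dist y z))
        \<le> 1 + 2 * riesz_kernel (s + e) (dist y z)" .
  qed
  also have "\<dots> = ennreal v * ennreal v + 2 * (\<integral>\<^sup>+y. \<integral>\<^sup>+z. riesz_kernel (s + e) (dist y z) \<partial>\<nu> \<partial>\<nu>)"
    by (rule double_integral_affine)
  also have "\<dots> \<le> ennreal v * ennreal v + 2 * ennreal (B * v)"
    by (intro add_left_mono mult_left_mono double_energy) auto
  also have "\<dots> = ennreal (v\<^sup>2 + 2 * (B * v))"
    using v_pos B_nonneg by (simp add: ennreal_plus ennreal_mult power2_eq_square)
  finally show ?thesis .
qed

lemma deviation_bound:
  "(\<integral>\<^sup>+x. (if mass_at L k x < ennreal (v / 2) then 1 else 0) \<partial>\<Omega>)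
    \<le> ennreal (4 / v\<^sup>2 * ((2 * \<rho> L) powr s * (B * v)))"
proof -
  interpret P: prob_space \<Omega> by (rule prob_space_\<Omega>)
  let ?i = "\<lambda>x. if mass_at L k x < ennreal (v / 2) then 1 else 0 :: ennreal"
  let ?\<eta> = "(2 * \<rho> L) powr s * (B * v)"
  \<comment> \<open>\<open>2 * v\<^sup>2\<close> is the mean of the cross term. It reappears in the
    bound on the other side and cancels.\<close>
  have "ennreal (2 * v\<^sup>2) + ennreal (v\<^sup>2 / 4) * (\<integral>\<^sup>+x. ?i x \<partial>\<Omega>)
      = ennreal (v\<^sup>2 / 4) * (\<integral>\<^sup>+x. ?i x \<partial>\<Omega>) + ennreal (2 * v) * (\<integral>\<^sup>+x. mass_at L k x \<partial>\<Omega>)"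
    using v_pos by (simp add: mass_at_mean ennreal_mult[symmetric] power2_eq_square ac_simps)
  also have "\<dots> = (\<integral>\<^sup>+x. ennreal (v\<^sup>2 / 4) * ?i x + ennreal (2 * v) * mass_at L k x \<partial>\<Omega>)"
    by (subst nn_integral_add) (auto simp: nn_integral_cmult)
  also have "\<dots> \<le> (\<integral>\<^sup>+x. mass_at L k x * mass_at L k x + ennreal (v\<^sup>2) \<partial>\<Omega>)"
    by (intro nn_integral_mono chebyshev_pointwise v_pos)
  also have "\<dots> = (\<integral>\<^sup>+x. mass_at L k x * mass_at L k x \<partial>\<Omega>) + ennreal (v\<^sup>2)"
    by (subst nn_integral_add) (auto simp: P.emeasure_space_1)
  also have "\<dots> \<le> (ennreal (v\<^sup>2) + ennreal ?\<eta>) + ennreal (v\<^sup>2)"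
    by (intro add_right_mono mass_at_second_moment)
  also have "\<dots> = ennreal (2 * v\<^sup>2) + ennreal ?\<eta>"
  proof -
    have "ennreal (2 * v\<^sup>2) = ennreal (v\<^sup>2) + ennreal (v\<^sup>2)"
      by (subst ennreal_plus[symmetric]) auto
    then show ?thesis by (simp add: ac_simps)
  qed
  finally have "ennreal (v\<^sup>2 / 4) * (\<integral>\<^sup>+x. ?i x \<partial>\<Omega>) \<le> ennreal ?\<eta>"
    by (simp add: ennreal_add_left_cancel_le)
  then have "ennreal (4 / v\<^sup>2) * (ennreal (v\<^sup>2 / 4) * (\<integral>\<^sup>+x. ?i x \<partial>\<Omega>)) \<le> ennreal (4 / v\<^sup>2) * ennreal ?\<eta>"
    by (intro mult_left_mono) auto
  moreover have "ennreal (4 / v\<^sup>2) * ennreal (v\<^sup>2 / 4) = 1"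
    using v_pos by (subst ennreal_mult[symmetric]) auto
  moreover have "ennreal (4 / v\<^sup>2) * ennreal ?\<eta> = ennreal (4 / v\<^sup>2 * ?\<eta>)"
    using v_pos B_nonneg by (intro ennreal_mult[symmetric]) auto
  ultimately show ?thesis by (simp add: mult.assoc[symmetric])
qed

text \<open>
  Fatou's lemma applied to the error \<open>Y\<close> replaces the convergence of the random measures: it only
  has to be small for infinitely many \<open>k\<close>.
\<close>

lemma AE_mass_and_energy:
  "AE x in \<Omega>. \<exists>L (R :: nat). \<exists>\<^sub>F k in sequentially. ennreal (v / 2) \<le> mass_at L k x \<and> energy_at L k x \<le> of_nat R"
proof -
  \<comment> \<open>\<open>Y L k x < 1\<close> forces both a mass of at least \<open>v / 2\<close>
    and an energy of at most \<open>L + 1\<close>. The weight \<open>1 / (L + 1)\<close> of the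
    energy makes the mean of \<open>Y L k\<close> tend to \<open>0\<close> with growing
    \<open>L\<close>, uniformly in \<open>k\<close>.\<close>
  define Y where "Y L k x = (if mass_at L k x < ennreal (v / 2) then 1 else 0) +
    inverse (of_nat (Suc L)) * energy_at L k x" for L k x
  define D where "D L = 4 / v\<^sup>2 * ((2 * \<rho> L) powr s * (B * v)) + inverse (real (Suc L)) * (v\<^sup>2 + 2 * (B * v))" for L
  have [measurable]: "Y L k \<in> borel_measurable \<Omega>" for L k unfolding Y_def by measurable
  have inv_eq: "inverse (of_nat (Suc L)) = ennreal (inverse (real (Suc L)))" for L
    by (simp add: inverse_ennreal[symmetric] ennreal_of_nat_eq_real_of_nat del: of_nat_Suc)
  have Y_le: "(\<integral>\<^sup>+x. Y L k x \<partial>\<Omega>) \<le> ennreal (D L)" for L k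
  proof -
    have "(\<integral>\<^sup>+x. Y L k x \<partial>\<Omega>) = (\<integral>\<^sup>+x. (if mass_at L k x < ennreal (v / 2) then 1 else 0) \<partial>\<Omega>)
        + inverse (of_nat (Suc L)) * (\<integral>\<^sup>+x. energy_at L k x \<partial>\<Omega>)"
      unfolding Y_def by (subst nn_integral_add) (auto simp: nn_integral_cmult)
    also have "\<dots> \<le> ennreal (4 / v\<^sup>2 * ((2 * \<rho> L) powr s * (B * v)))
        + inverse (of_nat (Suc L)) * ennreal (v\<^sup>2 + 2 * (B * v))"
      by (intro add_mono mult_left_mono deviation_bound energy_at_mean) auto
    also have "inverse (of_nat (Suc L)) * ennreal (v\<^sup>2 + 2 * (B * v))
        = ennreal (inverse (real (Suc L)) * (v\<^sup>2 + 2 * (B * v)))"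
      unfolding inv_eq using v_pos B_nonneg by (intro ennreal_mult[symmetric]) auto
    also have "ennreal (4 / v\<^sup>2 * ((2 * \<rho> L) powr s * (B * v))) + \<dots> = ennreal (D L)"
      using v_pos B_nonneg unfolding D_def by (intro ennreal_plus[symmetric]) auto
    finally show ?thesis .
  qed
  have "D \<longlonglongrightarrow> 4 / v\<^sup>2 * (0 * (B * v)) + 0 * (v\<^sup>2 + 2 * (B * v))"
    unfolding D_def
  proof (intro tendsto_intros LIMSEQ_inverse_real_of_nat)
    have "(\<lambda>L. 2 * \<rho> L) \<longlonglongrightarrow> 2 * 0" by (intro tendsto_intros \<rho>_tendsto)
    then show "(\<lambda>L. (2 * \<rho> L) powr s) \<longlonglongrightarrow> 0"
      using s_pos \<rho>(1) by (intro tendsto_zero_powrI[where b=s]) (auto intro: always_eventually less_imp_le)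
  qed
  then have D: "(\<lambda>L. ennreal (D L)) \<longlonglongrightarrow> 0" using tendsto_ennrealI[of D 0 sequentially] by simp
  \<comment> \<open>Its mean is \<open>0\<close>, so for almost every \<open>x\<close> some
    \<open>L\<close> has \<open>Y L k x < 1\<close> for infinitely many \<open>k\<close>.\<close>
  define W where "W x = (INF L. liminf (\<lambda>k. Y L k x))" for x
  have [measurable]: "W \<in> borel_measurable \<Omega>" unfolding W_def by measurable
  have "(\<integral>\<^sup>+x. W x \<partial>\<Omega>) \<le> ennreal (D L)" for L
  proof -
    have "(\<integral>\<^sup>+x. W x \<partial>\<Omega>) \<le> (\<integral>\<^sup>+x. liminf (\<lambda>k. Y L k x) \<partial>\<Omega>)"
      unfolding W_def by (intro nn_integral_mono INF_lower) auto
    also have "\<dots> \<le> liminf (\<lambda>k. \<integral>\<^sup>+x. Y L k x \<partial>\<Omega>)"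
      by (rule nn_integral_liminf) measurable
    also have "\<dots> \<le> liminf (\<lambda>k. ennreal (D L))"
      by (intro Liminf_mono always_eventually allI Y_le)
    also have "\<dots> = ennreal (D L)" by (simp add: Liminf_const)
    finally show ?thesis .
  qed
  then have "(\<integral>\<^sup>+x. W x \<partial>\<Omega>) \<le> 0" by (intro LIMSEQ_le_const[OF D]) auto
  then have "AE x in \<Omega>. W x = 0" by (subst nn_integral_0_iff_AE[symmetric]) auto
  then show ?thesis
  proof (rule AE_mp, intro AE_I2 impI)
    fix x assume "W x = 0"
    then have "W x < 1" by simp
    then obtain L where L: "liminf (\<lambda>k. Y L k x) < 1" unfolding W_def INF_less_iff by blast
    have "\<exists>\<^sub>F k in sequentially. Y L k x < 1"
    proof (rule ccontr)
      assume "\<not> ?thesis"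
      then have "\<forall>\<^sub>F k in sequentially. 1 \<le> Y L k x" by (simp add: frequently_def not_less)
      then have "1 \<le> liminf (\<lambda>k. Y L k x)" by (rule Liminf_bounded)
      with L show False by simp
    qed
    then have "\<exists>\<^sub>F k in sequentially. ennreal (v / 2) \<le> mass_at L k x \<and> energy_at L k x \<le> of_nat (Suc L)"
    proof (rule frequently_elim1)
      fix k assume Y: "Y L k x < 1"
      then have "\<not> mass_at L k x < ennreal (v / 2)" by (auto simp: Y_def)
      moreover have "energy_at L k x \<le> of_nat (Suc L)"
      proof -
        have "inverse (of_nat (Suc L)) * energy_at L k x \<le> 1"
          using Y by (intro order_trans[OF _ less_imp_le[OF Y]]) (simp add: Y_def)
        then have "of_nat (Suc L) * (inverse (of_nat (Suc L)) * energy_at L k x) \<le> of_nat (Suc L) * 1"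
          by (intro mult_left_mono) auto
        moreover have "of_nat (Suc L) * (inverse (of_nat (Suc L)) :: ennreal) = 1"
          using inverse_card_mult[of "{..L}"] by (simp add: mult.commute)
        ultimately show ?thesis by (simp add: mult.assoc[symmetric])
      qed
      ultimately show "ennreal (v / 2) \<le> mass_at L k x \<and> energy_at L k x \<le> of_nat (Suc L)" by simp
    qed
    then show "\<exists>L (R :: nat). \<exists>\<^sub>F k in sequentially. ennreal (v / 2) \<le> mass_at L k x \<and> energy_at L k x \<le> of_nat R"
      by blast
  qed
qed

end


section \<open>Dimension from below\<close>

text \<open>Either \<open>m\<close> is at most \<open>c\<close>, or \<open>m / c\<close> exceeds
  \<open>1\<close>; infinite \<open>m\<close> is included.\<close>

lemma AM_GM_ennreal:
  assumes "0 < c"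
  shows "m \<le> ennreal c + inverse (ennreal c) * (m * m)"
proof (cases "m \<le> ennreal c")
  case True
  then show ?thesis by (simp add: add_increasing2)
next
  case False
  have "inverse (ennreal c) * ennreal c = 1"
    using assms by (simp add: inverse_ennreal ennreal_mult[symmetric])
  then have "m = inverse (ennreal c) * (ennreal c * m)" by (simp add: mult.assoc[symmetric])
  also have "\<dots> \<le> inverse (ennreal c) * (m * m)"
    using False by (intro mult_left_mono mult_right_mono) auto
  finally show ?thesis by (rule add_increasing[OF zero_le])
qed

lemma inverse_ennreal_antimono:
  "0 \<le> x \<Longrightarrow> x \<le> y \<Longrightarrow> inverse (ennreal y) \<le> inverse (ennreal x)"
  by (cases "x = 0") (auto simp: inverse_ennreal intro!: ennreal_leI le_imp_inverse_le)

text \<open>The density \<open>f k\<close> sees only blocks before \<open>k\<close>, while a cover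
  is given for the intersection over all blocks. Compactness passes from one to the other.\<close>

lemma compact_INT_subset_open:
  fixes V :: "nat \<Rightarrow> 'a::metric_space set"
  assumes "compact K" "\<And>j. closed (V j)" "open G" "K \<inter> (\<Inter>j\<in>{L..}. V j) \<subseteq> G"
  obtains k0 where "\<And>k. k0 \<le> k \<Longrightarrow> K \<inter> (\<Inter>j\<in>{L..<k}. V j) \<subseteq> G"
proof -
  have "(K - G) \<inter> (\<Inter>j\<in>{L..}. V j) = {}" using assms(4) by blast
  then obtain T where T: "finite T" "T \<subseteq> {L..}" "(K - G) \<inter> (\<Inter>j\<in>T. V j) = {}"
    using compact_imp_fip_image[OF compact_diff[OF assms(1,3)], of "{L..}" V] assms(2) by blast
  show thesis
  proof (rule that[of "Suc (Max (insert 0 T))"])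
    fix k assume k: "Suc (Max (insert 0 T)) \<le> k"
    have "j < k" if "j \<in> T" for j
    proof -
      have "j \<le> Max (insert 0 T)" using T(1) that by (intro Max_ge) auto
      with k show ?thesis by linarith
    qed
    then have "T \<subseteq> {L..<k}" using T(2) by auto
    then show "K \<inter> (\<Inter>j\<in>{L..<k}. V j) \<subseteq> G" using T(3) by blast
  qed
qed

text \<open>
  If \<open>f k\<close> charges disjoint cover pieces with masses \<open>m i\<close>, its energy is at least the sum of
  \<open>(m i)\<^sup>2 / (e i) powr s\<close>, and AM-GM bounds the total mass by energy and cover sum. No limit of the
  measures with densities \<open>f k\<close> is needed.
\<close>

lemma hausdorff_dim_ge_of_energy:
  fixes \<nu> :: "'a::metric_space measure" and f :: "nat \<Rightarrow> 'a \<Rightarrow> ennreal" and V :: "nat \<Rightarrow> 'a set"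
  assumes K: "compact K" and V: "\<And>j. closed (V j)" and sub: "K \<inter> (\<Inter>j\<in>{L..}. V j) \<subseteq> A"
    and sets: "sets \<nu> = sets borel" and null: "emeasure \<nu> (- K) = 0"
    and f: "\<And>k. f k \<in> borel_measurable borel"
    and zero: "\<And>k j y. L \<le> j \<Longrightarrow> j < k \<Longrightarrow> y \<notin> V j \<Longrightarrow> f k y = 0"
    and v: "0 < v" and s: "0 < s"
    and freq: "\<exists>\<^sub>F k in sequentially. ennreal (v / 2) \<le> (\<integral>\<^sup>+y. f k y \<partial>\<nu>) \<and>
      (\<integral>\<^sup>+y. \<integral>\<^sup>+z. riesz_kernel s (dist y z) * (f k y * f k z) \<partial>\<nu> \<partial>\<nu>) \<le> of_nat R"
  shows "ereal s \<le> hausdorff_dim A"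
proof -
  \<comment> \<open>Balances the two halves of AM-GM: a cover sum of at most
    \<open>v / (8 * \<Lambda>)\<close> and an energy of at most \<open>R\<close> contribute at most
    \<open>v / 8\<close> each, together less than the mass \<open>v / 2\<close>.
    \<open>R + 1\<close> keeps \<open>\<Lambda>\<close> positive.\<close>
  define \<Lambda> where "\<Lambda> = 8 * (real R + 1) / v"
  have \<Lambda>: "0 < \<Lambda>" using v by (simp add: \<Lambda>_def)
  have \<epsilon>: "0 < v / (8 * \<Lambda>)" using v \<Lambda> by simp
  show ?thesis
  proof (rule hausdorff_dim_ge_open_cover[OF s \<epsilon>])
    fix U :: "nat \<Rightarrow> 'a set" and e :: "nat \<Rightarrow> real"
    assume cov: "A \<subseteq> (\<Union>i. U i)" and op: "\<And>i. open (U i)" and e: "\<And>i. 0 < e i"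
      and diam: "\<And>i y z. y \<in> U i \<Longrightarrow> z \<in> U i \<Longrightarrow> dist y z \<le> e i"
      and small: "(\<Sum>i. ennreal (e i powr s)) \<le> ennreal (v / (8 * \<Lambda>))"
    let ?G = "\<Union>i. U i"
    have G: "open ?G" using op by auto
    obtain k0 where k0: "\<And>k. k0 \<le> k \<Longrightarrow> K \<inter> (\<Inter>j\<in>{L..<k}. V j) \<subseteq> ?G"
      by (rule compact_INT_subset_open[OF K V G order_trans[OF sub cov]]) blast
    obtain k where k: "k0 \<le> k" and mass: "ennreal (v / 2) \<le> (\<integral>\<^sup>+y. f k y \<partial>\<nu>)"
      and en: "(\<integral>\<^sup>+y. \<integral>\<^sup>+z. riesz_kernel s (dist y z) * (f k y * f k z) \<partial>\<nu> \<partial>\<nu>) \<le> of_nat R"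
      using freq unfolding frequently_sequentially by blast
    have fm [measurable]: "f k \<in> borel_measurable \<nu>"
      using f[of k] by (simp add: measurable_cong_sets[OF sets refl])
    have space: "space \<nu> = UNIV" using sets_eq_imp_space_eq[OF sets] by simp
    define D where "D = density \<nu> (f k)"
    \<comment> \<open>Disjointness places the products \<open>m i * m i\<close> in disjoint regions
      of the double integral.\<close>
    define W where "W = disjointed U"
    have Wsets [measurable]: "W i \<in> sets \<nu>" for i
    proof -
      have "range U \<subseteq> sets borel" using op by auto
      from sets.range_disjointed_sets[OF this] show ?thesis unfolding W_def sets by blast
    qed
    have Wdisj: "disjoint_family W" unfolding W_def by (rule disjoint_family_disjointed)
    have WU: "W i \<subseteq> U i" for i unfolding W_def by (rule disjointed_subset)
    define m where "m i = emeasure D (W i)" for i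
    have m_eq: "m i = (\<integral>\<^sup>+y. f k y * indicator (W i) y \<partial>\<nu>)" for i
      unfolding m_def D_def by (rule emeasure_density) auto
    have "(\<integral>\<^sup>+y. f k y \<partial>\<nu>) = (\<integral>\<^sup>+y. f k y * indicator ?G y \<partial>\<nu>)"
    proof (rule nn_integral_cong_AE)
      have "AE y in \<nu>. y \<in> K"
        using null K by (intro AE_I[of _ _ "- K"]) (auto simp: sets compact_imp_closed)
      then show "AE y in \<nu>. f k y = f k y * indicator ?G y"
      proof (rule AE_mp, intro AE_I2 impI)
        fix y assume "y \<in> K"
        show "f k y = f k y * indicator ?G y"
        proof (cases "y \<in> ?G")
          case False
          then have "y \<notin> (\<Inter>j\<in>{L..<k}. V j)" using k0[OF k] \<open>y \<in> K\<close> by blast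
          then obtain j where "L \<le> j" "j < k" "y \<notin> V j" by auto
          then show ?thesis by (simp add: zero)
        qed simp
      qed
    qed
    also have "\<dots> = emeasure D ?G"
      unfolding D_def using G by (intro emeasure_density[symmetric]) (auto simp: sets)
    also have "?G = (\<Union>i. W i)" by (simp add: W_def UN_disjointed_eq)
    also have "emeasure D (\<Union>i. W i) = (\<Sum>i. m i)"
      unfolding m_def by (rule suminf_emeasure[symmetric]) (auto simp: D_def Wdisj)
    finally have mass_eq: "(\<integral>\<^sup>+y. f k y \<partial>\<nu>) = (\<Sum>i. m i)" .
    have c: "inverse (ennreal (\<Lambda> * e i powr s)) = ennreal (inverse \<Lambda>) * inverse (ennreal (e i powr s))" for i
      using \<Lambda> e[of i] by (simp add: inverse_ennreal ennreal_mult[symmetric])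
    have "(\<Sum>i. m i) \<le> (\<Sum>i. ennreal (\<Lambda> * e i powr s) + inverse (ennreal (\<Lambda> * e i powr s)) * (m i * m i))"
    proof (intro suminf_le AM_GM_ennreal)
      show "0 < \<Lambda> * e i powr s" for i using \<Lambda> e[of i] by simp
    qed auto
    also have "\<dots> = (\<Sum>i. ennreal \<Lambda> * ennreal (e i powr s)) +
        (\<Sum>i. ennreal (inverse \<Lambda>) * (inverse (ennreal (e i powr s)) * (m i * m i)))"
    proof -
      have c': "ennreal (\<Lambda> * e i powr s) = ennreal \<Lambda> * ennreal (e i powr s)" for i
        using \<Lambda> by (intro ennreal_mult) auto
      show ?thesis by (subst suminf_add) (simp_all only: c[unfolded c'] c' mult.assoc summableI)
    qed
    also have "\<dots> = ennreal \<Lambda> * (\<Sum>i. ennreal (e i powr s)) +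
        ennreal (inverse \<Lambda>) * (\<Sum>i. inverse (ennreal (e i powr s)) * (m i * m i))"
      by simp
    also have "\<dots> \<le> ennreal \<Lambda> * ennreal (v / (8 * \<Lambda>)) + ennreal (inverse \<Lambda>) * of_nat R"
    proof (intro add_mono mult_left_mono small order_trans[OF _ en])
      let ?g = "\<lambda>i y. f k y * indicator (W i) y"
      have "inverse (ennreal (e i powr s)) * (m i * m i)
          = (\<integral>\<^sup>+y. \<integral>\<^sup>+z. inverse (ennreal (e i powr s)) * (?g i y * ?g i z) \<partial>\<nu> \<partial>\<nu>)" for i
        unfolding m_eq by (simp add: nn_integral_cmult nn_integral_multc)
      then have "(\<Sum>i. inverse (ennreal (e i powr s)) * (m i * m i))
          = (\<Sum>i. \<integral>\<^sup>+y. \<integral>\<^sup>+z. inverse (ennreal (e i powr s)) * (?g i y * ?g i z) \<partial>\<nu> \<partial>\<nu>)"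
        by simp
      also have "\<dots> = (\<integral>\<^sup>+y. (\<Sum>i. \<integral>\<^sup>+z. inverse (ennreal (e i powr s)) * (?g i y * ?g i z) \<partial>\<nu>) \<partial>\<nu>)"
        by (rule nn_integral_suminf[symmetric]) (simp add: nn_integral_cmult)
      also have "\<dots> = (\<integral>\<^sup>+y. \<integral>\<^sup>+z. (\<Sum>i. inverse (ennreal (e i powr s)) * (?g i y * ?g i z)) \<partial>\<nu> \<partial>\<nu>)"
        by (intro nn_integral_cong nn_integral_suminf[symmetric]) simp
      also have "\<dots> \<le> (\<integral>\<^sup>+y. \<integral>\<^sup>+z. riesz_kernel s (dist y z) * (f k y * f k z) \<partial>\<nu> \<partial>\<nu>)"
      proof (intro nn_integral_mono)
        fix y z
        show "(\<Sum>i. inverse (ennreal (e i powr s)) * (?g i y * ?g i z))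
            \<le> riesz_kernel s (dist y z) * (f k y * f k z)"
        proof (cases "\<exists>i. y \<in> W i \<and> z \<in> W i")
          case True
          then obtain i where i: "y \<in> W i" "z \<in> W i" by blast
          then have "y \<notin> W j" if "j \<noteq> i" for j
            using Wdisj that unfolding disjoint_family_on_def by blast
          then have "(\<Sum>j. inverse (ennreal (e j powr s)) * (?g j y * ?g j z))
              = (\<Sum>j\<in>{i}. inverse (ennreal (e j powr s)) * (?g j y * ?g j z))"
            by (intro suminf_finite) auto
          also have "\<dots> = inverse (ennreal (e i powr s)) * (f k y * f k z)" using i by simp
          also have "\<dots> \<le> riesz_kernel s (dist y z) * (f k y * f k z)"
          proof (rule mult_right_mono)
            have "dist y z \<le> e i" using i WU by (intro diam) auto
            then have "dist y z powr s \<le> e i powr s" using s by (intro powr_mono2) auto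
            then show "inverse (ennreal (e i powr s)) \<le> riesz_kernel s (dist y z)"
              by (intro inverse_ennreal_antimono) auto
          qed simp
          finally show ?thesis .
        next
          case False
          then have "inverse (ennreal (e i powr s)) * (?g i y * ?g i z) = 0" for i
            by (auto simp: indicator_def)
          then have "(\<Sum>i. inverse (ennreal (e i powr s)) * (?g i y * ?g i z)) = (\<Sum>i. 0)"
            by (intro suminf_cong)
          then show ?thesis by simp
        qed
      qed
      finally show "(\<Sum>i. inverse (ennreal (e i powr s)) * (m i * m i))
          \<le> (\<integral>\<^sup>+y. \<integral>\<^sup>+z. riesz_kernel s (dist y z) * (f k y * f k z) \<partial>\<nu> \<partial>\<nu>)" .
    qed auto
    also have "\<dots> = ennreal (\<Lambda> * (v / (8 * \<Lambda>)) + inverse \<Lambda> * real R)"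
      using \<Lambda> v by (simp add: ennreal_of_nat_eq_real_of_nat ennreal_mult[symmetric] ennreal_plus[symmetric] del: ennreal_plus)
    also have "\<Lambda> * (v / (8 * \<Lambda>)) + inverse \<Lambda> * real R \<le> v / 8 + v / 8"
    proof (rule add_mono)
      show "\<Lambda> * (v / (8 * \<Lambda>)) \<le> v / 8" using \<Lambda> by simp
      have "inverse \<Lambda> * real R \<le> inverse \<Lambda> * (real R + 1)" using \<Lambda> by simp
      also have "\<dots> = v / 8" using v by (simp add: \<Lambda>_def field_simps)
      finally show "inverse \<Lambda> * real R \<le> v / 8" .
    qed
    finally have "(\<Sum>i. m i) \<le> ennreal (v / 8 + v / 8)" by (simp add: ennreal_leI)
    with mass have "ennreal (v / 2) \<le> ennreal (v / 8 + v / 8)" unfolding mass_eq by (rule order_trans)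
    then show False using v by (simp add: ennreal_le_iff)
  qed
qed

section \<open>Sparse blocks of balls and their correlations\<close>

lemma frequently_of_limsup:
  fixes r :: "nat \<Rightarrow> real"
  assumes r: "\<And>n. 0 < r n" "r \<longlonglongrightarrow> 0"
    and b: "ereal b < limsup (\<lambda>n. ereal (ln (real n) / - ln (r n)))"
  shows "\<exists>\<^sub>F n in sequentially. r n powr - b \<le> real n"
proof -
  have "\<exists>\<^sub>F n in sequentially. ereal b < ereal (ln (real n) / - ln (r n))"
  proof (rule ccontr)
    assume "\<not> ?thesis"
    then have "\<forall>\<^sub>F n in sequentially. ereal (ln (real n) / - ln (r n)) \<le> ereal b"
      by (simp add: frequently_def not_less)
    then have "limsup (\<lambda>n. ereal (ln (real n) / - ln (r n))) \<le> ereal b" by (rule Limsup_bounded)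
    with b show False by simp
  qed
  moreover have "\<forall>\<^sub>F n in sequentially. r n < 1 \<and> 0 < n"
    using order_tendstoD(2)[OF r(2), of 1] eventually_gt_at_top[of 0] by (simp add: eventually_conj)
  ultimately have "\<exists>\<^sub>F n in sequentially. ereal b < ereal (ln (real n) / - ln (r n)) \<and> r n < 1 \<and> 0 < n"
    by (rule frequently_eventually_frequently)
  then show ?thesis
  proof (rule frequently_elim1)
    fix n assume n: "ereal b < ereal (ln (real n) / - ln (r n)) \<and> r n < 1 \<and> 0 < n"
    have pos: "0 < - ln (r n)" using n r(1)[of n] by (simp add: ln_less_zero)
    have "b * - ln (r n) < ln (real n)"
      using conjunct1[OF n] by (simp only: less_ereal.simps pos_less_divide_eq[OF pos])
    then have "exp (b * - ln (r n)) < real n"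
      using n by (metis exp_less_mono exp_ln of_nat_0_less_iff)
    then show "r n powr - b \<le> real n" using r(1)[of n] by (simp add: powr_def)
  qed
qed

text \<open>
  The last condition makes the radii so sparse that the correlations of all earlier blocks are
  absorbed by the exponent \<open>e > \<beta>\<close>.
\<close>

lemma block_sequence:
  fixes r :: "nat \<Rightarrow> real"
  assumes r: "\<And>n. 0 < r n" "r \<longlonglongrightarrow> 0"
    and b: "ereal b < limsup (\<lambda>n. ereal (ln (real n) / - ln (r n)))"
    and K: "0 \<le> K" and e: "0 < e" "\<beta> < e" and \<delta>: "0 < \<delta>"
  obtains n :: "nat \<Rightarrow> nat" where "\<And>j. 2 * n j < n (Suc j)"
    "\<And>j. r (n (Suc j)) powr - b \<le> real (n (Suc j))" "\<And>j. r (n (Suc j)) < \<delta>"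
    "\<And>j. (\<Prod>i\<le>j. 1 + K * r (n (Suc i)) powr - \<beta>) \<le> (2 * r (n (Suc j))) powr - e"
proof -
  \<comment> \<open>\<open>p\<close> is the product of the factors accumulated so far. As
    \<open>\<beta> < e\<close>, multiplying the left-hand side of the last condition by
    \<open>(2 * r m) powr e\<close> gives a null sequence, so every late \<open>m\<close> satisfies
    that condition, and among these some satisfy the condition on \<open>b\<close>.\<close>
  have step: "\<exists>m. 2 * n < m \<and> r m powr - b \<le> real m \<and> r m < \<delta> \<and>
      p * (1 + K * r m powr - \<beta>) \<le> (2 * r m) powr - e" if p: "0 < p" for n and p :: real
  proof -
    have "(\<lambda>m. p * ((2 * r m) powr e + K * 2 powr e * r m powr (e - \<beta>))) \<longlonglongrightarrow> p * (0 + K * 2 powr e * 0)"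
    proof (intro tendsto_intros)
      have "(\<lambda>m. 2 * r m) \<longlonglongrightarrow> 2 * 0" by (intro tendsto_intros r)
      then show "(\<lambda>m. (2 * r m) powr e) \<longlonglongrightarrow> 0"
        using e r(1) by (intro tendsto_zero_powrI[where b=e]) (auto intro: always_eventually less_imp_le)
      show "(\<lambda>m. r m powr (e - \<beta>)) \<longlonglongrightarrow> 0"
        using e r by (intro tendsto_zero_powrI[where b="e - \<beta>"]) (auto intro: always_eventually less_imp_le)
    qed
    then have "\<forall>\<^sub>F m in sequentially. p * ((2 * r m) powr e + K * 2 powr e * r m powr (e - \<beta>)) < 1"
      by (intro order_tendstoD) auto
    moreover have "\<forall>\<^sub>F m in sequentially. r m < \<delta>" using r(2) \<delta> by (rule order_tendstoD)
    moreover have "\<forall>\<^sub>F m in sequentially. 2 * n < m" by (rule eventually_gt_at_top)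
    ultimately have "\<forall>\<^sub>F m in sequentially. p * ((2 * r m) powr e + K * 2 powr e * r m powr (e - \<beta>)) < 1
        \<and> r m < \<delta> \<and> 2 * n < m" by (intro eventually_conj)
    from frequently_eventually_frequently[OF frequently_of_limsup[OF r b] this]
    obtain m where m: "p * ((2 * r m) powr e + K * 2 powr e * r m powr (e - \<beta>)) < 1"
        "r m < \<delta>" "2 * n < m" "r m powr - b \<le> real m"
      using frequently_ex by blast
    have "p * (1 + K * r m powr - \<beta>) * (2 * r m) powr e
        = p * ((2 * r m) powr e + K * 2 powr e * r m powr (e - \<beta>))"
      using r(1)[of m] by (simp add: powr_mult powr_diff powr_minus field_simps)
    also have "\<dots> \<le> 1" using m by simp
    finally have "p * (1 + K * r m powr - \<beta>) \<le> (2 * r m) powr - e"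
      using r(1)[of m] by (simp add: powr_minus pos_le_divide_eq divide_inverse[symmetric] field_simps)
    with m show ?thesis by blast
  qed
  \<comment> \<open>A state pairs the chosen index with the product of all factors up to it.\<close>
  define P where "P np mq \<longleftrightarrow> (case np of (n, p) \<Rightarrow> case mq of (m, q) \<Rightarrow> 2 * n < m \<and>
      r m powr - b \<le> real m \<and> r m < \<delta> \<and> q = p * (1 + K * r m powr - \<beta>) \<and> q \<le> (2 * r m) powr - e)"
    for np mq :: "nat \<times> real"
  have "\<exists>f. f 0 = (0, 1) \<and> (\<forall>j. 0 < snd (f j) \<and> P (f j) (f (Suc j)))"
  proof -
    have "\<exists>f. \<forall>j. (0 < snd (f j) \<and> (j = 0 \<longrightarrow> f j = (0, 1))) \<and> P (f j) (f (Suc j))"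
    proof (rule dependent_nat_choice)
      show "\<exists>x. 0 < snd x \<and> (0 = (0::nat) \<longrightarrow> x = (0 :: nat, 1 :: real))" by (intro exI[of _ "(0, 1)"]) auto
    next
      fix np :: "nat \<times> real" and j :: nat
      assume np: "0 < snd np \<and> (j = 0 \<longrightarrow> np = (0, 1))"
      obtain m where m: "2 * fst np < m" "r m powr - b \<le> real m" "r m < \<delta>"
          "snd np * (1 + K * r m powr - \<beta>) \<le> (2 * r m) powr - e"
        using step[of "snd np" "fst np"] np by blast
      have "0 < snd np * (1 + K * r m powr - \<beta>)"
        using np K by (intro mult_pos_pos add_pos_nonneg) auto
      then show "\<exists>y. (0 < snd y \<and> (Suc j = 0 \<longrightarrow> y = (0, 1))) \<and> P np y"
        using m by (intro exI[of _ "(m, snd np * (1 + K * r m powr - \<beta>))"]) (auto simp: P_def split: prod.splits)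
    qed
    then show ?thesis by blast
  qed
  then obtain f where f: "f 0 = (0, 1)" "\<And>j. P (f j) (f (Suc j))" by blast
  define n where "n j = fst (f j)" for j
  have f_eq: "f j = (n j, snd (f j))" for j by (simp add: n_def)
  have fP: "2 * n j < n (Suc j) \<and> r (n (Suc j)) powr - b \<le> real (n (Suc j)) \<and> r (n (Suc j)) < \<delta> \<and>
      snd (f (Suc j)) = snd (f j) * (1 + K * r (n (Suc j)) powr - \<beta>) \<and>
      snd (f (Suc j)) \<le> (2 * r (n (Suc j))) powr - e" for j
    using f(2)[of j] unfolding P_def by (simp add: n_def split_beta)
  have prod: "snd (f (Suc j)) = (\<Prod>i\<le>j. 1 + K * r (n (Suc i)) powr - \<beta>)" for j
  proof (induction j)
    case 0
    show ?case using fP[of 0] f(1) by simp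
  next
    case (Suc j)
    then show ?case using fP[of "Suc j"] by (simp add: mult.commute)
  qed
  show thesis
  proof (rule that[of n])
    show "2 * n j < n (Suc j)" for j using fP[of j] by simp
    show "r (n (Suc j)) powr - b \<le> real (n (Suc j))" for j using fP[of j] by simp
    show "r (n (Suc j)) < \<delta>" for j using fP[of j] by simp
    show "(\<Prod>i\<le>j. 1 + K * r (n (Suc i)) powr - \<beta>) \<le> (2 * r (n (Suc j))) powr - e" for j
      using fP[of j] unfolding prod by simp
  qed
qed

text \<open>A factor differs from \<open>1\<close> only if \<open>d \<le> 2 * \<rho> j\<close>. If
  \<open>m\<close> is the largest such index, sparsity bounds the product by
  \<open>(2 * \<rho> m) powr - e\<close>, hence by \<open>d powr - e\<close>.\<close>

lemma correlation_bound:
  fixes \<rho> a :: "nat \<Rightarrow> real"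
  assumes \<rho>: "\<And>j. 0 < \<rho> j" "decseq \<rho>" and a: "\<And>j. 0 \<le> a j"
    and sparse: "\<And>j. (\<Prod>i\<le>j. 1 + a i) \<le> (2 * \<rho> j) powr - e"
    and e: "0 \<le> e" and d: "0 \<le> d"
  shows "(\<Prod>j\<in>{L..<k}. 1 + ennreal (a j) * indicator {..2 * \<rho> j} d)
    \<le> 1 + indicator {..2 * \<rho> L} d * riesz_kernel e d"
proof -
  define S where "S = {j\<in>{L..<k}. d \<le> 2 * \<rho> j}"
  have eq: "(\<Prod>j\<in>{L..<k}. 1 + ennreal (a j) * indicator {..2 * \<rho> j} d) = (\<Prod>j\<in>S. ennreal (1 + a j))"
    unfolding S_def using a
    by (intro prod.mono_neutral_cong_right) (auto simp: ennreal_plus)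
  show ?thesis
  proof (cases "S = {} \<or> d = 0")
    case True
    then show ?thesis
    proof
      assume "d = 0"
      then show ?thesis using \<rho>(1)[of L] by simp
    qed (simp add: eq)
  next
    case False
    define m where "m = Max S"
    have fin: "finite S" by (simp add: S_def)
    have "m \<in> S" unfolding m_def using fin False by (intro Max_in) auto
    then have m: "L \<le> m" "d \<le> 2 * \<rho> m" by (auto simp: S_def)
    have sub: "S \<subseteq> {..m}" unfolding m_def using fin by auto
    have "(\<Prod>j\<in>S. 1 + a j) \<le> (\<Prod>j\<le>m. 1 + a j)"
      using sub a by (intro prod_mono2) (auto intro: add_nonneg_nonneg)
    also have "\<dots> \<le> (2 * \<rho> m) powr - e" by (rule sparse)
    also have "\<dots> \<le> d powr - e" using m e d False by (intro powr_mono2') auto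
    finally have "(\<Prod>j\<in>S. 1 + a j) \<le> d powr - e" .
    moreover have "(\<Prod>j\<in>S. ennreal (1 + a j)) = ennreal (\<Prod>j\<in>S. 1 + a j)"
      using a by (intro prod_ennreal) auto
    ultimately have "(\<Prod>j\<in>S. ennreal (1 + a j)) \<le> riesz_kernel e d"
      using False d by (simp add: riesz_kernel_eq ennreal_leI)
    moreover have "d \<le> 2 * \<rho> L" using m \<rho>(2) by (force simp: decseq_def intro: order_trans)
    ultimately show ?thesis unfolding eq by (simp add: add_increasing)
  qed
qed

section \<open>The lower bound for fixed exponents\<close>

context ahlfors_space
begin

text \<open>The energy order \<open>q\<close> is split as \<open>s + e\<close> with
  \<open>e > t - b\<close>. A block consists of the indices between two sparse times, more than half
  of those up to its end, and its balls are shrunk to its last and smallest radius. Its average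
  density then has correlations of order \<open>\<rho> j powr - (t - b)\<close>.\<close>

lemma dimension_lower_bound:
  fixes g :: "'c::{complete_space, second_countable_topology} \<Rightarrow> 'a"
  assumes S: "closed S" "continuous_on S g"
    and r: "\<And>n. 0 < r n" "decseq r" "r \<longlonglongrightarrow> 0"
    and b: "ereal b < limsup (\<lambda>n. ereal (ln (real n) / - ln (r n)))" "b < t"
    and s: "0 < s" "s + (t - b) < q" and q: "ereal q < hausdorff_dim (g ` S)"
  shows "AE x in \<Omega>. ereal s \<le> hausdorff_dim (covering_set r x \<inter> g ` S)"
proof -
  define e where "e = q - s"
  have e: "0 < e" "t - b < e" using s b by (auto simp: e_def)
  have se: "s + e = q" by (simp add: e_def)
  obtain K \<nu> B0 where K: "compact K" "K \<subseteq> g ` S" and \<nu>: "sets \<nu> = sets borel" "emeasure \<nu> (- K) = 0"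
    "emeasure \<nu> UNIV \<noteq> 0" "emeasure \<nu> UNIV \<noteq> \<infinity>"
    and B0: "\<And>y. (\<integral>\<^sup>+z. riesz_kernel q (dist y z) \<partial>\<nu>) \<le> ennreal B0"
    using frostman[OF S _ q] e s by (auto simp: e_def)
  define v where "v = measure \<nu> UNIV"
  have mass: "emeasure \<nu> UNIV = ennreal v"
    using \<nu>(4) by (simp add: v_def emeasure_eq_ennreal_measure)
  have v: "0 < v" using \<nu>(3) mass by (simp add: v_def zero_less_measure_iff)
  define B where "B = max 0 B0"
  have B: "(\<integral>\<^sup>+z. riesz_kernel (s + e) (dist y z) \<partial>\<nu>) \<le> ennreal B" for y
    unfolding se by (rule order_trans[OF B0]) (simp add: B_def ennreal_leI)
  have K0: "0 \<le> 2 * C" using C_pos by simp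
  obtain n where n: "\<And>j. 2 * n j < n (Suc j)"
    "\<And>j. r (n (Suc j)) powr - b \<le> real (n (Suc j))" "\<And>j. r (n (Suc j)) < diameter (UNIV :: 'a set)"
    "\<And>j. (\<Prod>i\<le>j. 1 + 2 * C * r (n (Suc i)) powr - (t - b)) \<le> (2 * r (n (Suc j))) powr - e"
    by (rule block_sequence[OF r(1,3) b(1) K0 e diam_pos]) blast
  define \<rho> where "\<rho> j = r (n (Suc j))" for j
  define J where "J j = {n j<..n (Suc j)}" for j
  have inc: "n j < n (Suc j)" for j using n(1)[of j] by linarith
  then have smono: "strict_mono n" by (rule strict_monoI_Suc)
  have n_ge: "j \<le> n j" for j using smono by (rule strict_mono_imp_increasing)
  have J_eq: "card (J j) = n (Suc j) - n j" for j by (simp add: J_def)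
  have disj: "disjoint_family J"
    unfolding disjoint_family_on_def
  proof (intro ballI impI)
    have 1: "J i \<inter> J j = {}" if "i < j" for i j
    proof -
      have "n (Suc i) \<le> n j" using that by (intro strict_mono_leD[OF smono]) simp
      then show ?thesis by (auto simp: J_def)
    qed
    fix i j :: nat assume "i \<noteq> j"
    then show "J i \<inter> J j = {}" using 1[of i j] 1[of j i] by (cases "i < j") auto
  qed
  have dec: "decseq \<rho>"
    unfolding \<rho>_def using r(2) smono by (auto simp: decseq_def strict_mono_less_eq)
  have \<rho>0: "\<rho> \<longlonglongrightarrow> 0"
  proof -
    have "strict_mono (\<lambda>j. n (Suc j))" using smono by (auto simp: strict_mono_def)
    from LIMSEQ_subseq_LIMSEQ[OF r(3) this] show ?thesis by (simp add: \<rho>_def[abs_def] o_def)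
  qed
  \<comment> \<open>The factor \<open>2\<close> comes from
    \<open>n (Suc j) \<le> 2 * card (J j)\<close>, which holds because the times more than
    double.\<close>
  have coef: "inverse (of_nat (card (J j))) * ennreal (C / \<rho> j powr t) \<le> ennreal (2 * C * \<rho> j powr - (t - b))" for j
  proof -
    have pos: "0 < real (card (J j))" using inc[of j] by (simp add: J_eq)
    have "\<rho> j powr - b \<le> real (n (Suc j))" using n(2) by (simp add: \<rho>_def)
    also have "\<dots> \<le> 2 * real (card (J j))" using n(1)[of j] unfolding J_eq by linarith
    finally have le: "1 / \<rho> j powr b \<le> 2 * real (card (J j))" by (simp only: powr_minus_divide)
    have "0 < \<rho> j powr b" using r(1)[of "n (Suc j)"] by (simp add: \<rho>_def)
    from le[unfolded pos_divide_le_eq[OF this]]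
    have "inverse (real (card (J j))) \<le> 2 * \<rho> j powr b"
      unfolding inverse_eq_divide pos_divide_le_eq[OF pos] by (simp only: mult_ac)
    then have "inverse (real (card (J j))) * (C / \<rho> j powr t) \<le> 2 * \<rho> j powr b * (C / \<rho> j powr t)"
      using C_pos by (intro mult_right_mono) auto
    also have "\<dots> = 2 * C * \<rho> j powr - (t - b)"
      using r(1) by (simp add: \<rho>_def powr_diff)
    finally have "ennreal (inverse (real (card (J j))) * (C / \<rho> j powr t)) \<le> ennreal (2 * C * \<rho> j powr - (t - b))"
      by (rule ennreal_leI)
    moreover have "inverse (of_nat (card (J j))) = ennreal (inverse (real (card (J j))))"
      using pos by (simp add: inverse_ennreal[symmetric] ennreal_of_nat_eq_real_of_nat)
    moreover have "ennreal (inverse (real (card (J j))) * (C / \<rho> j powr t))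
        = ennreal (inverse (real (card (J j)))) * ennreal (C / \<rho> j powr t)"
      using C_pos by (intro ennreal_mult) auto
    ultimately show ?thesis by (simp only:)
  qed
  have corr: "(\<Prod>j\<in>{L..<k}. 1 + inverse (of_nat (card (J j))) *
        (ennreal (C / \<rho> j powr t) * indicator {..2 * \<rho> j} d))
      \<le> 1 + indicator {..2 * \<rho> L} d * riesz_kernel e d" if "0 \<le> d" for d L k
  proof -
    have "(\<Prod>j\<in>{L..<k}. 1 + inverse (of_nat (card (J j))) *
        (ennreal (C / \<rho> j powr t) * indicator {..2 * \<rho> j} d))
      \<le> (\<Prod>j\<in>{L..<k}. 1 + ennreal (2 * C * \<rho> j powr - (t - b)) * indicator {..2 * \<rho> j} d)"
      unfolding mult.assoc[symmetric]
      by (intro prod_mono_ennreal add_left_mono mult_right_mono coef[unfolded mult.assoc[symmetric]]) auto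
    also have "\<dots> \<le> 1 + indicator {..2 * \<rho> L} d * riesz_kernel e d"
    proof (rule correlation_bound[OF _ dec])
      show "0 < \<rho> j" for j by (simp add: \<rho>_def r)
      show "0 \<le> 2 * C * \<rho> j powr - (t - b)" for j using C_pos by simp
      show "(\<Prod>i\<le>j. 1 + 2 * C * \<rho> i powr - (t - b)) \<le> (2 * \<rho> j) powr - e" for j
        unfolding \<rho>_def by (rule n(4))
    qed (use e that in auto)
    finally show ?thesis .
  qed
  interpret random_energy \<mu> t C J \<rho> \<nu> v B s e
  proof unfold_locales
    show "finite (J j)" for j by (simp add: J_def)
    show "J j \<noteq> {}" for j using inc[of j] by (auto simp: J_def)
    show "disjoint_family J" by (rule disj)
    show "0 < \<rho> j" for j by (simp add: \<rho>_def r)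
    show "\<rho> j < diameter (UNIV :: 'a set)" for j by (simp add: \<rho>_def n)
    show "sets \<nu> = sets borel" by (rule \<nu>)
    show "emeasure \<nu> UNIV = ennreal v" by (rule mass)
    show "0 < v" by (rule v)
    show "(\<integral>\<^sup>+z. riesz_kernel (s + e) (dist y z) \<partial>\<nu>) \<le> ennreal B" for y by (rule B)
    show "0 \<le> B" by (simp add: B_def)
    show "0 < s" by (rule s)
    show "0 \<le> e" using e by simp
    show "(\<Prod>j\<in>{L..<k}. 1 + inverse (of_nat (card (J j))) *
        (ennreal (C / \<rho> j powr t) * indicator {..2 * \<rho> j} d))
      \<le> 1 + indicator {..2 * \<rho> L} d * riesz_kernel e d" if "0 \<le> d" for d L k
      using that by (rule corr)
    show "\<rho> \<longlonglongrightarrow> 0" by (rule \<rho>0)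
  qed
  from AE_mass_and_energy show ?thesis
  proof (rule AE_mp, intro AE_I2 impI)
    fix x assume x: "x \<in> space \<Omega>" and "\<exists>L (R :: nat). \<exists>\<^sub>F k in sequentially. ennreal (v / 2) \<le> mass_at L k x \<and> energy_at L k x \<le> of_nat R"
    then obtain L R where LR: "\<exists>\<^sub>F k in sequentially. ennreal (v / 2) \<le> mass_at L k x \<and> energy_at L k x \<le> of_nat R"
      by blast
    define V where "V j = (\<Union>i\<in>J j. cball (x i) (\<rho> j))" for j
    show "ereal s \<le> hausdorff_dim (covering_set r x \<inter> g ` S)"
    proof (rule hausdorff_dim_ge_of_energy[where K=K and V=V and L=L and f="\<lambda>k. prod_density L k x"])
      show "compact K" by (rule K)
      show "closed (V j)" for j unfolding V_def by (intro closed_UN) (auto simp: J_def)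
      show "K \<inter> (\<Inter>j\<in>{L..}. V j) \<subseteq> covering_set r x \<inter> g ` S"
      proof
        fix y assume y: "y \<in> K \<inter> (\<Inter>j\<in>{L..}. V j)"
        \<comment> \<open>Every block from \<open>L\<close> on contributes an index, and late blocks
          contain only large indices; the original balls contain the shrunk ones.\<close>
        have "\<exists>i\<ge>k. y \<in> cball (x i) (r i)" for k
        proof -
          have "y \<in> V (max L k)" using y by auto
          then obtain i where i: "i \<in> J (max L k)" "y \<in> cball (x i) (\<rho> (max L k))"
            by (auto simp: V_def)
          have "k \<le> n (max L k)" using n_ge[of "max L k"] by simp
          then have "k \<le> i" using i(1) by (auto simp: J_def)
          moreover have "\<rho> (max L k) \<le> r i" using i(1) r(2) by (auto simp: J_def \<rho>_def decseq_def)
          ultimately show ?thesis using i(2) by (intro exI[of _ i]) auto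
        qed
        then have "y \<in> covering_set r x" by (fastforce simp: covering_set_def)
        then show "y \<in> covering_set r x \<inter> g ` S" using y K(2) by auto
      qed
      show "sets \<nu> = sets borel" by (rule \<nu>)
      show "emeasure \<nu> (- K) = 0" by (rule \<nu>)
      show "prod_density L k x \<in> borel_measurable borel" for k
        using prod_density_measurable[of "\<lambda>_. x" borel "\<lambda>y. y" L k] x by simp
      show "prod_density L k x y = 0" if "L \<le> j" "j < k" "y \<notin> V j" for k j y
      proof -
        have "block_density (J j) (\<rho> j) x y = 0"
          using that(3) by (auto simp: block_density_def ball_density_def V_def indicator_def)
        then show ?thesis using that(1,2) unfolding prod_density_def by (intro prod_zero) auto
      qed
      show "0 < v" by (rule v)
      show "0 < s" by (rule s)
      show "\<exists>\<^sub>F k in sequentially. ennreal (v / 2) \<le> (\<integral>\<^sup>+y. prod_density L k x y \<partial>\<nu>) \<and>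
        (\<integral>\<^sup>+y. \<integral>\<^sup>+z. riesz_kernel s (dist y z) * (prod_density L k x y * prod_density L k x z) \<partial>\<nu> \<partial>\<nu>) \<le> of_nat R"
        using LR by (simp add: mass_at_def energy_at_def)
    qed
  qed
qed

end


section \<open>Dimension from above\<close>

lemma finite_ball_cover:
  fixes A :: "'a::metric_space set"
  assumes S: "finite S" "A \<subseteq> (\<Union>x\<in>S. cball x e)" and e: "0 < e" "2 * e \<le> \<delta>" and u: "0 < u"
  shows "\<exists>U :: nat \<Rightarrow> 'a set. A \<subseteq> (\<Union>i. U i) \<and> (\<forall>i. bounded (U i) \<and> diameter (U i) \<le> \<delta>) \<and>
    (\<Sum>i. diam_powr u (U i)) \<le> ennreal (real (card S) * (2 * e) powr u)"
proof -
  obtain h where h: "bij_betw h {0..<card S} S" using ex_bij_betw_nat_finite[OF S(1)] by blast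
  define U where "U i = (if i < card S then cball (h i) e else {})" for i
  have "A \<subseteq> (\<Union>i. U i)"
  proof
    fix x assume "x \<in> A"
    then obtain y where y: "y \<in> S" "x \<in> cball y e" using S(2) by blast
    then have "y \<in> h ` {0..<card S}" using bij_betw_imp_surj_on[OF h] by simp
    then obtain i where "i < card S" "h i = y" by auto
    then have "x \<in> U i" using y by (simp add: U_def)
    then show "x \<in> (\<Union>i. U i)" by blast
  qed
  moreover have "bounded (U i) \<and> diameter (U i) \<le> \<delta>" for i
  proof
    show "bounded (U i)" by (simp add: U_def)
    show "diameter (U i) \<le> \<delta>"
    proof (rule diameter_le_dist)
      fix x y assume "x \<in> U i" "y \<in> U i"
      then have "dist (h i) x \<le> e" "dist (h i) y \<le> e" by (auto simp: U_def split: if_splits)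
      then show "dist x y \<le> \<delta>" using dist_triangle3[of x y "h i"] e(2) by simp
    qed (use e in simp)
  qed
  moreover have "(\<Sum>i. diam_powr u (U i)) \<le> ennreal (real (card S) * (2 * e) powr u)"
  proof -
    have "(\<Sum>i. diam_powr u (U i)) = (\<Sum>i<card S. diam_powr u (U i))"
      by (rule suminf_finite) (auto simp: U_def diam_powr_def)
    also have "\<dots> \<le> (\<Sum>i<card S. ennreal ((2 * e) powr u))"
    proof (rule sum_mono)
      fix i
      have "U i \<subseteq> cball (h i) e" by (simp add: U_def)
      then show "diam_powr u (U i) \<le> ennreal ((2 * e) powr u)" using u e(1) by (rule diam_powr_le)
    qed
    also have "\<dots> = ennreal (real (card S) * (2 * e) powr u)"
      by (simp add: ennreal_mult ennreal_of_nat_eq_real_of_nat)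
    finally show ?thesis .
  qed
  ultimately show ?thesis by blast
qed

text \<open>The premeasure bounds the size of a maximal packing by balls of one common radius, and
  the balls of twice the radius cover. So covering numbers are controlled at every small scale, not
  only along some sequence of scales.\<close>

lemma packing_premeasure_finite_cover:
  fixes A :: "'a::metric_space set"
  assumes fin: "packing_premeasure s A < \<top>"
  obtains \<delta> c :: real where "0 < \<delta>" "0 \<le> c" "\<And>\<rho>. 0 < \<rho> \<Longrightarrow> \<rho> \<le> \<delta> \<Longrightarrow>
    \<exists>S. finite S \<and> S \<subseteq> A \<and> real (card S) * (2 * \<rho>) powr s \<le> c \<and> A \<subseteq> (\<Union>x\<in>S. cball x (2 * \<rho>))"
proof -
  obtain \<delta> where \<delta>: "0 < \<delta>" "(SUP \<C>\<in>packings \<delta> A. \<Sum>\<^sub>\<infinity>(x, \<rho>)\<in>\<C>. ennreal ((2 * \<rho>) powr s)) < \<top>"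
    using fin unfolding packing_premeasure_def INF_less_iff by auto
  define c where "c = enn2real (SUP \<C>\<in>packings \<delta> A. \<Sum>\<^sub>\<infinity>(x, \<rho>)\<in>\<C>. ennreal ((2 * \<rho>) powr s))"
  have c_eq: "ennreal c = (SUP \<C>\<in>packings \<delta> A. \<Sum>\<^sub>\<infinity>(x, \<rho>)\<in>\<C>. ennreal ((2 * \<rho>) powr s))"
    unfolding c_def using \<delta>(2) by simp
  have c0: "0 \<le> c" by (simp add: c_def)
  show thesis
  proof (rule that[OF \<delta>(1) c0])
    fix \<rho> :: real assume \<rho>: "0 < \<rho>" "\<rho> \<le> \<delta>"
    let ?Q = "\<lambda>S. S \<subseteq> A \<and> pairwise (\<lambda>x y. cball x \<rho> \<inter> cball y \<rho> = {}) S"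
    have bound: "real (card S) * (2 * \<rho>) powr s \<le> c" if S: "finite S" "?Q S" for S
    proof -
      let ?C = "(\<lambda>x. (x, \<rho>)) ` S"
      have "?C \<in> packings \<delta> A"
        using S \<rho> by (auto simp: packings_def pairwise_def countable_finite)
      then have "(\<Sum>\<^sub>\<infinity>(x, \<rho>)\<in>?C. ennreal ((2 * \<rho>) powr s)) \<le> ennreal c"
        unfolding c_eq by (rule SUP_upper)
      also have "(\<Sum>\<^sub>\<infinity>(x, \<rho>)\<in>?C. ennreal ((2 * \<rho>) powr s)) = (\<Sum>p\<in>?C. case p of (x, \<rho>) \<Rightarrow> ennreal ((2 * \<rho>) powr s))"
        using S(1) by (intro infsum_finite) auto
      also have "\<dots> = ennreal (real (card S) * (2 * \<rho>) powr s)"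
        by (subst sum.reindex) (auto simp: inj_on_def ennreal_mult ennreal_of_nat_eq_real_of_nat)
      finally show ?thesis using c0 by (simp add: ennreal_le_iff)
    qed
    have "card S \<le> nat \<lceil>c / (2 * \<rho>) powr s\<rceil>" if "finite S" "?Q S" for S
    proof -
      have "0 < (2 * \<rho>) powr s" using \<rho> by simp
      then have "real (card S) \<le> c / (2 * \<rho>) powr s" using bound[OF that] by (simp add: pos_le_divide_eq)
      then show ?thesis by linarith
    qed
    then obtain S where S: "finite S" "?Q S" "\<And>x. x \<notin> S \<Longrightarrow> \<not> ?Q (insert x S)"
      by (rule finite_maximal_set[of ?Q "nat \<lceil>c / (2 * \<rho>) powr s\<rceil>", rotated]) auto
    have "A \<subseteq> (\<Union>x\<in>S. cball x (2 * \<rho>))"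
    proof
      fix a assume a: "a \<in> A"
      show "a \<in> (\<Union>x\<in>S. cball x (2 * \<rho>))"
      proof (cases "a \<in> S")
        case True
        then show ?thesis using \<rho>(1) by (intro UN_I[of a]) auto
      next
        case False
        then have "\<exists>b\<in>S. cball a \<rho> \<inter> cball b \<rho> \<noteq> {} \<or> cball b \<rho> \<inter> cball a \<rho> \<noteq> {}"
          using S(2) S(3)[OF False] a unfolding pairwise_insert by blast
        then obtain b z where b: "b \<in> S" "dist a z \<le> \<rho>" "dist b z \<le> \<rho>" by auto
        then have "dist b a \<le> 2 * \<rho>" using dist_triangle2[of b a z] by simp
        then show ?thesis using b(1) by auto
      qed
    qed
    then show "\<exists>S. finite S \<and> S \<subseteq> A \<and> real (card S) * (2 * \<rho>) powr s \<le> c \<and> A \<subseteq> (\<Union>x\<in>S. cball x (2 * \<rho>))"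
      using S bound by blast
  qed
qed

text \<open>Covers by equal balls of radius \<open>2 * \<rho>\<close> have \<open>u\<close>-sums of
  order \<open>\<rho> powr (u - s)\<close>.\<close>

lemma hausdorff_measure_0_of_packing_premeasure:
  fixes A :: "'a::metric_space set"
  assumes fin: "packing_premeasure s A < \<top>" and s: "0 \<le> s" "s < u"
  shows "hausdorff_measure u A = 0"
  unfolding hausdorff_measure_eq_0_iff
proof (intro allI impI)
  fix \<delta> :: real and \<epsilon> :: ennreal assume \<delta>: "0 < \<delta>" and \<epsilon>: "0 < \<epsilon>"
  obtain \<delta>0 c where c: "0 < \<delta>0" "0 \<le> c" "\<And>\<rho>. 0 < \<rho> \<Longrightarrow> \<rho> \<le> \<delta>0 \<Longrightarrow>
    \<exists>S. finite S \<and> S \<subseteq> A \<and> real (card S) * (2 * \<rho>) powr s \<le> c \<and> A \<subseteq> (\<Union>x\<in>S. cball x (2 * \<rho>))"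
    by (rule packing_premeasure_finite_cover[OF fin]) blast
  obtain e :: real where e: "0 < e" "ennreal e < \<epsilon>"
  proof (cases \<epsilon>)
    case (real x)
    then show ?thesis using \<epsilon> by (intro that[of "x / 2"]) (auto simp: ennreal_less_iff)
  next
    case top
    then show ?thesis by (intro that[of 1]) auto
  qed
  have "((\<lambda>x. c * 2 powr u * (2 * x) powr (u - s)) \<longlongrightarrow> c * 2 powr u * 0) (at_right 0)"
  proof (intro tendsto_intros tendsto_zero_powrI[where b="u - s"])
    have "((\<lambda>x. 2 * x) \<longlongrightarrow> 2 * (0::real)) (at_right 0)" by (intro tendsto_intros)
    then show "((\<lambda>x. 2 * x) \<longlongrightarrow> (0::real)) (at_right 0)" by simp
    show "\<forall>\<^sub>F x in at_right (0::real). 0 \<le> 2 * x"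
      using eventually_at_right_less[of "0::real"] by eventually_elim simp
  qed (use s in auto)
  then have "\<forall>\<^sub>F x in at_right 0. c * 2 powr u * (2 * x) powr (u - s) < e"
    using e(1) by (intro order_tendstoD) auto
  moreover have "\<forall>\<^sub>F x in at_right 0. x < min \<delta>0 (\<delta> / 4)"
  proof -
    have "0 < min \<delta>0 (\<delta> / 4)" using c(1) \<delta> by simp
    from eventually_at_right_real[OF this] show ?thesis by eventually_elim simp
  qed
  moreover have "\<forall>\<^sub>F x in at_right (0::real). 0 < x" by (rule eventually_at_right_less)
  ultimately have "\<forall>\<^sub>F x in at_right 0. c * 2 powr u * (2 * x) powr (u - s) < e \<and> x < min \<delta>0 (\<delta> / 4) \<and> 0 < x"
    by (intro eventually_conj)
  then obtain \<rho> where \<rho>: "c * 2 powr u * (2 * \<rho>) powr (u - s) < e" "\<rho> < min \<delta>0 (\<delta> / 4)" "0 < \<rho>"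
    using eventually_happens'[OF trivial_limit_at_right_real] by blast
  then obtain S where S: "finite S" "S \<subseteq> A" "real (card S) * (2 * \<rho>) powr s \<le> c" "A \<subseteq> (\<Union>x\<in>S. cball x (2 * \<rho>))"
    using c(3)[of \<rho>] by auto
  have "real (card S) * (2 * (2 * \<rho>)) powr u = (real (card S) * (2 * \<rho>) powr s) * (2 powr u * (2 * \<rho>) powr (u - s))"
  proof -
    have "(2 * (2 * \<rho>)) powr u = 2 powr u * (2 * \<rho>) powr u" using \<rho>(3) by (intro powr_mult)
    moreover have "(2 * \<rho>) powr u = (2 * \<rho>) powr s * (2 * \<rho>) powr (u - s)"
      by (simp add: powr_add[symmetric])
    ultimately show ?thesis by (simp only: mult_ac)
  qed
  also have "\<dots> \<le> c * (2 powr u * (2 * \<rho>) powr (u - s))" using S(3) by (rule mult_right_mono) simp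
  also have "\<dots> < e" using \<rho>(1) by (simp add: mult.assoc)
  finally have "ennreal (real (card S) * (2 * (2 * \<rho>)) powr u) < \<epsilon>"
    using e(2) by (meson ennreal_leI le_less_trans less_imp_le)
  moreover obtain U where "A \<subseteq> (\<Union>i. U i)" "\<forall>i. bounded (U i) \<and> diameter (U i) \<le> \<delta>"
      "(\<Sum>i. diam_powr u (U i)) \<le> ennreal (real (card S) * (2 * (2 * \<rho>)) powr u)"
    using finite_ball_cover[OF S(1,4), of \<delta> u] \<rho> s by auto
  ultimately show "\<exists>U :: nat \<Rightarrow> 'a set. A \<subseteq> (\<Union>i. U i) \<and> (\<forall>i. bounded (U i) \<and> diameter (U i) \<le> \<delta>) \<and>
      (\<Sum>i. diam_powr u (U i)) < \<epsilon>" by (meson le_less_trans)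
qed

lemma packing_dim_cover:
  assumes "packing_dim F < ereal s'"
  shows "\<exists>s (B :: nat \<Rightarrow> 'a::metric_space set). 0 \<le> s \<and> s < s' \<and> F \<subseteq> (\<Union>i. B i) \<and>
    (\<forall>i. packing_premeasure s (B i) < \<top>)"
proof -
  obtain s where s: "0 \<le> s" "s < s'" "packing_measure s F = 0"
    using assms unfolding packing_dim_def Inf_less_iff by auto
  then have "packing_measure s F < 1" by simp
  then obtain B :: "nat \<Rightarrow> 'a set" where B: "F \<subseteq> (\<Union>i. B i)" "(\<Sum>i. packing_premeasure s (B i)) < 1"
    unfolding packing_measure_def INF_less_iff by blast
  have "packing_premeasure s (B i) < \<top>" for i
    using le_less_trans[OF le_suminf_ennreal[of "\<lambda>i. packing_premeasure s (B i)" i] B(2)] 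
    by (rule less_trans) simp
  with s B(1) show ?thesis by (intro exI[of _ s] exI[of _ B] conjI allI)
qed

text \<open>Eventually \<open>n < r n powr - b\<close>, so the terms are dominated by
  \<open>real n powr - (\<theta> / b)\<close> with \<open>\<theta> / b > 1\<close>.\<close>

lemma summable_radius_powr:
  fixes r :: "nat \<Rightarrow> real"
  assumes r: "\<And>n. 0 < r n" "r \<longlonglongrightarrow> 0"
    and b: "limsup (\<lambda>n. ereal (ln (real n) / - ln (r n))) < ereal b" "0 < b" "b < \<theta>"
  shows "summable (\<lambda>n. r n powr \<theta>)"
proof (rule summable_comparison_test_ev)
  show "summable (\<lambda>n. real n powr - (\<theta> / b))"
    using b by (simp add: summable_real_powr_iff)
  have "\<forall>\<^sub>F n in sequentially. ereal (ln (real n) / - ln (r n)) < ereal b"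
    using b(1) by (rule Limsup_lessD)
  moreover have "\<forall>\<^sub>F n in sequentially. r n < 1" using order_tendstoD(2)[OF r(2), of 1] by simp
  moreover have "\<forall>\<^sub>F n in sequentially. 0 < n" by (rule eventually_gt_at_top)
  ultimately show "\<forall>\<^sub>F n in sequentially. norm (r n powr \<theta>) \<le> real n powr - (\<theta> / b)"
  proof eventually_elim
    case (elim n)
    have pos: "0 < - ln (r n)" using elim r(1)[of n] by (simp add: ln_less_zero)
    have "ln (real n) < b * - ln (r n)"
      using elim(1) by (simp only: less_ereal.simps pos_divide_less_eq[OF pos])
    then have "\<theta> / b * ln (real n) \<le> \<theta> / b * (b * - ln (r n))"
      using b by (intro mult_left_mono) auto
    also have "\<dots> = - (\<theta> * ln (r n))" using b by simp
    finally have "exp (\<theta> * ln (r n)) \<le> exp (- (\<theta> / b) * ln (real n))" by simp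
    then show ?case using r(1)[of n] elim(3) by (simp add: powr_def)
  qed
qed

section \<open>Random covers of sets with finite packing premeasure\<close>

context ahlfors_space
begin

text \<open>A ball that meets \<open>A\<close> has its centre in a neighbourhood of measure of order
  \<open>r n powr (t - s)\<close>, so the expected cover sum converges by
  \<open>t - s + u > b\<close>. Where the sum is finite its tails tend to \<open>0\<close>, and they
  belong to covers by arbitrarily small balls.\<close>

lemma AE_covering_null:
  assumes fin: "packing_premeasure s A < \<top>"
    and r: "\<And>n. 0 < r n" "r \<longlonglongrightarrow> 0"
    and b: "limsup (\<lambda>n. ereal (ln (real n) / - ln (r n))) < ereal b" "0 < b" "b + s < t + u"
    and u: "0 < u"
  shows "AE x in \<Omega>. hausdorff_measure u (covering_set r x \<inter> A) = 0"
proof -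
  obtain \<delta>0 c where c: "0 < \<delta>0" "0 \<le> c" "\<And>\<rho>. 0 < \<rho> \<Longrightarrow> \<rho> \<le> \<delta>0 \<Longrightarrow>
    \<exists>S. finite S \<and> S \<subseteq> A \<and> real (card S) * (2 * \<rho>) powr s \<le> c \<and> A \<subseteq> (\<Union>x\<in>S. cball x (2 * \<rho>))"
    by (rule packing_premeasure_finite_cover[OF fin]) blast
  have "\<forall>n. \<exists>S. r n \<le> \<delta>0 \<longrightarrow> finite S \<and> S \<subseteq> A \<and> real (card S) * (2 * r n) powr s \<le> c \<and> A \<subseteq> (\<Union>x\<in>S. cball x (2 * r n))"
  proof
    fix n
    show "\<exists>S. r n \<le> \<delta>0 \<longrightarrow> finite S \<and> S \<subseteq> A \<and> real (card S) * (2 * r n) powr s \<le> c \<and> A \<subseteq> (\<Union>x\<in>S. cball x (2 * r n))"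
      using c(3)[OF r(1)[of n]] by (cases "r n \<le> \<delta>0") simp_all
  qed
  from choice[OF this] obtain S where S: "\<And>n. r n \<le> \<delta>0 \<Longrightarrow> finite (S n)"
      "\<And>n. r n \<le> \<delta>0 \<Longrightarrow> real (card (S n)) * (2 * r n) powr s \<le> c"
      "\<And>n. r n \<le> \<delta>0 \<Longrightarrow> A \<subseteq> (\<Union>x\<in>S n. cball x (2 * r n))" by blast
  \<comment> \<open>\<open>3\<close> is \<open>2\<close> for the cover of \<open>A\<close> plus
    \<open>1\<close> for the ball meeting \<open>A\<close>. The finitely many indices with
    \<open>r n > \<delta>0\<close> have no controlled cover and are left out of the tails
    below.\<close>
  define W where "W n = (if r n \<le> \<delta>0 then \<Union>x\<in>S n. cball x (3 * r n) else {})" for n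
  have [measurable]: "W n \<in> sets borel" for n
    using S(1) by (auto simp: W_def intro!: borel_closed closed_UN)
  have near: "y \<in> W n" if a: "a \<in> A" and d: "dist y a \<le> r n" and rn: "r n \<le> \<delta>0" for y a n
  proof -
    obtain x where x: "x \<in> S n" "dist x a \<le> 2 * r n" using S(3)[OF rn] a by auto
    have "dist x y \<le> 3 * r n" using x(2) d dist_triangle2[of x y a] by simp
    with x(1) rn show ?thesis by (auto simp: W_def)
  qed
  \<comment> \<open>Collects the count \<open>c * (2 * r n) powr - s\<close> and the ball mass
    \<open>C * (3 * r n) powr t\<close>.\<close>
  define K where "K = c * 2 powr - s * C * 3 powr t"
  have K: "0 \<le> K" using c C_pos by (simp add: K_def)
  have W_le: "measure \<mu> (W n) \<le> K * r n powr (t - s)" for n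
  proof (cases "r n \<le> \<delta>0")
    case True
    have "measure \<mu> (W n) \<le> (\<Sum>x\<in>S n. measure \<mu> (cball x (3 * r n)))"
      using True S(1) by (auto simp: W_def intro!: measure_UNION_le)
    also have "\<dots> \<le> (\<Sum>x\<in>S n. C * (3 * r n) powr t)"
      using r(1) by (intro sum_mono ball_upper) simp
    also have "\<dots> = real (card (S n)) * (C * (3 * r n) powr t)" by simp
    also have "\<dots> \<le> c * (2 * r n) powr - s * (C * (3 * r n) powr t)"
    proof (rule mult_right_mono)
      have "0 < (2 * r n) powr s" using r(1)[of n] by simp
      then have "real (card (S n)) \<le> c / (2 * r n) powr s"
        using S(2)[OF True] by (simp add: pos_le_divide_eq)
      then show "real (card (S n)) \<le> c * (2 * r n) powr - s" by (simp add: powr_minus divide_inverse)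
    qed (use C_pos in auto)
    also have "\<dots> = K * r n powr (t - s)"
    proof -
      have "(2 * r n) powr - s = 2 powr - s * r n powr - s" "(3 * r n) powr t = 3 powr t * r n powr t"
        using r(1)[of n] by (auto intro!: powr_mult)
      moreover have "r n powr (t - s) = r n powr t * r n powr - s" by (simp add: powr_add[symmetric])
      ultimately show ?thesis by (simp only: K_def mult_ac)
    qed
    finally show ?thesis .
  qed (simp add: W_def K)
  have summ: "summable (\<lambda>n. K * 2 powr u * r n powr (t - s + u))"
    using b by (intro summable_mult summable_radius_powr[OF r b(1,2)]) auto
  define f where "f x n = indicator (W n) (x n) * (2 * r n) powr u" for x :: "nat \<Rightarrow> 'a" and n
  have [measurable]: "(\<lambda>x. ennreal (f x n)) \<in> borel_measurable \<Omega>" for n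
    unfolding f_def by measurable
  have "(\<integral>\<^sup>+x. (\<Sum>n. ennreal (f x n)) \<partial>\<Omega>) = (\<Sum>n. \<integral>\<^sup>+x. ennreal (f x n) \<partial>\<Omega>)"
    by (rule nn_integral_suminf) measurable
  also have "\<dots> \<le> (\<Sum>n. ennreal (K * 2 powr u * r n powr (t - s + u)))"
  proof (intro suminf_le)
    fix n
    have "(\<integral>\<^sup>+x. ennreal (f x n) \<partial>\<Omega>) = (\<integral>\<^sup>+x. ennreal ((2 * r n) powr u) * indicator (W n) x \<partial>\<mu>)"
      unfolding f_def
      by (subst nn_integral_component[symmetric]) (auto intro!: nn_integral_cong simp: indicator_def)
    also have "\<dots> = ennreal ((2 * r n) powr u) * emeasure \<mu> (W n)"
      by (rule nn_integral_cmult_indicator) (simp add: sets_eq)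
    also have "\<dots> = ennreal ((2 * r n) powr u * measure \<mu> (W n))"
      by (simp add: emeasure_eq_measure ennreal_mult)
    also have "\<dots> \<le> ennreal (K * 2 powr u * r n powr (t - s + u))"
    proof (rule ennreal_leI)
      have "(2 * r n) powr u * measure \<mu> (W n) \<le> (2 * r n) powr u * (K * r n powr (t - s))"
        by (intro mult_left_mono W_le) auto
      also have "\<dots> = (2 powr u * r n powr u) * (K * r n powr (t - s))"
        using r(1)[of n] by (subst powr_mult) auto
      also have "\<dots> = K * 2 powr u * r n powr (t - s + u)"
        by (simp add: powr_add mult_ac)
      finally show "(2 * r n) powr u * measure \<mu> (W n) \<le> K * 2 powr u * r n powr (t - s + u)" .
    qed
    finally show "(\<integral>\<^sup>+x. ennreal (f x n) \<partial>\<Omega>) \<le> ennreal (K * 2 powr u * r n powr (t - s + u))" .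
  qed auto
  also have "\<dots> < \<top>"
  proof -
    have "0 \<le> K * 2 powr u * r n powr (t - s + u)" for n using K by simp
    from suminf_ennreal2[OF this summ] show ?thesis by (simp only: ennreal_less_top)
  qed
  finally have lt: "(\<integral>\<^sup>+x. (\<Sum>n. ennreal (f x n)) \<partial>\<Omega>) < \<top>" .
  have "AE x in \<Omega>. (\<Sum>n. ennreal (f x n)) \<noteq> \<infinity>"
  proof (rule nn_integral_PInf_AE)
    show "(\<lambda>x. \<Sum>n. ennreal (f x n)) \<in> borel_measurable \<Omega>" by measurable
    show "(\<integral>\<^sup>+x. (\<Sum>n. ennreal (f x n)) \<partial>\<Omega>) \<noteq> \<infinity>" using lt by (simp only: infinity_ennreal_def less_top)
  qed
  then show ?thesis
  proof (rule AE_mp, intro AE_I2 impI)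
    fix x assume fin: "(\<Sum>n. ennreal (f x n)) \<noteq> \<infinity>"
    have f0: "0 \<le> f x n" for n by (simp add: f_def)
    have sf: "summable (f x)" using fin f0 by (intro summable_suminf_not_top) auto
    show "hausdorff_measure u (covering_set r x \<inter> A) = 0"
      unfolding hausdorff_measure_eq_0_iff
    proof (intro allI impI)
      fix \<delta> :: real and \<epsilon> :: ennreal assume \<delta>: "0 < \<delta>" and \<epsilon>: "0 < \<epsilon>"
      obtain e :: real where e: "0 < e" "ennreal e \<le> \<epsilon>"
      proof (cases \<epsilon>)
        case (real y)
        then show ?thesis using \<epsilon> by (intro that[of y]) (auto simp: ennreal_less_iff)
      next
        case top
        then show ?thesis by (intro that[of 1]) auto
      qed
      obtain n1 where n1: "\<And>n. n1 \<le> n \<Longrightarrow> norm (\<Sum>i. f x (i + n)) < e"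
        using suminf_exist_split[OF e(1) sf] by blast
      have "\<forall>\<^sub>F n in sequentially. r n < min \<delta>0 (\<delta> / 2)"
        using c(1) \<delta> by (intro order_tendstoD(2)[OF r(2)]) auto
      then obtain n2 where n2: "\<And>n. n2 \<le> n \<Longrightarrow> r n < min \<delta>0 (\<delta> / 2)"
        by (auto simp: eventually_sequentially)
      \<comment> \<open>\<open>Suc\<close> because the intersection in \<open>covering_set\<close>
        starts at \<open>1\<close>.\<close>
      define k where "k = Suc (max n1 n2)"
      define U where "U i = (if x (i + k) \<in> W (i + k) then cball (x (i + k)) (r (i + k)) else {})" for i
      have rk: "r (i + k) < \<delta>0" "2 * r (i + k) \<le> \<delta>" for i
      proof -
        have "n2 \<le> i + k" by (simp add: k_def)
        from n2[OF this] show "r (i + k) < \<delta>0" "2 * r (i + k) \<le> \<delta>" by auto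
      qed
      have "covering_set r x \<inter> A \<subseteq> (\<Union>i. U i)"
      proof
        fix y assume y: "y \<in> covering_set r x \<inter> A"
        have "k \<in> {1..}" by (simp add: k_def)
        then obtain n where n: "k \<le> n" "y \<in> cball (x n) (r n)"
          using y unfolding covering_set_def by blast
        then obtain i where i: "n = i + k" using le_Suc_ex by (metis add.commute)
        have "x n \<in> W n" using near[of y "x n" n] y n(2) rk(1)[of i] i by simp
        then have "y \<in> U i" using n(2) i by (simp add: U_def)
        then show "y \<in> (\<Union>i. U i)" by blast
      qed
      moreover have "bounded (U i) \<and> diameter (U i) \<le> \<delta>" for i
      proof
        show "bounded (U i)" by (simp add: U_def)
        show "diameter (U i) \<le> \<delta>"
        proof (rule diameter_le_dist)
          fix y z assume "y \<in> U i" "z \<in> U i"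
          then have "dist (x (i + k)) y \<le> r (i + k)" "dist (x (i + k)) z \<le> r (i + k)"
            by (auto simp: U_def split: if_splits)
          then show "dist y z \<le> \<delta>" using dist_triangle3[of y z "x (i + k)"] rk(2)[of i] by simp
        qed (use \<delta> in simp)
      qed
      moreover have "(\<Sum>i. diam_powr u (U i)) < \<epsilon>"
      proof -
        have "(\<Sum>i. diam_powr u (U i)) \<le> (\<Sum>i. ennreal (f x (i + k)))"
        proof (intro suminf_le)
          fix i
          show "diam_powr u (U i) \<le> ennreal (f x (i + k))"
          proof (cases "x (i + k) \<in> W (i + k)")
            case True
            have "diam_powr u (U i) \<le> ennreal ((2 * r (i + k)) powr u)"
              using u r(1) by (intro diam_powr_le[of _ "x (i + k)"]) (auto simp: U_def)
            then show ?thesis using True by (simp add: f_def)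
          qed (simp add: U_def diam_powr_def)
        qed auto
        also have "\<dots> = ennreal (\<Sum>i. f x (i + k))"
          using f0 sf by (intro suminf_ennreal2) (auto simp: summable_iff_shift)
        also have "\<dots> < ennreal e"
        proof (rule ennreal_lessI[OF e(1)])
          have "n1 \<le> k" by (simp add: k_def)
          from n1[OF this] show "(\<Sum>i. f x (i + k)) < e" unfolding real_norm_def by linarith
        qed
        finally show ?thesis using e(2) by simp
      qed
      ultimately show "\<exists>U :: nat \<Rightarrow> 'a set. covering_set r x \<inter> A \<subseteq> (\<Union>i. U i) \<and>
          (\<forall>i. bounded (U i) \<and> diameter (U i) \<le> \<delta>) \<and> (\<Sum>i. diam_powr u (U i)) < \<epsilon>"
        by blast
    qed
  qed
qed

lemma dimension_upper_bound:
  assumes r: "\<And>n. 0 < r n" "r \<longlonglongrightarrow> 0"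
    and b: "limsup (\<lambda>n. ereal (ln (real n) / - ln (r n))) < ereal b" "0 < b" "b + s' \<le> t + u"
    and s': "packing_dim F < ereal s'" and u: "0 < u"
  shows "AE x in \<Omega>. hausdorff_dim (covering_set r x \<inter> F) \<le> ereal u"
proof -
  obtain s and B :: "nat \<Rightarrow> 'a set" where s: "0 \<le> s" "s < s'" "F \<subseteq> (\<Union>i. B i)"
    "\<forall>i. packing_premeasure s (B i) < \<top>"
    using packing_dim_cover[OF s'] by blast
  have "AE x in \<Omega>. \<forall>i. hausdorff_measure u (covering_set r x \<inter> B i) = 0"
    unfolding AE_all_countable
    using b s u by (intro allI AE_covering_null[OF spec[OF s(4)] r b(1,2)]) auto
  then show ?thesis
  proof (rule AE_mp, intro AE_I2 impI)
    fix x assume "\<forall>i. hausdorff_measure u (covering_set r x \<inter> B i) = 0"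
    then have "hausdorff_measure u (\<Union>i. covering_set r x \<inter> B i) = 0"
      by (intro hausdorff_measure_UN_eq_0) auto
    moreover have "covering_set r x \<inter> F \<subseteq> (\<Union>i. covering_set r x \<inter> B i)" using s(3) by blast
    ultimately have "hausdorff_measure u (covering_set r x \<inter> F) = 0"
      by (rule hausdorff_measure_mono[rotated])
    then show "hausdorff_dim (covering_set r x \<inter> F) \<le> ereal u"
      using u by (intro hausdorff_dim_le) auto
  qed
qed

end

text \<open>This is the upper bound in the case \<open>\<alpha> = t\<close>, where it holds for
  every sequence of centres.\<close>

lemma hausdorff_dim_le_packing_dim:
  fixes A F :: "'a::metric_space set"
  assumes "A \<subseteq> F"
  shows "hausdorff_dim A \<le> packing_dim F"
proof (rule ccontr)
  assume "\<not> ?thesis"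
  then have "packing_dim F < hausdorff_dim A" by simp
  from ereal_dense2[OF this] obtain u where u: "packing_dim F < ereal u" "ereal u < hausdorff_dim A"
    by blast
  obtain s and B :: "nat \<Rightarrow> 'a set" where s: "0 \<le> s" "s < u" "F \<subseteq> (\<Union>i. B i)"
    "\<forall>i. packing_premeasure s (B i) < \<top>"
    using packing_dim_cover[OF u(1)] by blast
  have "hausdorff_measure u (\<Union>i. B i) = 0"
    using s by (intro hausdorff_measure_UN_eq_0 hausdorff_measure_0_of_packing_premeasure) auto
  then have "hausdorff_measure u A = 0"
    using assms s(3) by (intro hausdorff_measure_mono[of A "\<Union>i. B i"]) auto
  then have "hausdorff_dim A \<le> ereal u" using s by (intro hausdorff_dim_le) auto
  with u(2) show False by simp
qed


section \<open>The dimension formula\<close>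

lemma ahlfors_spaceI:
  fixes \<mu> :: "'a::metric_space measure"
  assumes compact: "compact (UNIV :: 'a set)" and nontriv: "\<exists>x y :: 'a. x \<noteq> y"
    and \<mu>: "prob_space \<mu>" "sets \<mu> = sets borel" and t: "0 < t" and reg: "ahlfors_regular t \<mu>"
  shows "\<exists>C. ahlfors_space \<mu> t C"
proof -
  interpret prob_space \<mu> by (rule \<mu>)
  let ?D = "diameter (UNIV :: 'a set)"
  obtain x y :: 'a where "x \<noteq> y" using nontriv by blast
  then have "0 < dist x y" by simp
  also have "\<dots> \<le> ?D" using compact_imp_bounded[OF compact] by (intro diameter_bounded_bound) auto
  finally have D: "0 < ?D" .
  obtain C1 where C1: "0 < C1" "\<And>(x :: 'a) r. 0 < r \<Longrightarrow> r < ?D \<Longrightarrow>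
      ennreal (inverse C1 * r powr t) \<le> emeasure \<mu> (cball x r) \<and> emeasure \<mu> (cball x r) \<le> ennreal (C1 * r powr t)"
    using reg unfolding ahlfors_regular_def by blast
  \<comment> \<open>For radii above the diameter, \<open>1 \<le> C * r powr t\<close> suffices,
    since \<open>\<mu>\<close> is a probability measure.\<close>
  define C where "C = max C1 (1 / ?D powr t)"
  have C: "0 < C" "C1 \<le> C" "1 / ?D powr t \<le> C" using C1(1) by (auto simp: C_def)
  have "ahlfors_space \<mu> t C"
  proof unfold_locales
    show "compact (UNIV :: 'a set)" "sets \<mu> = sets borel" "0 < t" "0 < C" "0 < ?D" by fact+
    show "r powr t / C \<le> measure \<mu> (cball x r)" if r: "0 < r" "r < ?D" for r x
    proof -
      have "inverse C1 * r powr t \<le> measure \<mu> (cball x r)"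
        using C1(2)[OF r, of x] by (simp add: emeasure_eq_measure)
      moreover have "r powr t / C \<le> r powr t / C1" using C C1(1) by (intro divide_left_mono) auto
      ultimately show ?thesis by (simp add: divide_inverse mult.commute)
    qed
    show "measure \<mu> (cball x r) \<le> C * r powr t" if r: "0 < r" for r x
    proof (cases "r < ?D")
      case True
      have "measure \<mu> (cball x r) \<le> C1 * r powr t"
        using C1(2)[OF r True, of x] C1(1) by (simp add: emeasure_eq_measure ennreal_le_iff)
      also have "\<dots> \<le> C * r powr t" using C(2) by (intro mult_right_mono) auto
      finally show ?thesis .
    next
      case False
      have "measure \<mu> (cball x r) \<le> (1 / ?D powr t) * ?D powr t" using D by simp
      also have "\<dots> \<le> C * r powr t"
        using C False D t by (intro mult_mono powr_mono2) auto
      finally show ?thesis .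
    qed
  qed
  then show ?thesis ..
qed

lemma analytic_via_closed_image:
  fixes F :: "'a::topological_space set"
  assumes "analytic_via TYPE('b::polish_space) F"
  obtains S :: "('b::polish_space \<times> (nat \<Rightarrow> nat discrete)) set" and g where "closed S" "continuous_on S g" "F = g ` S"
proof -
  obtain B :: "'b set" and f where B: "B \<in> sets borel" "continuous_on B f" "F = f ` B"
    using assms unfolding analytic_via_def by blast
  obtain S :: "('b \<times> (nat \<Rightarrow> nat discrete)) set" where S: "closed S" "B = fst ` S"
    using borel_projection_of_closed[OF B(1)] by blast
  show thesis
  proof (rule that[OF S(1)])
    show "continuous_on S (f \<circ> fst)"
      using B(2) unfolding S(2) by (intro continuous_on_compose continuous_intros)
    show "F = (f \<circ> fst) ` S" using B(3) S(2) by (simp add: image_comp)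
  qed
qed

text \<open>With the next lemma this reduces an almost sure bound to countably many exponents, each
  with its own null set.\<close>

lemma ereal_le_of_rat_upper:
  assumes "\<And>u. u \<in> \<rat> \<Longrightarrow> x < ereal u \<Longrightarrow> y \<le> ereal u"
  shows "y \<le> x"
proof (rule ccontr)
  assume "\<not> y \<le> x"
  then have "x < y" by simp
  from ereal_dense2[OF this] obtain z where z: "x < ereal z" "ereal z < y" by blast
  from ereal_dense2[OF z(2)] obtain w where w: "ereal z < ereal w" "ereal w < y" by blast
  obtain u where u: "u \<in> \<rat>" "z < u" "u < w" using Rats_dense_in_real[of z w] w(1) by auto
  have "y \<le> ereal u" using u z(1) less_trans[of x "ereal z" "ereal u"] by (intro assms) simp_all
  moreover have "ereal u < y" using u(3) w(2) less_trans[of "ereal u" "ereal w" y] by simp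
  ultimately show False by simp
qed

lemma ereal_le_of_rat_lower:
  assumes "\<And>u. u \<in> \<rat> \<Longrightarrow> ereal u < x \<Longrightarrow> ereal u \<le> y"
  shows "x \<le> y"
proof (rule ccontr)
  assume "\<not> x \<le> y"
  then have "y < x" by simp
  from ereal_dense2[OF this] obtain z where z: "y < ereal z" "ereal z < x" by blast
  from ereal_dense2[OF z(2)] obtain w where w: "ereal z < ereal w" "ereal w < x" by blast
  obtain u where u: "u \<in> \<rat>" "z < u" "u < w" using Rats_dense_in_real[of z w] w(1) by auto
  have "ereal u \<le> y" using u w(2) less_trans[of "ereal u" "ereal w" x] by (intro assms) simp_all
  moreover have "y < ereal u" using u(2) z(1) less_trans[of y "ereal z" "ereal u"] by simp
  ultimately show False by simp
qed

lemma limsup_log_ratio_nonneg: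
  fixes r :: "nat \<Rightarrow> real"
  assumes "\<And>n. 0 < r n" "r \<longlonglongrightarrow> 0"
  shows "0 \<le> limsup (\<lambda>n. ereal (ln (real n) / - ln (r n)))"
proof (rule le_Limsup)
  have "\<forall>\<^sub>F n in sequentially. r n < 1" using order_tendstoD(2)[OF assms(2), of 1] by simp
  moreover have "\<forall>\<^sub>F n in sequentially. 1 \<le> n" by (rule eventually_ge_at_top)
  ultimately show "\<forall>\<^sub>F n in sequentially. 0 \<le> ereal (ln (real n) / - ln (r n))"
  proof eventually_elim
    case (elim n)
    have "0 < - ln (r n)" using elim assms(1)[of n] by (simp add: ln_less_zero)
    moreover have "0 \<le> ln (real n)" using elim by simp
    ultimately have "0 \<le> ln (real n) / - ln (r n)" by (intro divide_nonneg_pos)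
    then show ?case by simp
  qed
qed simp

section \<open>From fixed exponents to the exact bounds\<close>

context ahlfors_space
begin

lemma AE_lower:
  fixes g :: "'c::{complete_space, second_countable_topology} \<Rightarrow> 'a"
  assumes S: "closed S" "continuous_on S g"
    and r: "\<And>n. 0 < r n" "decseq r" "r \<longlonglongrightarrow> 0"
    and \<alpha>: "\<alpha> = min (ereal t) (limsup (\<lambda>n. ereal (ln (real n) / - ln (r n))))"
  shows "AE x in \<Omega>. max 0 (\<alpha> + hausdorff_dim (g ` S) - ereal t) \<le> hausdorff_dim (covering_set r x \<inter> g ` S)"
proof -
  have "0 \<le> \<alpha>" "\<alpha> \<le> ereal t" unfolding \<alpha> using limsup_log_ratio_nonneg[of r] r t_pos by auto
  then obtain a where a: "\<alpha> = ereal a" by (cases \<alpha>) auto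
  have at: "a \<le> t" "ereal a \<le> limsup (\<lambda>n. ereal (ln (real n) / - ln (r n)))"
  proof -
    show "a \<le> t" using \<open>\<alpha> \<le> ereal t\<close> a by simp
    show "ereal a \<le> limsup (\<lambda>n. ereal (ln (real n) / - ln (r n)))"
      unfolding a[symmetric] \<alpha> by (rule min.cobounded2)
  qed
  let ?d = "hausdorff_dim (g ` S)"
  have "AE x in \<Omega>. ereal s \<le> hausdorff_dim (covering_set r x \<inter> g ` S)"
    if s: "0 < s" "ereal s < \<alpha> + ?d - ereal t" for s
  proof -
    have "ereal (s + (t - a)) < ?d" using s(2) unfolding a by (cases ?d) auto
    from ereal_dense2[OF this] obtain q where q: "s + (t - a) < q" "ereal q < ?d" by auto
    \<comment> \<open>Half of the slack in \<open>s + (t - a) < q\<close> goes to \<open>b\<close>,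
      which has to lie strictly below the limsup.\<close>
    define b where "b = a - (q - (s + (t - a))) / 2"
    have b: "b < a" "s + (t - b) < q" using q(1) by (auto simp: b_def field_simps)
    have "ereal b < limsup (\<lambda>n. ereal (ln (real n) / - ln (r n)))"
      using b(1) at(2) by (auto intro: less_le_trans[of _ "ereal a"])
    then show ?thesis using b at(1) s(1) q(2) by (intro dimension_lower_bound[OF S r]) auto
  qed
  then have "AE x in \<Omega>. \<forall>s\<in>{s\<in>\<rat>. 0 < s \<and> ereal s < \<alpha> + ?d - ereal t}.
      ereal s \<le> hausdorff_dim (covering_set r x \<inter> g ` S)"
    by (subst AE_ball_countable) (auto intro: countable_subset[OF _ countable_rat])
  then show ?thesis
  proof (rule AE_mp, intro AE_I2 impI)
    fix x assume *: "\<forall>s\<in>{s\<in>\<rat>. 0 < s \<and> ereal s < \<alpha> + ?d - ereal t}.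
      ereal s \<le> hausdorff_dim (covering_set r x \<inter> g ` S)"
    have "\<alpha> + ?d - ereal t \<le> hausdorff_dim (covering_set r x \<inter> g ` S)"
    proof (rule ereal_le_of_rat_lower)
      fix s assume "s \<in> \<rat>" "ereal s < \<alpha> + ?d - ereal t"
      \<comment> \<open>Only positive exponents were treated; for the others nonnegativity of the
        dimension suffices.\<close>
      then show "ereal s \<le> hausdorff_dim (covering_set r x \<inter> g ` S)"
        using * hausdorff_dim_nonneg[of "covering_set r x \<inter> g ` S"]
        by (cases "0 < s") (auto intro: order_trans[of _ 0])
    qed
    then show "max 0 (\<alpha> + ?d - ereal t) \<le> hausdorff_dim (covering_set r x \<inter> g ` S)"
      by (simp add: hausdorff_dim_nonneg)
  qed
qed

lemma AE_upper:
  assumes r: "\<And>n. 0 < r n" "r \<longlonglongrightarrow> 0"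
    and \<alpha>: "\<alpha> = min (ereal t) (limsup (\<lambda>n. ereal (ln (real n) / - ln (r n))))"
  shows "AE x in \<Omega>. hausdorff_dim (covering_set r x \<inter> F) \<le> max 0 (\<alpha> + packing_dim F - ereal t)"
proof (cases "ereal t \<le> limsup (\<lambda>n. ereal (ln (real n) / - ln (r n)))")
  case True
  then have "\<alpha> = ereal t" using \<alpha> by simp
  then have "\<alpha> + packing_dim F - ereal t = packing_dim F" by (cases "packing_dim F") auto
  moreover have "hausdorff_dim (covering_set r x \<inter> F) \<le> packing_dim F" for x
    by (rule hausdorff_dim_le_packing_dim) auto
  ultimately show ?thesis by (simp add: max.coboundedI2)
next
  case False
  let ?L = "limsup (\<lambda>n. ereal (ln (real n) / - ln (r n)))"
  have L: "0 \<le> ?L" by (rule limsup_log_ratio_nonneg[OF r])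
  \<comment> \<open>Below \<open>t\<close> the limsup is finite and equals \<open>\<alpha>\<close>,
    so real exponents \<open>b\<close> above it are available.\<close>
  with False obtain l where l: "?L = ereal l" "0 \<le> l" "l < t" by (cases ?L) auto
  then have \<alpha>l: "\<alpha> = ereal l" using \<alpha> by simp
  let ?m = "max 0 (\<alpha> + packing_dim F - ereal t)"
  have "AE x in \<Omega>. hausdorff_dim (covering_set r x \<inter> F) \<le> ereal u" if u: "?m < ereal u" for u
  proof -
    have "0 < u" using u by simp
    have "packing_dim F < ereal (u + t - l)" using u unfolding \<alpha>l by (cases "packing_dim F") auto
    from ereal_dense2[OF this] obtain s' where s': "packing_dim F < ereal s'" "s' < u + t - l" by auto
    \<comment> \<open>Makes \<open>b + s' = t + u\<close> exact, and \<open>s' < u + t - l\<close>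
      puts \<open>b\<close> above the limsup.\<close>
    define b where "b = u + t - s'"
    have "l < b" using s'(2) by (simp add: b_def)
    then show ?thesis using s'(1) l \<open>0 < u\<close>
      by (intro dimension_upper_bound[OF r, of b s']) (auto simp: b_def)
  qed
  moreover have cnt: "countable {u\<in>\<rat>. ?m < ereal u}"
    by (rule countable_subset[OF _ countable_rat]) blast
  ultimately have "AE x in \<Omega>. \<forall>u\<in>{u\<in>\<rat>. ?m < ereal u}. hausdorff_dim (covering_set r x \<inter> F) \<le> ereal u"
    unfolding AE_ball_countable[OF cnt] by blast
  then show ?thesis
  proof (rule AE_mp, intro AE_I2 impI)
    fix x assume *: "\<forall>u\<in>{u\<in>\<rat>. ?m < ereal u}. hausdorff_dim (covering_set r x \<inter> F) \<le> ereal u"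
    show "hausdorff_dim (covering_set r x \<inter> F) \<le> ?m"
    proof (rule ereal_le_of_rat_upper)
      fix u assume "u \<in> \<rat>" "?m < ereal u"
      then have "u \<in> {u\<in>\<rat>. ?m < ereal u}" by (intro CollectI conjI)
      with * show "hausdorff_dim (covering_set r x \<inter> F) \<le> ereal u" by (rule bspec)
    qed
  qed
qed

end

theorem theorem2p4:
  fixes \<mu> :: "'a::metric_space measure"
    and t :: real
    and r :: "nat \<Rightarrow> real"
    and \<alpha> :: ereal
    and F :: "'a set"
  assumes "compact (UNIV :: 'a set)"
    and "\<exists>x y :: 'a. x \<noteq> y"
    and "prob_space \<mu>"
    and "sets \<mu> = sets borel"
    and "0 < t"
    and "ahlfors_regular t \<mu>"
    and "\<And>n. 0 < r n"
    and "decseq r"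
    and "r \<longlonglongrightarrow> 0"
    and "\<alpha> = min (ereal t) (limsup (\<lambda>n. ereal (ln (real n) / - ln (r n))))"
    and "analytic_via TYPE('b::polish_space) F"
  shows "AE x in completion (\<Pi>\<^sub>M n\<in>(UNIV :: nat set). \<mu>).
           max 0 (\<alpha> + hausdorff_dim F - ereal t) \<le> hausdorff_dim (covering_set r x \<inter> F) \<and>
           hausdorff_dim (covering_set r x \<inter> F) \<le> max 0 (\<alpha> + packing_dim F - ereal t)"
proof -
  obtain C where "ahlfors_space \<mu> t C" using ahlfors_spaceI[OF assms(1-6)] ..
  then interpret ahlfors_space \<mu> t C .
  obtain S :: "('b \<times> (nat \<Rightarrow> nat discrete)) set" and g where S: "closed S" "continuous_on S g" "F = g ` S"
    by (rule analytic_via_closed_image[OF assms(11)])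
  show ?thesis
    using AE_lower[OF S(1,2) assms(7-10), folded S(3)] AE_upper[OF assms(7,9,10), of F]
    by (intro AE_completion AE_conjI)
qed

end
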